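(* (Chaos decomposition II.) Let $\mathcal H=\mathbb C$, so that $\mathcal{TP}(\mathbb C)=\bigoplus_{n=0}^\infty Z(\mathbb C[S_0(n)]:\mathbb C[S(n)])$. Then the elements $$\{\chi^{\lambda':\lambda}:\ n\ge0,\ \lambda\in\mathrm{Par}(n),\ \lambda'=\lambda+\square\}$$ are orthogonal (with respect to $\langle\cdot,\cdot\rangle_q$ for every $q\in\mathcal Z$) and span $\mathcal{TP}(\mathbb C)$. Moreover, for $N\in\mathbb N$, $$\{\chi^{\lambda':\lambda}:\ n\ge0,\ \lambda'=\lambda+\square,\ \lambda'\in\mathrm{Par}(n+1;\le N)\}$$ is an orthogonal basis for $\mathcal F_{1/N}(\mathbb C)$.
   Context: $S(n)$, $S_0(n)$ are the permutation groups of $\{1,\dots,n\}$ and $\{0,1,\dots,n\}$, with $S(n)\subset S_0(n)$ the permutations fixing $0$. For $\alpha\in S_0(n)$, $|\alpha|=(n+1)-\#\text{cycles}(\alpha)$. The adjoint on $\mathbb C[S_0(n)]$ is the antilinear extension of $\alpha^*=\alpha^{-1}$; $\chi_q$ is the linear extension of $\chi_q(\alpha)=q^{|\alpha|}$ (with $0^0=1$); $\mathcal Z=\{0\}\cup\{\pm1/N:N\in\mathbb N\}$. $Z(\mathbb C[S_0(n)]:\mathbb C[S(n)])=\{\eta\in\mathbb C[S_0(n)]:\sigma^{-1}\eta\sigma=\eta\ \ \forall\sigma\in S(n)\}$. $\mathrm{Par}(n)$ is the set of partitions of $n$, and $\mathrm{Par}(n+1;\le N)$ the set of partitions of $n+1$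 with at most $N$ parts. For $\lambda\in\mathrm{Par}(n)$, $\lambda'\in\mathrm{Par}(n+1)$, write $\lambda'=\lambda+\square$ if the Young diagram of $\lambda$ is obtained from that of $\lambda'$ by removing one box. In that case the restriction to $S(n)$ of the irreducible representation $\rho_{\lambda'}$ of $S_0(n)$ contains the irreducible representation $\lambda$ exactly once; with $p_\lambda$ the orthogonal projection onto this component, $\chi^{\lambda':\lambda}(\sigma)=\mathrm{Tr}(p_\lambda\rho_{\lambda'}(\sigma)p_\lambda)$, and $\chi^{\lambda':\lambda}$ is identified with $\sum_{\sigma\in S_0(n)}\chi^{\lambda':\lambda}(\sigma)\sigma\in\mathbb C[S_0(n)]$. For $\mathcal H=\mathbb C$ the $q$-inner product on $\bigoplus_nZ(\mathbb C[S_0(n)]:\mathbb C[S(n)])$ makes different $n$ orthogonal and is $\langle\eta,\zeta\rangle_q=n!\,\chi_q[\eta\zeta^*]$ for $\eta,\zeta\in Z(\mathbb C[S_0(n)]:\mathbb C[S(n)])$. It is positive semi-definite for $q\in\mathcal Z$; $\mathcal F_q(\mathbb C)$ is the Hilbert space completion of the quotient by its kernel. *)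

theory Defs
  imports Complex_Main "HOL-Library.Function_Algebras" "HOL-Combinatorics.Combinatorics"
begin

section \<open>Group algebras of finite symmetric groups\<close>

text \<open>
  Elements of the group algebra of the symmetric group of a finite set \<open>A\<close> of natural numbers
  are coefficient functions vanishing outside of that group, so that the group algebra of a
  subset of \<open>A\<close> is literally a subspace. The groups \<open>S(n)\<close> and \<open>S\<^sub>0(n)\<close> are \<open>Sym {1..n}\<close> and
  \<open>Sym {0..n}\<close>; products of permutations are compositions.
\<close>

type_synonym perm_fun = "nat \<Rightarrow> nat"
type_synonym galg = "perm_fun \<Rightarrow> complex"

definition Sym :: "nat set \<Rightarrow> perm_fun set" where
  "Sym A = {\<sigma>. \<sigma> permutes A}"

definition group_algebra :: "nat set \<Rightarrow> galg set" where
  "group_algebra A = {f. \<forall>\<sigma>. \<sigma> \<notin> Sym A \<longrightarrow> f \<sigma> = 0}"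

definition gdelta :: "perm_fun \<Rightarrow> galg" where
  "gdelta \<sigma> = (\<lambda>\<tau>. if \<tau> = \<sigma> then 1 else 0)"

definition gscale :: "complex \<Rightarrow> galg \<Rightarrow> galg" where
  "gscale c f = (\<lambda>\<sigma>. c * f \<sigma>)"

global_interpretation gvs: vector_space gscale
  by unfold_locales (auto simp: gscale_def algebra_simps)

definition gmul :: "nat set \<Rightarrow> galg \<Rightarrow> galg \<Rightarrow> galg" where
  "gmul A f g = (\<lambda>\<sigma>. \<Sum>\<tau>\<in>Sym A. f \<tau> * g (inv \<tau> \<circ> \<sigma>))"

definition gadj :: "nat set \<Rightarrow> galg \<Rightarrow> galg" where
  "gadj A f = (\<Sum>\<sigma>\<in>Sym A. gscale (cnj (f \<sigma>)) (gdelta (inv \<sigma>)))"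

definition ginner :: "nat set \<Rightarrow> galg \<Rightarrow> galg \<Rightarrow> complex" where
  "ginner A f g = (\<Sum>\<sigma>\<in>Sym A. f \<sigma> * cnj (g \<sigma>))"

definition rel_center :: "nat \<Rightarrow> galg set" where
  "rel_center n = {\<eta> \<in> group_algebra {0..n}. \<forall>\<sigma>\<in>Sym {1..n}.
     gmul {0..n} (gmul {0..n} (gdelta (inv \<sigma>)) \<eta>) (gdelta \<sigma>) = \<eta>}"

text \<open>Fixed points count as cycles: \<open>orbit \<alpha> i = {i}\<close> if \<open>\<alpha> i = i\<close>.\<close>

definition perm_length :: "nat \<Rightarrow> perm_fun \<Rightarrow> nat" where
  "perm_length n \<alpha> = (n + 1) - card (orbit \<alpha> ` {0..n})"

definition chi_q :: "real \<Rightarrow> nat \<Rightarrow> galg \<Rightarrow> complex" where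
  "chi_q q n f = (\<Sum>\<alpha>\<in>Sym {0..n}. f \<alpha> * complex_of_real (q ^ perm_length n \<alpha>))"

definition Zset :: "real set" where
  "Zset = {0} \<union> {1 / real N |N. N \<ge> 1} \<union> {- (1 / real N) |N. N \<ge> 1}"


section \<open>Partitions and irreducible representations of symmetric groups\<close>

definition Par :: "nat \<Rightarrow> nat list set" where
  "Par n = {\<mu>. sorted_wrt (\<ge>) \<mu> \<and> 0 \<notin> set \<mu> \<and> sum_list \<mu> = n}"

definition Par_le :: "nat \<Rightarrow> nat \<Rightarrow> nat list set" where
  "Par_le n N = {\<mu> \<in> Par n. length \<mu> \<le> N}"

definition diagram :: "nat list \<Rightarrow> (nat \<times> nat) set" where
  "diagram \<mu> = {(i, j). i < length \<mu> \<and> j < \<mu> ! i}"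

definition adds_box :: "nat list \<Rightarrow> nat list \<Rightarrow> bool" where
  "adds_box \<mu> \<nu> \<longleftrightarrow> (\<exists>b\<in>diagram \<nu>. diagram \<mu> = diagram \<nu> - {b})"

text \<open>
  The irreducible representation of \<open>Sym A\<close> belonging to a partition \<open>\<mu>\<close> of \<open>card A\<close> is the left
  ideal generated by a Young symmetrizer (row symmetrizer times column antisymmetrizer, so that
  a single row gives the trivial representation), with the left regular action. This is unitary
  for the standard inner product \<open>ginner A\<close>. Different tableaux give isomorphic representations.
\<close>

definition tableau :: "nat set \<Rightarrow> nat list \<Rightarrow> nat \<times> nat \<Rightarrow> nat" where
  "tableau A \<mu> = (SOME t. bij_betw t (diagram \<mu>) A)"

definition row_group :: "nat set \<Rightarrow> nat list \<Rightarrow> perm_fun set" where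
  "row_group A \<mu> = {\<sigma> \<in> Sym A. \<forall>i j. (i, j) \<in> diagram \<mu> \<longrightarrow>
     (\<exists>k. (i, k) \<in> diagram \<mu> \<and> \<sigma> (tableau A \<mu> (i, j)) = tableau A \<mu> (i, k))}"

definition column_group :: "nat set \<Rightarrow> nat list \<Rightarrow> perm_fun set" where
  "column_group A \<mu> = {\<sigma> \<in> Sym A. \<forall>i j. (i, j) \<in> diagram \<mu> \<longrightarrow>
     (\<exists>k. (k, j) \<in> diagram \<mu> \<and> \<sigma> (tableau A \<mu> (i, j)) = tableau A \<mu> (k, j))}"

definition young_symmetrizer :: "nat set \<Rightarrow> nat list \<Rightarrow> galg" where
  "young_symmetrizer A \<mu> =
     gmul A (\<Sum>\<sigma>\<in>row_group A \<mu>. gdelta \<sigma>)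
            (\<Sum>\<sigma>\<in>column_group A \<mu>. gscale (of_int (sign \<sigma>)) (gdelta \<sigma>))"

definition irrep_space :: "nat set \<Rightarrow> nat list \<Rightarrow> galg set" where
  "irrep_space A \<mu> = {gmul A x (young_symmetrizer A \<mu>) |x. x \<in> group_algebra A}"

definition irrep_action :: "nat set \<Rightarrow> perm_fun \<Rightarrow> galg \<Rightarrow> galg" where
  "irrep_action A \<sigma> v = gmul A (gdelta \<sigma>) v"


section \<open>Relative characters\<close>

text \<open>
  The unique \<open>S(n)\<close>-subrepresentation of the restriction of \<open>\<nu>\<close> that is isomorphic to \<open>\<mu>\<close>:
  the image of the irreducible representation \<open>\<mu>\<close> under an injective intertwiner. (A linear map
  on a subspace extends to the whole ambient vector space, so \<open>\<phi>\<close> may be taken globally linear.)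
\<close>

definition branch_component :: "nat \<Rightarrow> nat list \<Rightarrow> nat list \<Rightarrow> galg set" where
  "branch_component n \<mu> \<nu> = (THE W. W \<subseteq> irrep_space {0..n} \<nu> \<and>
     (\<exists>\<phi>. Vector_Spaces.linear gscale gscale \<phi> \<and>
          bij_betw \<phi> (irrep_space {1..n} \<mu>) W \<and>
          (\<forall>\<sigma>\<in>Sym {1..n}. \<forall>v\<in>irrep_space {1..n} \<mu>.
             \<phi> (irrep_action {1..n} \<sigma> v) = irrep_action {0..n} \<sigma> (\<phi> v))))"

definition orth_proj :: "nat set \<Rightarrow> galg set \<Rightarrow> galg \<Rightarrow> galg" where
  "orth_proj A W v = (THE w. w \<in> W \<and> (\<forall>u\<in>W. ginner A (v - w) u = 0))"

definition basis_of :: "galg set \<Rightarrow> galg set" where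
  "basis_of V = (SOME B. gvs.independent B \<and> gvs.span B = V)"

text \<open>Trace of an endomorphism of a finite-dimensional subspace \<open>V\<close>: the sum of the diagonal
  coefficients with respect to any basis of \<open>V\<close>.\<close>

definition trace_on :: "galg set \<Rightarrow> (galg \<Rightarrow> galg) \<Rightarrow> complex" where
  "trace_on V T = (\<Sum>b\<in>basis_of V. gvs.representation (basis_of V) (T b) b)"

definition rel_char :: "nat \<Rightarrow> nat list \<Rightarrow> nat list \<Rightarrow> perm_fun \<Rightarrow> complex" where
  "rel_char n \<mu> \<nu> \<sigma> =
     (let p = orth_proj {0..n} (branch_component n \<mu> \<nu>)
      in trace_on (irrep_space {0..n} \<nu>) (p \<circ> irrep_action {0..n} \<sigma> \<circ> p))"

definition rel_char_elt :: "nat \<Rightarrow> nat list \<Rightarrow> nat list \<Rightarrow> galg" where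
  "rel_char_elt n \<mu> \<nu> = (\<Sum>\<sigma>\<in>Sym {0..n}. gscale (rel_char n \<mu> \<nu> \<sigma>) (gdelta \<sigma>))"


section \<open>The space \<open>TP(\<complex>)\<close> and its \<open>q\<close>-inner product\<close>

type_synonym tp = "nat \<Rightarrow> galg"

definition tscale :: "complex \<Rightarrow> tp \<Rightarrow> tp" where
  "tscale c f = (\<lambda>n. gscale c (f n))"

global_interpretation tvs: vector_space tscale
  by unfold_locales (auto simp: tscale_def gscale_def algebra_simps fun_eq_iff)

definition TP :: "tp set" where
  "TP = {f. (\<forall>n. f n \<in> rel_center n) \<and> finite {n. f n \<noteq> 0}}"

definition in_degree :: "nat \<Rightarrow> galg \<Rightarrow> tp" where
  "in_degree n \<eta> = (\<lambda>m. if m = n then \<eta> else 0)"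

definition q_inner :: "real \<Rightarrow> tp \<Rightarrow> tp \<Rightarrow> complex" where
  "q_inner q f g = (\<Sum>n | f n \<noteq> 0. fact n * chi_q q n (gmul {0..n} (f n) (gadj {0..n} (g n))))"

definition box_pairs :: "(nat \<times> nat list \<times> nat list) set" where
  "box_pairs = {(n, \<mu>, \<nu>). \<mu> \<in> Par n \<and> \<nu> \<in> Par (n + 1) \<and> adds_box \<mu> \<nu>}"

definition box_pairs_le :: "nat \<Rightarrow> (nat \<times> nat list \<times> nat list) set" where
  "box_pairs_le N = {(n, \<mu>, \<nu>). \<mu> \<in> Par n \<and> \<nu> \<in> Par_le (n + 1) N \<and> adds_box \<mu> \<nu>}"

fun chaos_elt :: "nat \<times> nat list \<times> nat list \<Rightarrow> tp" where
  "chaos_elt (n, \<mu>, \<nu>) = in_degree n (rel_char_elt n \<mu> \<nu>)"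


section \<open>Hilbert space completion of a semi-inner product space\<close>

record 'h hilb =
  hcarrier :: "'h set"
  hzero :: 'h
  hadd :: "'h \<Rightarrow> 'h \<Rightarrow> 'h"
  hscale :: "complex \<Rightarrow> 'h \<Rightarrow> 'h"
  hinner :: "'h \<Rightarrow> 'h \<Rightarrow> complex"

definition hdist :: "'h hilb \<Rightarrow> 'h \<Rightarrow> 'h \<Rightarrow> real" where
  "hdist H x y = (let z = hadd H x (hscale H (- 1) y) in sqrt (Re (hinner H z z)))"

inductive_set hspan :: "'h hilb \<Rightarrow> 'h set \<Rightarrow> 'h set" for H S where
  zero: "hzero H \<in> hspan H S"
| step: "s \<in> S \<Longrightarrow> x \<in> hspan H S \<Longrightarrow> hadd H (hscale H c s) x \<in> hspan H S"

text \<open>A family of pairwise orthogonal nonzero vectors whose closed linear span is everything.\<close>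

definition orthogonal_basis :: "'h hilb \<Rightarrow> 'i set \<Rightarrow> ('i \<Rightarrow> 'h) \<Rightarrow> bool" where
  "orthogonal_basis H I e \<longleftrightarrow>
     (\<forall>i\<in>I. e i \<in> hcarrier H \<and> e i \<noteq> hzero H) \<and>
     (\<forall>i\<in>I. \<forall>j\<in>I. i \<noteq> j \<longrightarrow> hinner H (e i) (e j) = 0) \<and>
     (\<forall>x\<in>hcarrier H. \<forall>\<epsilon>>0. \<exists>y\<in>hspan H (e ` I). hdist H x y < \<epsilon>)"

definition semi_norm :: "('v \<Rightarrow> 'v \<Rightarrow> complex) \<Rightarrow> 'v \<Rightarrow> real" where
  "semi_norm ip x = sqrt (Re (ip x x))"

definition cauchy_seqs ::
    "'v::ab_group_add set \<Rightarrow> ('v \<Rightarrow> 'v \<Rightarrow> complex) \<Rightarrow> (nat \<Rightarrow> 'v) set" where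
  "cauchy_seqs V ip = {X. range X \<subseteq> V \<and>
     (\<forall>\<epsilon>>0. \<exists>M. \<forall>m\<ge>M. \<forall>k\<ge>M. semi_norm ip (X m - X k) < \<epsilon>)}"

text \<open>
  Sequences are identified if their distance tends to zero. Constant sequences are identified
  if and only if they differ by an element of the kernel of the semi-inner product, so this
  quotient of the space of Cauchy sequences is the completion of the quotient of \<open>V\<close> by the kernel.
\<close>

definition cauchy_rel ::
    "'v::ab_group_add set \<Rightarrow> ('v \<Rightarrow> 'v \<Rightarrow> complex) \<Rightarrow> ((nat \<Rightarrow> 'v) \<times> (nat \<Rightarrow> 'v)) set" where
  "cauchy_rel V ip = {(X, Y). X \<in> cauchy_seqs V ip \<and> Y \<in> cauchy_seqs V ip \<and>
     (\<lambda>k. semi_norm ip (X k - Y k)) \<longlonglongrightarrow> 0}"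

definition completion_embed ::
    "'v::ab_group_add set \<Rightarrow> ('v \<Rightarrow> 'v \<Rightarrow> complex) \<Rightarrow> 'v \<Rightarrow> (nat \<Rightarrow> 'v) set" where
  "completion_embed V ip x = cauchy_rel V ip `` {\<lambda>k. x}"

definition completion ::
    "(complex \<Rightarrow> 'v \<Rightarrow> 'v) \<Rightarrow> 'v::ab_group_add set \<Rightarrow> ('v \<Rightarrow> 'v \<Rightarrow> complex) \<Rightarrow>
     (nat \<Rightarrow> 'v) set hilb" where
  "completion s V ip =
     \<lparr> hcarrier = cauchy_seqs V ip // cauchy_rel V ip,
       hzero = completion_embed V ip 0,
       hadd = (\<lambda>\<xi> \<eta>. cauchy_rel V ip `` {\<lambda>k. X k + Y k |X Y. X \<in> \<xi> \<and> Y \<in> \<eta>}),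
       hscale = (\<lambda>c \<xi>. cauchy_rel V ip `` {\<lambda>k. s c (X k) |X. X \<in> \<xi>}),
       hinner = (\<lambda>\<xi> \<eta>. THE z. \<forall>X\<in>\<xi>. \<forall>Y\<in>\<eta>. (\<lambda>k. ip (X k) (Y k)) \<longlonglongrightarrow> z) \<rparr>"

definition Fock :: "real \<Rightarrow> (nat \<Rightarrow> tp) set hilb" where
  "Fock q = completion tscale TP (q_inner q)"

definition Fock_embed :: "real \<Rightarrow> tp \<Rightarrow> (nat \<Rightarrow> tp) set" where
  "Fock_embed q = completion_embed TP (q_inner q)"

end

theory Submission
  imports Defs
begin

text \<open>
  Write \<open>z\<^sub>\<mu>\<close> and \<open>z\<^sub>\<nu>\<close> for the central projections of \<open>\<complex>[S(n)]\<close> and \<open>\<complex>[S\<^sub>0(n)]\<close> belonging to the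
  partitions \<open>\<mu>\<close> of \<open>n\<close> and \<open>\<nu>\<close> of \<open>n + 1\<close>. The projection onto the component \<open>\<mu>\<close> of the irreducible
  representation \<open>\<nu>\<close> is multiplication by \<open>z\<^sub>\<mu>\<close>, and computing traces on a left ideal then shows that
  the relative character is a nonzero multiple of the product \<open>z\<^sub>\<mu> z\<^sub>\<nu>\<close> (\<open>rel_char_elt_eq\<close>). These
  products are self-adjoint idempotents, and different ones multiply to zero; this makes the
  relative characters orthogonal for every \<open>q\<close>.

  Central projections come from Young symmetrizers. If \<open>e\<close> is an idempotent with \<open>e \<complex>[G] e = \<complex> e\<close>, then
  \<open>e g e = (e(g\<^sup>-\<^sup>1) / e(1)) e\<close>, and this single formula (\<open>prim_sandwich\<close>) replaces Schur
  orthogonality: it shows that \<open>e(1) \<Sum>\<^sub>g g e g\<^sup>-\<^sup>1\<close> is the central projection of \<open>e\<close>. That a normalized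
  Young symmetrizer is such an idempotent, and that different shapes give disjoint blocks, rests
  on the combinatorics of fillings, which is settled by comparing total weights (\<open>filling_compare\<close>).

  For the span, \<open>z\<^sub>\<mu> z\<^sub>\<nu> \<noteq> 0\<close> whenever \<open>\<nu>\<close> arises from \<open>\<mu>\<close> by adding a box, because the row and column
  groups of \<open>\<mu>\<close> embed into those of \<open>\<nu>\<close> (\<open>branching_nonzero\<close>). So there are at least as many
  independent elements as such pairs of shapes. Conversely the dimension of the relative center is
  the number of \<open>S(n)\<close>-conjugacy classes of \<open>S\<^sub>0(n)\<close>. A class is determined by its cycle type together
  with the length of the cycle through \<open>0\<close>, that is by a partition of \<open>n + 1\<close> with a marked part, and
  shrinking that part by one gives a pair of shapes (\<open>marked_shape_conjugate\<close>). Hence the products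
  \<open>z\<^sub>\<mu> z\<^sub>\<nu>\<close> span (\<open>rel_center_span\<close>). In particular the relative center is commutative, so the
  restriction of \<open>\<nu>\<close> is multiplicity free (\<open>intertwiners_one_dim\<close>), which is what makes the component
  \<open>\<mu>\<close> well defined in the first place.

  For \<open>q = 1/N\<close>, the functional \<open>\<chi>\<^sub>q\<close> is the normalized trace of the permutation action on words of
  length \<open>n + 1\<close> in \<open>N\<close> letters, so \<open>\<chi>\<^sub>q(x x\<^sup>*)\<close> vanishes if and only if \<open>x\<close> acts as zero. For \<open>z\<^sub>\<mu> z\<^sub>\<nu>\<close>
  this happens exactly if \<open>\<nu>\<close> has more than \<open>N\<close> rows (\<open>null_iff\<close>): then every word repeats a letter
  along the first column, while otherwise the row numbers form a word whose stabilizer is the row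
  group. So the relative characters with at most \<open>N\<close> rows have positive norm, the other ones are null
  vectors, and passing to the completion gives the orthogonal basis.
\<close>

section \<open>Convolution in the group algebra\<close>

locale ground =
  fixes A :: "nat set"
  assumes fin: "finite A"
begin

abbreviation G where "G \<equiv> Sym A"
abbreviation GA where "GA \<equiv> group_algebra A"
abbreviation mul (infixl "\<odot>" 70) where "f \<odot> g \<equiv> gmul A f g"
abbreviation adj where "adj f \<equiv> gadj A f"
abbreviation one where "one \<equiv> gdelta id"

lemma finite_G [simp]: "finite G"
  unfolding Sym_def using finite_permutations[OF fin] by simp

lemma G_id [simp]: "id \<in> G"
  by (simp add: Sym_def permutes_id)

lemma G_comp [simp]: "\<sigma> \<in> G \<Longrightarrow> \<tau> \<in> G \<Longrightarrow> \<sigma> \<circ> \<tau> \<in> G"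
  by (simp add: Sym_def permutes_compose)

lemma G_inv [simp]: "\<sigma> \<in> G \<Longrightarrow> inv \<sigma> \<in> G"
  by (simp add: Sym_def permutes_inv)

lemma G_inv_inv [simp]: "\<sigma> \<in> G \<Longrightarrow> inv (inv \<sigma>) = \<sigma>"
  by (simp add: Sym_def permutes_inv_inv)

lemma G_bij: "\<sigma> \<in> G \<Longrightarrow> bij \<sigma>"
  by (auto simp: Sym_def permutes_bij)

lemma G_inv_o [simp]: "\<sigma> \<in> G \<Longrightarrow> inv \<sigma> \<circ> \<sigma> = id" "\<sigma> \<in> G \<Longrightarrow> \<sigma> \<circ> inv \<sigma> = id"
  by (auto simp: Sym_def permutes_inv_o)

lemma G_inv_app [simp]: "\<sigma> \<in> G \<Longrightarrow> inv \<sigma> (\<sigma> x) = x" "\<sigma> \<in> G \<Longrightarrow> \<sigma> (inv \<sigma> x) = x"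
  by (auto simp: Sym_def permutes_inverses)

lemma G_inv_comp: "\<sigma> \<in> G \<Longrightarrow> \<tau> \<in> G \<Longrightarrow> inv (\<sigma> \<circ> \<tau>) = inv \<tau> \<circ> inv \<sigma>"
  using G_bij by (simp add: o_inv_distrib)

lemma G_cancel [simp]:
  assumes "\<sigma> \<in> G"
  shows "inv \<sigma> \<circ> (\<sigma> \<circ> \<tau>) = \<tau>" "\<sigma> \<circ> (inv \<sigma> \<circ> \<tau>) = \<tau>"
    "\<tau> \<circ> \<sigma> \<circ> inv \<sigma> = \<tau>" "\<tau> \<circ> inv \<sigma> \<circ> \<sigma> = \<tau>"
  using assms by (auto simp: fun_eq_iff)

lemma G_in_A [simp]: "\<sigma> \<in> G \<Longrightarrow> \<sigma> x \<in> A \<longleftrightarrow> x \<in> A"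
  by (simp add: Sym_def permutes_in_image)

lemma G_comp_left_iff: "\<sigma> \<in> G \<Longrightarrow> \<sigma> \<circ> \<tau> \<in> G \<longleftrightarrow> \<tau> \<in> G"
  by (metis G_cancel(1) G_comp G_inv)

lemma G_inv_eq_id: "\<sigma> \<in> G \<Longrightarrow> inv \<sigma> \<circ> \<tau> = id \<longleftrightarrow> \<tau> = \<sigma>"
  by (metis G_cancel(2) G_inv_o(1) comp_id)

lemma sum_translate:
  assumes "\<rho> \<in> G" shows "(\<Sum>\<tau>\<in>G. F (\<rho> \<circ> \<tau>)) = (\<Sum>\<tau>\<in>G. F \<tau>)"
  by (rule sum.reindex_bij_witness[where i="\<lambda>\<tau>. inv \<rho> \<circ> \<tau>" and j="\<lambda>\<tau>. \<rho> \<circ> \<tau>"])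
     (use assms in auto)

lemma sum_inv: "(\<Sum>\<tau>\<in>G. F (inv \<tau>)) = (\<Sum>\<tau>\<in>G. F \<tau>)"
  by (rule sum.reindex_bij_witness[where i=inv and j=inv]) auto

lemma GA_iff: "f \<in> GA \<longleftrightarrow> (\<forall>\<sigma>. \<sigma> \<notin> G \<longrightarrow> f \<sigma> = 0)"
  by (simp add: group_algebra_def)

lemma GA_zero_outside: "f \<in> GA \<Longrightarrow> \<sigma> \<notin> G \<Longrightarrow> f \<sigma> = 0"
  by (simp add: GA_iff)

lemma GA_0 [simp]: "0 \<in> GA" by (simp add: GA_iff)
lemma GA_add [simp]: "f \<in> GA \<Longrightarrow> g \<in> GA \<Longrightarrow> f + g \<in> GA" by (simp add: GA_iff)
lemma GA_diff [simp]: "f \<in> GA \<Longrightarrow> g \<in> GA \<Longrightarrow> f - g \<in> GA" by (simp add: GA_iff)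
lemma GA_scale [simp]: "f \<in> GA \<Longrightarrow> gscale c f \<in> GA" by (simp add: GA_iff gscale_def)
lemma GA_delta [simp]: "\<sigma> \<in> G \<Longrightarrow> gdelta \<sigma> \<in> GA" by (auto simp: GA_iff gdelta_def)
lemma GA_sum: "(\<And>i. i \<in> I \<Longrightarrow> f i \<in> GA) \<Longrightarrow> sum f I \<in> GA"
  by (induction I rule: infinite_finite_induct) simp_all
lemma GA_mul [simp]: "g \<in> GA \<Longrightarrow> f \<odot> g \<in> GA"
  by (auto simp: GA_iff gmul_def G_comp_left_iff)

lemma mul_assoc: "f \<odot> g \<odot> h = f \<odot> (g \<odot> h)"
proof
  fix \<sigma>
  have "(f \<odot> g \<odot> h) \<sigma> = (\<Sum>\<tau>\<in>G. \<Sum>\<rho>\<in>G. f \<rho> * (g (inv \<rho> \<circ> \<tau>) * h (inv \<tau> \<circ> \<sigma>)))"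
    by (simp add: gmul_def sum_distrib_right mult.assoc)
  also have "\<dots> = (\<Sum>\<rho>\<in>G. \<Sum>\<tau>\<in>G. f \<rho> * (g (inv \<rho> \<circ> \<tau>) * h (inv \<tau> \<circ> \<sigma>)))"
    by (rule sum.swap)
  also have "\<dots> = (\<Sum>\<rho>\<in>G. \<Sum>\<tau>\<in>G. f \<rho> * (g \<tau> * h (inv \<tau> \<circ> (inv \<rho> \<circ> \<sigma>))))"
  proof (rule sum.cong[OF refl])
    fix \<rho> assume r: "\<rho> \<in> G"
    show "(\<Sum>\<tau>\<in>G. f \<rho> * (g (inv \<rho> \<circ> \<tau>) * h (inv \<tau> \<circ> \<sigma>))) =
          (\<Sum>\<tau>\<in>G. f \<rho> * (g \<tau> * h (inv \<tau> \<circ> (inv \<rho> \<circ> \<sigma>))))"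
      by (subst sum_translate[OF r, symmetric], rule sum.cong[OF refl])
         (use r in \<open>simp add: G_inv_comp comp_assoc\<close>)
  qed
  also have "\<dots> = (f \<odot> (g \<odot> h)) \<sigma>"
    by (simp add: gmul_def sum_distrib_left)
  finally show "(f \<odot> g \<odot> h) \<sigma> = (f \<odot> (g \<odot> h)) \<sigma>" .
qed

lemma mul_add_left: "(f + g) \<odot> h = f \<odot> h + g \<odot> h"
  by (simp add: gmul_def fun_eq_iff sum.distrib algebra_simps)
lemma mul_add_right: "h \<odot> (f + g) = h \<odot> f + h \<odot> g"
  by (simp add: gmul_def fun_eq_iff sum.distrib algebra_simps)
lemma mul_diff_left: "(f - g) \<odot> h = f \<odot> h - g \<odot> h"
  by (simp add: gmul_def fun_eq_iff sum_subtractf algebra_simps)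
lemma mul_diff_right: "h \<odot> (f - g) = h \<odot> f - h \<odot> g"
  by (simp add: gmul_def fun_eq_iff sum_subtractf algebra_simps)
lemma mul_scale_left [simp]: "gscale c f \<odot> h = gscale c (f \<odot> h)"
  by (simp add: gmul_def gscale_def fun_eq_iff sum_distrib_left mult.assoc)
lemma mul_scale_right [simp]: "h \<odot> gscale c f = gscale c (h \<odot> f)"
  by (simp add: gmul_def gscale_def fun_eq_iff sum_distrib_left algebra_simps)
lemma mul_minus_right [simp]: "h \<odot> - f = - (h \<odot> f)"
  by (simp add: gmul_def fun_eq_iff sum_negf)
lemma mul_0_left [simp]: "0 \<odot> f = 0"
  by (simp add: gmul_def fun_eq_iff)
lemma mul_0_right [simp]: "f \<odot> 0 = 0"
  by (simp add: gmul_def fun_eq_iff)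
lemma mul_sum_left: "sum f I \<odot> h = (\<Sum>i\<in>I. f i \<odot> h)"
  by (induction I rule: infinite_finite_induct) (simp_all only: sum.infinite sum.empty sum.insert not_False_eq_True mul_add_left mul_0_left)
lemma mul_sum_right: "h \<odot> sum f I = (\<Sum>i\<in>I. h \<odot> f i)"
  by (induction I rule: infinite_finite_induct) (simp_all only: sum.infinite sum.empty sum.insert not_False_eq_True mul_add_right mul_0_right)

lemma delta_mul: "\<sigma> \<in> G \<Longrightarrow> gdelta \<sigma> \<odot> f = (\<lambda>\<tau>. f (inv \<sigma> \<circ> \<tau>))"
proof
  fix \<tau> assume s: "\<sigma> \<in> G"
  have "(gdelta \<sigma> \<odot> f) \<tau> = (\<Sum>\<rho>\<in>G. if \<rho> = \<sigma> then f (inv \<rho> \<circ> \<tau>) else 0)"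
    unfolding gmul_def by (rule sum.cong) (auto simp: gdelta_def)
  then show "(gdelta \<sigma> \<odot> f) \<tau> = f (inv \<sigma> \<circ> \<tau>)" using s by simp
qed

lemma delta_delta [simp]: "\<sigma> \<in> G \<Longrightarrow> gdelta \<sigma> \<odot> gdelta \<tau> = gdelta (\<sigma> \<circ> \<tau>)"
proof
  fix \<rho> assume s: "\<sigma> \<in> G"
  have "inv \<sigma> \<circ> \<rho> = \<tau> \<longleftrightarrow> \<rho> = \<sigma> \<circ> \<tau>" using s by auto
  then show "(gdelta \<sigma> \<odot> gdelta \<tau>) \<rho> = gdelta (\<sigma> \<circ> \<tau>) \<rho>"
    unfolding delta_mul[OF s] by (simp add: gdelta_def)
qed

lemma delta_delta' [simp]: "\<sigma> \<in> G \<Longrightarrow> gdelta \<sigma> \<odot> (gdelta \<tau> \<odot> f) = gdelta (\<sigma> \<circ> \<tau>) \<odot> f"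
  by (simp add: mul_assoc[symmetric])

lemma mul_one_left [simp]: "one \<odot> f = f"
  by (simp add: delta_mul)

lemma mul_one_right [simp]:
  assumes "f \<in> GA" shows "f \<odot> one = f"
proof
  fix \<sigma>
  have "(f \<odot> one) \<sigma> = (\<Sum>\<rho>\<in>G. if \<sigma> = \<rho> then f \<rho> else 0)"
    unfolding gmul_def by (rule sum.cong) (auto simp: gdelta_def G_inv_eq_id)
  then show "(f \<odot> one) \<sigma> = f \<sigma>" using GA_zero_outside[OF assms, of \<sigma>] by auto
qed

lemma sum_apply: "(sum f I :: galg) \<sigma> = (\<Sum>i\<in>I. f i \<sigma>)"
  by (induction I rule: infinite_finite_induct) simp_all

lemma sum_delta_apply:
  "(\<Sum>\<sigma>\<in>S. gscale (c \<sigma>) (gdelta \<sigma>)) \<tau> = (if finite S \<and> \<tau> \<in> S then c \<tau> else 0)"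
proof (cases "finite S")
  case True
  have "(\<Sum>\<sigma>\<in>S. gscale (c \<sigma>) (gdelta \<sigma>)) \<tau> = (\<Sum>\<sigma>\<in>S. if \<tau> = \<sigma> then c \<sigma> else 0)"
    unfolding sum_apply by (rule sum.cong) (auto simp: gscale_def gdelta_def)
  then show ?thesis using True by simp
qed simp

lemma expand: "f \<in> GA \<Longrightarrow> f = (\<Sum>\<sigma>\<in>G. gscale (f \<sigma>) (gdelta \<sigma>))"
  by (auto simp: fun_eq_iff sum_delta_apply GA_zero_outside)

lemma mul_expand_left: "f \<odot> h = (\<Sum>\<sigma>\<in>G. gscale (f \<sigma>) (gdelta \<sigma> \<odot> h))"
proof
  fix \<tau>
  show "(f \<odot> h) \<tau> = (\<Sum>\<sigma>\<in>G. gscale (f \<sigma>) (gdelta \<sigma> \<odot> h)) \<tau>"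
    unfolding sum_apply gmul_def[of A f] by (simp add: gscale_def delta_mul)
qed

lemma mul_expand_right:
  assumes "f \<in> GA" shows "h \<odot> f = (\<Sum>\<sigma>\<in>G. gscale (f \<sigma>) (h \<odot> gdelta \<sigma>))"
proof -
  have "h \<odot> f = h \<odot> (\<Sum>\<sigma>\<in>G. gscale (f \<sigma>) (gdelta \<sigma>))" using expand[OF assms] by simp
  then show ?thesis by (simp add: mul_sum_right)
qed

lemma trace_commute: "(f \<odot> g) id = (g \<odot> f) id"
  unfolding gmul_def by (subst sum_inv[symmetric]) (simp add: mult.commute)

lemma coeff_mul_delta: "\<sigma> \<in> G \<Longrightarrow> (f \<odot> gdelta \<sigma>) id = f (inv \<sigma>)"
  by (subst trace_commute) (simp add: delta_mul)

lemma adj_apply: "adj f \<sigma> = (if \<sigma> \<in> G then cnj (f (inv \<sigma>)) else 0)"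
proof -
  have "adj f = (\<Sum>\<tau>\<in>G. gscale (cnj (f (inv \<tau>))) (gdelta \<tau>))"
    unfolding gadj_def by (subst sum_inv[symmetric]) simp
  then show ?thesis by (simp add: sum_delta_apply)
qed

lemma adj_GA [simp]: "adj f \<in> GA"
  by (simp add: GA_iff adj_apply)

lemma adj_adj [simp]: "f \<in> GA \<Longrightarrow> adj (adj f) = f"
  by (auto simp: fun_eq_iff adj_apply GA_zero_outside)

lemma adj_scale [simp]: "adj (gscale c f) = gscale (cnj c) (adj f)"
  by (auto simp: fun_eq_iff adj_apply gscale_def)

lemma adj_0 [simp]: "adj 0 = 0"
  by (simp add: fun_eq_iff adj_apply)

lemma adj_add: "adj (f + g) = adj f + adj g"
  by (auto simp: fun_eq_iff adj_apply)

lemma adj_sum: "adj (sum f I) = (\<Sum>i\<in>I. adj (f i))"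
  by (induction I rule: infinite_finite_induct) (simp_all only: sum.infinite sum.empty sum.insert not_False_eq_True adj_add adj_0)

lemma adj_delta: "\<sigma> \<in> G \<Longrightarrow> adj (gdelta \<sigma>) = gdelta (inv \<sigma>)"
proof
  fix \<tau> assume s: "\<sigma> \<in> G"
  have "\<tau> \<in> G \<and> inv \<tau> = \<sigma> \<longleftrightarrow> \<tau> = inv \<sigma>" using s by auto
  then show "adj (gdelta \<sigma>) \<tau> = gdelta (inv \<sigma>) \<tau>" by (auto simp: adj_apply gdelta_def)
qed

lemma adj_mul: "f \<in> GA \<Longrightarrow> adj (f \<odot> g) = adj g \<odot> adj f"
proof
  fix \<sigma> assume f: "f \<in> GA"
  show "adj (f \<odot> g) \<sigma> = (adj g \<odot> adj f) \<sigma>"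
  proof (cases "\<sigma> \<in> G")
    case s: True
    have "(adj g \<odot> adj f) \<sigma> = (\<Sum>\<tau>\<in>G. cnj (g (inv \<tau>)) * cnj (f (inv \<sigma> \<circ> \<tau>)))"
      unfolding gmul_def by (rule sum.cong) (use s in \<open>auto simp: adj_apply G_inv_comp\<close>)
    also have "\<dots> = (\<Sum>\<tau>\<in>G. cnj (g (inv \<tau> \<circ> inv \<sigma>)) * cnj (f \<tau>))"
      by (subst sum_translate[OF s, symmetric], rule sum.cong)
         (use s in \<open>auto simp: G_inv_comp\<close>)
    finally show ?thesis using s by (simp add: adj_apply gmul_def mult.commute)
  next
    case False
    then show ?thesis using GA_mul[OF adj_GA] by (simp add: adj_apply GA_zero_outside)
  qed
qed

lemma ginner_eq: "ginner A f g = (f \<odot> adj g) id"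
  unfolding ginner_def gmul_def by (rule sum.cong) (auto simp: adj_apply)

lemma ginner_self_eq_0:
  assumes "f \<in> GA" "ginner A f f = 0" shows "f = 0"
proof -
  have "complex_of_real (\<Sum>\<sigma>\<in>G. (cmod (f \<sigma>))\<^sup>2) = 0"
    using assms(2) by (simp add: ginner_def complex_norm_square[symmetric] del: of_real_power)
  then have "(\<Sum>\<sigma>\<in>G. (cmod (f \<sigma>))\<^sup>2) = 0" using of_real_eq_0_iff by blast
  then have "\<forall>\<sigma>\<in>G. f \<sigma> = 0"
    by (subst (asm) sum_nonneg_eq_0_iff) auto
  then show ?thesis using GA_zero_outside[OF assms(1)] by (metis ext zero_fun_def)
qed

lemma mul_adj_eq_0: "f \<in> GA \<Longrightarrow> f \<odot> adj f = 0 \<Longrightarrow> f = 0"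
  by (rule ginner_self_eq_0) (simp_all add: ginner_eq)

text \<open>The algebra is semisimple in the following sense: \<open>f x f\<close> cannot vanish for all \<open>x\<close> unless
  \<open>f = 0\<close>, since it would vanish for \<open>x = f\<^sup>*\<close>.\<close>

lemma sandwich_eq_0:
  assumes f: "f \<in> GA" and "f \<odot> adj f \<odot> f = 0" shows "f = 0"
proof (rule mul_adj_eq_0[OF f])
  have "f \<odot> adj f \<odot> adj (f \<odot> adj f) = 0"
    using assms by (simp add: adj_mul mul_assoc[symmetric])
  then show "f \<odot> adj f = 0" by (rule mul_adj_eq_0[rotated]) simp
qed

end

lemma group_algebra_mono: "K \<subseteq> A \<Longrightarrow> group_algebra K \<subseteq> group_algebra A"
  unfolding group_algebra_def Sym_def using permutes_subset by blast

lemma Sym_mono: "K \<subseteq> A \<Longrightarrow> Sym K \<subseteq> Sym A"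
  unfolding Sym_def using permutes_subset by blast

lemma gmul_subset:
  assumes "finite A" "K \<subseteq> A" "f \<in> group_algebra K"
  shows "gmul K f g = gmul A f g"
proof
  interpret ground A by unfold_locales fact
  fix \<sigma>
  have "(\<Sum>\<tau>\<in>Sym K. f \<tau> * g (inv \<tau> \<circ> \<sigma>)) = (\<Sum>\<tau>\<in>Sym A. f \<tau> * g (inv \<tau> \<circ> \<sigma>))"
    by (rule sum.mono_neutral_left) (use assms Sym_mono in \<open>auto simp: group_algebra_def\<close>)
  then show "gmul K f g \<sigma> = gmul A f g \<sigma>" by (simp add: gmul_def)
qed

lemma gadj_subset:
  assumes "finite A" "K \<subseteq> A" "f \<in> group_algebra K"
  shows "gadj K f = gadj A f"
proof -
  interpret ground A by unfold_locales fact
  show ?thesis unfolding gadj_def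
    by (rule sum.mono_neutral_left)
       (use assms Sym_mono in \<open>auto simp: group_algebra_def\<close>)
qed

section \<open>Primitive idempotents and central projections\<close>

context ground
begin

text \<open>The value \<open>e(1)\<close> is the dimension of the left ideal \<open>\<complex>[G] e\<close> divided by the order of \<open>G\<close>. It is the
  factor that turns the sum of the conjugates of \<open>e\<close> into an idempotent.\<close>

definition prim :: "galg \<Rightarrow> bool" where
  "prim e \<longleftrightarrow> e \<in> GA \<and> e \<odot> e = e \<and> (\<forall>x\<in>GA. \<exists>c. e \<odot> x \<odot> e = gscale c e) \<and> e id \<noteq> 0"

definition central_proj :: "galg \<Rightarrow> galg" where
  "central_proj e = gscale (e id) (\<Sum>g\<in>G. gdelta g \<odot> e \<odot> gdelta (inv g))"

lemma primD:
  assumes "prim e"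
  shows "e \<in> GA" "e \<odot> e = e" "e id \<noteq> 0" "e \<noteq> 0" "e \<odot> (e \<odot> x) = e \<odot> x"
  using assms by (auto simp: prim_def mul_assoc[symmetric])

text \<open>The scalar by which \<open>e g e\<close> is a multiple of \<open>e\<close> is found by applying the trace to both
  sides. This formula replaces Schur orthogonality.\<close>

lemma prim_sandwich:
  assumes e: "prim e" and g: "g \<in> G"
  shows "e \<odot> (gdelta g \<odot> e) = gscale (e (inv g) / e id) e"
proof -
  obtain c where c: "e \<odot> gdelta g \<odot> e = gscale c e"
    using e g unfolding prim_def by (meson GA_delta)
  have "(e \<odot> gdelta g \<odot> e) id = (e \<odot> (e \<odot> gdelta g)) id" by (rule trace_commute)
  also have "\<dots> = e (inv g)" using primD(5)[OF e] g by (simp add: coeff_mul_delta)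
  finally have "c = e (inv g) / e id"
    using c primD(3)[OF e] by (simp add: gscale_def field_simps)
  then show ?thesis using c by (simp add: mul_assoc)
qed

lemma commute_if_delta_commute:
  assumes "x \<in> GA" "\<And>g. g \<in> G \<Longrightarrow> gdelta g \<odot> y = y \<odot> gdelta g"
  shows "x \<odot> y = y \<odot> x"
  by (simp add: mul_expand_left[of x y] mul_expand_right[OF assms(1), of y] assms(2))

lemma average_commutes:
  assumes h: "h \<in> G"
  shows "gdelta h \<odot> (\<Sum>g\<in>G. gdelta g \<odot> e \<odot> gdelta (inv g)) =
    (\<Sum>g\<in>G. gdelta g \<odot> e \<odot> gdelta (inv g)) \<odot> gdelta h"
proof -
  have "(\<Sum>g\<in>G. gdelta g \<odot> e \<odot> gdelta (inv g)) \<odot> gdelta h =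
      (\<Sum>g\<in>G. gdelta g \<odot> (e \<odot> gdelta (inv g \<circ> h)))"
    by (simp add: mul_sum_left mul_assoc)
  also have "\<dots> = (\<Sum>g\<in>G. gdelta (h \<circ> g) \<odot> (e \<odot> gdelta (inv (h \<circ> g) \<circ> h)))"
    by (rule sum_translate[OF h, symmetric])
  also have "\<dots> = (\<Sum>g\<in>G. gdelta (h \<circ> g) \<odot> (e \<odot> gdelta (inv g)))"
    by (rule sum.cong) (use h in \<open>auto simp: G_inv_comp\<close>)
  finally show ?thesis using h by (simp add: mul_sum_right mul_assoc)
qed

lemma central_proj_GA [simp]: "e \<in> GA \<Longrightarrow> central_proj e \<in> GA"
  unfolding central_proj_def by (intro GA_scale GA_sum GA_mul) simp

lemma central_proj_commute: "x \<in> GA \<Longrightarrow> x \<odot> central_proj e = central_proj e \<odot> x"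
  by (rule commute_if_delta_commute) (simp_all add: central_proj_def average_commutes)

lemma central_proj_left: assumes "prim e" shows "central_proj e \<odot> e = e"
proof -
  have "central_proj e \<odot> e = gscale (e id) (\<Sum>g\<in>G. gdelta g \<odot> (e \<odot> (gdelta (inv g) \<odot> e)))"
    by (simp add: central_proj_def mul_sum_left mul_assoc)
  also have "\<dots> = gscale (e id) (\<Sum>g\<in>G. gscale (e g / e id) (gdelta g \<odot> e))"
    using assms by (simp add: prim_sandwich)
  also have "\<dots> = (\<Sum>g\<in>G. gscale (e g) (gdelta g \<odot> e))"
    using primD(3)[OF assms] by (simp add: gvs.scale_sum_right)
  also have "\<dots> = e \<odot> e" by (rule mul_expand_left[symmetric])
  finally show ?thesis using primD(2)[OF assms] by simp
qed

lemma central_proj_right: "prim e \<Longrightarrow> e \<odot> central_proj e = e"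
  using central_proj_commute[of e e] central_proj_left primD(1) by simp

lemma central_mul_central_proj:
  assumes "\<And>g. g \<in> G \<Longrightarrow> gdelta g \<odot> y = y \<odot> gdelta g" "y \<odot> e = e"
  shows "y \<odot> central_proj e = central_proj e"
proof -
  have "y \<odot> (gdelta g \<odot> (e \<odot> gdelta (inv g))) = gdelta g \<odot> (e \<odot> gdelta (inv g))"
    if "g \<in> G" for g
    using assms(1)[OF that] assms(2) by (metis mul_assoc)
  then show ?thesis by (simp add: central_proj_def mul_sum_right mul_assoc)
qed

lemma central_proj_delta: "g \<in> G \<Longrightarrow> gdelta g \<odot> central_proj e = central_proj e \<odot> gdelta g"
  by (rule central_proj_commute) simp

lemma central_proj_idem: "prim e \<Longrightarrow> central_proj e \<odot> central_proj e = central_proj e"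
  by (rule central_mul_central_proj) (simp_all add: central_proj_delta central_proj_left)

text \<open>With \<open>z\<close> the central projection of \<open>e\<close>, the central element \<open>z\<^sup>*\<close> acts on \<open>e\<close> by a scalar,
  which is \<open>0\<close> or \<open>1\<close>, and it is not \<open>0\<close> because \<open>e\<^sup>* e \<noteq> 0\<close>. Hence \<open>z\<^sup>* z = z\<close>.\<close>

lemma central_proj_adj:
  assumes e: "prim e" shows "adj (central_proj e) = central_proj e"
proof -
  let ?z = "central_proj e"
  note [simp] = primD(1)[OF e]
  have z: "?z \<in> GA" by simp
  have comm: "gdelta g \<odot> adj ?z = adj ?z \<odot> gdelta g" if "g \<in> G" for g
  proof -
    have "adj (?z \<odot> gdelta (inv g)) = adj (gdelta (inv g) \<odot> ?z)"
      using that by (simp add: central_proj_delta)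
    then show ?thesis using that by (simp add: adj_mul adj_delta)
  qed
  have comm': "x \<odot> adj ?z = adj ?z \<odot> x" if "x \<in> GA" for x
    using commute_if_delta_commute[OF that comm] .
  obtain c where c: "e \<odot> adj ?z \<odot> e = gscale c e"
    using e unfolding prim_def by (meson adj_GA)
  have ze: "adj ?z \<odot> e = gscale c e"
    using c comm'[of e] primD(2)[OF e] by (simp add: mul_assoc)
  have "adj e \<odot> adj ?z = adj e"
    using central_proj_left[OF e] adj_mul[of ?z e] by simp
  then have "adj e \<odot> e = adj e \<odot> (adj ?z \<odot> e)" by (simp add: mul_assoc[symmetric])
  also have "\<dots> = gscale c (adj e \<odot> e)" by (simp add: ze)
  finally have "gscale (1 - c) (adj e \<odot> e) = 0" by (simp add: gvs.scale_left_diff_distrib)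
  moreover have "adj e \<odot> e \<noteq> 0"
    using sandwich_eq_0[of e] primD(1,4)[OF e] by (auto simp: mul_assoc)
  ultimately have "c = 1" by simp
  then have "adj ?z \<odot> ?z = ?z"
    by (intro central_mul_central_proj comm) (simp_all add: ze)
  then show ?thesis using adj_mul[of "adj ?z" ?z] by simp
qed

lemma central_proj_orthogonal:
  assumes "e \<in> GA" "f \<in> GA" "\<And>x. x \<in> GA \<Longrightarrow> e \<odot> (x \<odot> f) = 0"
  shows "central_proj e \<odot> central_proj f = 0"
proof -
  have "gdelta g \<odot> (e \<odot> (gdelta (inv g) \<odot> (gdelta h \<odot> (f \<odot> gdelta (inv h))))) = 0"
    if "g \<in> G" "h \<in> G" for g h
  proof -
    have "e \<odot> (gdelta (inv g \<circ> h) \<odot> f) \<odot> gdelta (inv h) = 0" using assms that by simp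
    then show ?thesis using that by (simp add: mul_assoc)
  qed
  then show ?thesis by (simp add: central_proj_def mul_sum_left mul_sum_right mul_assoc)
qed

lemma disjoint_sym:
  assumes "e \<in> GA" "f \<in> GA" "\<And>x. x \<in> GA \<Longrightarrow> e \<odot> (x \<odot> f) = 0" "x \<in> GA"
  shows "f \<odot> (x \<odot> e) = 0"
proof (rule sandwich_eq_0)
  let ?y = "f \<odot> (x \<odot> e)"
  have "?y \<odot> adj ?y \<odot> ?y = f \<odot> (x \<odot> (e \<odot> (adj ?y \<odot> f) \<odot> (x \<odot> e)))"
    by (simp add: mul_assoc)
  then show "?y \<odot> adj ?y \<odot> ?y = 0" using assms(3)[of "adj ?y"] by simp
qed (use assms in simp)

text \<open>The left ideal generated by a primitive idempotent is minimal.\<close>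

lemma prim_left_inverse:
  assumes e: "prim e" and w: "w \<in> GA" "w \<odot> e = w" "w \<noteq> 0"
  shows "\<exists>v\<in>GA. v \<odot> w = e"
proof -
  obtain s where "e \<odot> (adj w \<odot> w) \<odot> e = gscale s e"
    using e w(1) unfolding prim_def by (meson GA_mul)
  then have s: "e \<odot> (adj w \<odot> w) = gscale s e" by (simp add: mul_assoc w)
  have "w \<odot> (e \<odot> (adj w \<odot> w)) = w \<odot> adj w \<odot> w" by (metis mul_assoc w(2))
  then have "s \<noteq> 0" using s sandwich_eq_0[OF w(1)] w(3) by auto
  then have "gscale (1 / s) (e \<odot> adj w) \<odot> w = e" using s by (simp add: mul_assoc)
  moreover have "gscale (1 / s) (e \<odot> adj w) \<in> GA" by simp
  ultimately show ?thesis by blast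
qed

definition real_elt :: "galg \<Rightarrow> bool" where "real_elt f \<longleftrightarrow> (\<forall>\<sigma>. f \<sigma> \<in> \<real>)"

lemma real_elt_mul: "real_elt f \<Longrightarrow> real_elt g \<Longrightarrow> real_elt (f \<odot> g)"
  by (auto simp: real_elt_def gmul_def intro!: sum_in_Reals Reals_mult)

lemma real_elt_scale: "c \<in> \<real> \<Longrightarrow> real_elt f \<Longrightarrow> real_elt (gscale c f)"
  by (auto simp: real_elt_def gscale_def)

lemma real_elt_delta: "real_elt (gdelta \<sigma>)"
  by (auto simp: real_elt_def gdelta_def)

lemma real_elt_sum: "(\<And>i. i \<in> I \<Longrightarrow> real_elt (f i)) \<Longrightarrow> real_elt (sum f I)"
  by (auto simp: real_elt_def sum_apply intro!: sum_in_Reals)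

lemma real_elt_central_proj: "real_elt e \<Longrightarrow> real_elt (central_proj e)"
  unfolding central_proj_def
  by (intro real_elt_scale real_elt_sum real_elt_mul real_elt_delta) (auto simp: real_elt_def)

text \<open>A character, as a function of \<open>\<sigma>\<close>, is the coefficient function of a central element at
  \<open>\<sigma>\<^sup>-\<^sup>1\<close>. Reality makes up for the inverse.\<close>

lemma real_selfadj_inv:
  assumes "real_elt f" "adj f = f" "\<sigma> \<in> G" shows "f (inv \<sigma>) = f \<sigma>"
proof -
  have "f \<sigma> = cnj (f (inv \<sigma>))" using adj_apply[of f \<sigma>] assms by simp
  then show ?thesis using assms(1) by (metis Reals_cnj_iff real_elt_def)
qed

end

section \<open>Restriction to a subgroup\<close>

locale ground_pair = ground +
  fixes K :: "nat set"
  assumes sub: "K \<subseteq> A"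
begin

sublocale small: ground K
  by unfold_locales (use fin sub finite_subset in blast)

lemma small_GA: "f \<in> small.GA \<Longrightarrow> f \<in> GA"
  using group_algebra_mono[OF sub] by blast

lemma small_G: "\<sigma> \<in> small.G \<Longrightarrow> \<sigma> \<in> G"
  using Sym_mono[OF sub] by blast

lemma small_mul: "f \<in> small.GA \<Longrightarrow> gmul K f g = f \<odot> g"
  by (rule gmul_subset[OF fin sub])

lemma small_adj: "f \<in> small.GA \<Longrightarrow> gadj K f = adj f"
  by (rule gadj_subset[OF fin sub])

lemma small_expand_left: "f \<in> small.GA \<Longrightarrow> f \<odot> h = (\<Sum>\<sigma>\<in>small.G. gscale (f \<sigma>) (gdelta \<sigma> \<odot> h))"
  using small.mul_expand_left[of f h] by (simp add: small_mul)

lemma small_prim_sandwich: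
  assumes f: "small.prim f" and g: "g \<in> small.G"
  shows "f \<odot> (gdelta g \<odot> (f \<odot> x)) = gscale (f (inv g) / f id) (f \<odot> x)"
proof -
  have "f \<odot> (gdelta g \<odot> f) = gscale (f (inv g) / f id) f"
    using small.prim_sandwich[OF f g] small.primD(1)[OF f] g by (simp add: small_mul)
  then show ?thesis by (metis mul_assoc mul_scale_left)
qed

lemma small_primD:
  assumes "small.prim f"
  shows "f \<in> GA" "f \<odot> f = f" "f \<odot> (f \<odot> x) = f \<odot> x"
  using small.primD[OF assms] small_mul[of f] by (auto simp: small_GA mul_assoc[symmetric])

text \<open>By the sandwich formula the scalars produced by the individual summands are the coefficients of
  \<open>f\<close>, so the sum over the group reassembles to multiplication by \<open>f\<close>.\<close>

lemma average_mul_prim: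
  assumes f: "small.prim f"
  shows "(\<Sum>g\<in>small.G. gdelta g \<odot> (y \<odot> f) \<odot> gdelta (inv g)) \<odot> (f \<odot> w) =
    gscale (1 / f id) (f \<odot> (y \<odot> (f \<odot> w)))"
proof -
  have "(\<Sum>g\<in>small.G. gdelta g \<odot> (y \<odot> f) \<odot> gdelta (inv g)) \<odot> (f \<odot> w) =
      (\<Sum>g\<in>small.G. gdelta g \<odot> (y \<odot> (f \<odot> (gdelta (inv g) \<odot> (f \<odot> w)))))"
    by (simp add: mul_sum_left mul_assoc)
  also have "\<dots> = (\<Sum>g\<in>small.G. gscale (1 / f id) (gscale (f g) (gdelta g \<odot> (y \<odot> (f \<odot> w)))))"
    by (rule sum.cong) (simp_all add: small_prim_sandwich[OF f])
  also have "\<dots> = gscale (1 / f id) (f \<odot> (y \<odot> (f \<odot> w)))"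
    using small_expand_left[OF small.primD(1)[OF f]] by (simp add: gvs.scale_sum_right)
  finally show ?thesis .
qed

text \<open>Multiplicity one: if the relative commutant is one-dimensional on the common block of \<open>f\<close>
  and \<open>e\<close>, then so is \<open>f \<complex>[G] e\<close>. Given \<open>w\<close> and \<open>w'\<close> there, pick \<open>v\<close> with \<open>v w = e\<close>; the average of
  \<open>w' v\<close> lies in the relative commutant, hence acts on \<open>w\<close> by a scalar, but it maps \<open>w\<close> to a
  multiple of \<open>w'\<close>.\<close>

lemma intertwiners_one_dim:
  assumes f: "small.prim f" and e: "prim e"
    and comm: "\<And>y. y \<in> GA \<Longrightarrow> (\<And>g. g \<in> small.G \<Longrightarrow> gdelta g \<odot> y = y \<odot> gdelta g) \<Longrightarrow>
      \<exists>t. small.central_proj f \<odot> central_proj e \<odot> y =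
          gscale t (small.central_proj f \<odot> central_proj e)"
    and w: "w \<in> GA" "f \<odot> w = w" "w \<odot> e = w" "w \<noteq> 0"
    and w': "w' \<in> GA" "f \<odot> w' = w'" "w' \<odot> e = w'"
  shows "\<exists>t. w' = gscale t w"
proof -
  let ?zf = "small.central_proj f" and ?ze = "central_proj e"
  have zf: "?zf \<in> small.GA" using small.primD(1)[OF f] by simp
  obtain u where u: "u \<in> GA" "u \<odot> w = e" using prim_left_inverse[OF e w(1,3,4)] by blast
  define v where "v = u \<odot> f"
  have vw: "v \<odot> w = e" by (simp add: v_def mul_assoc w u)
  have vf: "v \<odot> f = v" by (simp add: v_def mul_assoc small_primD(2)[OF f])
  have vGA: "v \<in> GA" by (simp add: v_def small_primD(1)[OF f])
  define T where "T = (\<Sum>g\<in>small.G. gdelta g \<odot> (w' \<odot> v \<odot> f) \<odot> gdelta (inv g))"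
  have TGA: "T \<in> GA" unfolding T_def by (intro GA_sum GA_mul) (simp add: small_G)
  have Tcomm: "gdelta h \<odot> T = T \<odot> gdelta h" if h: "h \<in> small.G" for h
  proof -
    have "T \<odot> gdelta h = (\<Sum>g\<in>small.G. gdelta g \<odot> (w' \<odot> v \<odot> f \<odot> gdelta (inv g \<circ> h)))"
      unfolding T_def using small_G by (simp add: mul_sum_left mul_assoc)
    also have "\<dots> = (\<Sum>g\<in>small.G. gdelta (h \<circ> g) \<odot> (w' \<odot> v \<odot> f \<odot> gdelta (inv (h \<circ> g) \<circ> h)))"
      by (rule small.sum_translate[OF h, symmetric])
    also have "\<dots> = (\<Sum>g\<in>small.G. gdelta (h \<circ> g) \<odot> (w' \<odot> v \<odot> f \<odot> gdelta (inv g)))"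
      by (rule sum.cong) (use h in \<open>auto simp: small.G_inv_comp\<close>)
    also have "\<dots> = gdelta h \<odot> T"
      unfolding T_def using h small_G by (simp add: mul_sum_right mul_assoc)
    finally show ?thesis by simp
  qed
  obtain t where t: "?zf \<odot> ?ze \<odot> T = gscale t (?zf \<odot> ?ze)" using comm[OF TGA Tcomm] by blast
  have zfw: "?zf \<odot> x = x" if "f \<odot> x = x" for x
  proof -
    have "?zf \<odot> f = f" using small.central_proj_left[OF f] zf by (simp add: small_mul)
    then show ?thesis using that by (metis mul_assoc)
  qed
  have zew: "?ze \<odot> x = x" if "x \<in> GA" "x \<odot> e = x" for x
    using central_proj_right[OF e] central_proj_commute[OF that(1), of e] that
    by (metis mul_assoc)
  have "T \<odot> w = gscale (1 / f id) w'"
    using average_mul_prim[OF f, of "w' \<odot> v" w] unfolding T_def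
    by (simp add: w w' vw mul_assoc)
  moreover have "T \<odot> w = gscale t w"
  proof -
    have fw: "f \<odot> (T \<odot> w) = T \<odot> w" using calculation w' by simp
    have we: "T \<odot> w \<odot> e = T \<odot> w" by (simp add: mul_assoc w)
    have "T \<odot> w = ?zf \<odot> (?ze \<odot> (T \<odot> w))" using zfw[OF fw] zew[OF _ we] w(1) by simp
    also have "\<dots> = gscale t (?zf \<odot> ?ze) \<odot> w" by (simp add: t[symmetric] mul_assoc)
    also have "\<dots> = gscale t w" using zew[of w] zfw[of w] w by (simp add: mul_assoc)
    finally show ?thesis .
  qed
  ultimately have "gscale (f id) (gscale (1 / f id) w') = gscale (f id) (gscale t w)" by simp
  then have "w' = gscale (f id * t) w" using small.primD(3)[OF f] by simp
  then show ?thesis by blast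
qed

end

section \<open>Young diagrams\<close>

definition row_len :: "nat list \<Rightarrow> nat \<Rightarrow> nat" where
  "row_len \<mu> i = (if i < length \<mu> then \<mu> ! i else 0)"

lemma diagram_iff: "(i, j) \<in> diagram \<mu> \<longleftrightarrow> j < row_len \<mu> i"
  by (auto simp: diagram_def row_len_def)

lemma diagram_eq_Sigma: "diagram \<mu> = (SIGMA i:{..<length \<mu>}. {..<\<mu> ! i})"
  by (auto simp: diagram_def)

lemma finite_diagram [simp]: "finite (diagram \<mu>)"
  by (simp add: diagram_eq_Sigma)

lemma card_diagram: "card (diagram \<mu>) = sum_list \<mu>"
  by (simp add: diagram_eq_Sigma sum_list_sum_nth atLeast0LessThan)

lemma row_len_antimono: "\<mu> \<in> Par n \<Longrightarrow> i \<le> k \<Longrightarrow> row_len \<mu> k \<le> row_len \<mu> i"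
  by (cases "i = k") (auto simp: row_len_def Par_def sorted_wrt_iff_nth_less)

lemma diagram_columns:
  assumes "\<mu> \<in> Par n"
  shows "(i, j) \<in> diagram \<mu> \<longleftrightarrow> i < card {p \<in> diagram \<mu>. snd p = j}"
proof -
  let ?L = "{i. (i, j) \<in> diagram \<mu>}"
  have "{p \<in> diagram \<mu>. snd p = j} = (\<lambda>i. (i, j)) ` ?L" by auto
  then have c: "card {p \<in> diagram \<mu>. snd p = j} = card ?L"
    by (simp add: card_image inj_on_def)
  have fin: "finite ?L"
    by (rule finite_subset[of _ "{..<length \<mu>}"]) (auto simp: diagram_def)
  have down: "k \<in> ?L" if "k \<le> i" "i \<in> ?L" for i k
    using that(2) less_le_trans[OF _ row_len_antimono[OF assms that(1)], of j]
    by (simp add: diagram_iff)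
  have "?L = {..<card ?L}"
  proof -
    have "\<exists>m. ?L = {..<m}"
    proof (cases "?L = {}")
      case False
      have "?L = {..<Suc (Max ?L)}"
      proof (intro set_eqI iffI)
        fix k assume "k \<in> ?L"
        then show "k \<in> {..<Suc (Max ?L)}" using Max_ge[OF fin] by (simp add: less_Suc_eq_le)
      next
        fix k assume "k \<in> {..<Suc (Max ?L)}"
        then show "k \<in> ?L" by (intro down[OF _ Max_in[OF fin False]]) (simp add: less_Suc_eq_le)
      qed
      then show ?thesis by blast
    qed auto
    then show ?thesis by (metis card_lessThan)
  qed
  from arg_cong[OF this, of "\<lambda>S. i \<in> S"] show ?thesis unfolding c by simp
qed

lemma diagram_inject:
  assumes "\<mu> \<in> Par n" "\<nu> \<in> Par m" "diagram \<mu> = diagram \<nu>" shows "\<mu> = \<nu>"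
proof (rule nth_equalityI)
  have len: "{i. (i, 0) \<in> diagram \<kappa>} = {..<length \<kappa>}" if "\<kappa> \<in> Par k" for \<kappa> k
  proof -
    have "0 < \<kappa> ! i" if "i < length \<kappa>" for i
      using nth_mem[OF that] \<open>\<kappa> \<in> Par k\<close> by (metis (mono_tags, lifting) Par_def gr0I mem_Collect_eq)
    then show ?thesis by (auto simp: diagram_def)
  qed
  have row: "{j. (i, j) \<in> diagram \<kappa>} = {..<\<kappa> ! i}" if "i < length \<kappa>" for \<kappa> i
    using that by (auto simp: diagram_def)
  show l: "length \<mu> = length \<nu>"
    using len[OF assms(1)] len[OF assms(2)] assms(3) by simp
  fix i assume "i < length \<mu>"
  then show "\<mu> ! i = \<nu> ! i" using row[of i \<mu>] row[of i \<nu>] l assms(3) by simp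
qed

text \<open>
  If a filling has the row lengths of \<open>\<mu>\<close> and the column lengths of \<open>\<nu>\<close>, compare the total weight
  of its cells with that of the diagram of \<open>\<mu>\<close>, for the weight \<open>2 \<mu>\<^sub>i - 2 j - 1\<close> of the cell
  \<open>(i, j)\<close>. This weight is positive on the diagram and negative outside of it, so the diagram is the
  unique set of cells of maximal weight. On the other hand the total weight depends on the row
  and column lengths only. The column statistic below, which is the sum of the squares of
  the row lengths, therefore orders the shapes in a way compatible with dominance, and the extremal
  case is rigid.
\<close>

definition col_stat :: "nat list \<Rightarrow> int" where
  "col_stat \<mu> = (\<Sum>p\<in>diagram \<mu>. 2 * int (snd p) + 1)"

lemma filling_compare:
  fixes r c r' c' :: "'a \<Rightarrow> nat"
  assumes A: "finite A"
    and mu: "bij_betw (\<lambda>x. (r x, c x)) A (diagram \<mu>)"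
    and nu: "bij_betw (\<lambda>x. (r' x, c' x)) A (diagram \<nu>)"
    and inj: "inj_on (\<lambda>x. (r x, c' x)) A"
  shows "col_stat \<mu> \<le> col_stat \<nu>"
    and "col_stat \<mu> = col_stat \<nu> \<Longrightarrow> (\<lambda>x. (r x, c' x)) ` A = diagram \<mu>"
proof -
  define w :: "nat \<times> nat \<Rightarrow> int" where "w p = 2 * int (row_len \<mu> (fst p)) - (2 * int (snd p) + 1)" for p
  define E where "E = (\<lambda>x. (r x, c' x)) ` A"
  have finE: "finite E" using A by (simp add: E_def)
  have pos: "w p > 0" if "p \<in> diagram \<mu>" for p
    using that by (cases p) (auto simp: diagram_iff w_def)
  have neg: "w p < 0" if "p \<notin> diagram \<mu>" for p
    using that by (cases p) (auto simp: diagram_iff w_def)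
  have "sum w E = (\<Sum>x\<in>A. w (r x, c' x))"
    unfolding E_def using inj by (simp add: sum.reindex)
  also have "\<dots> = (\<Sum>x\<in>A. 2 * int (row_len \<mu> (r x))) - (\<Sum>x\<in>A. 2 * int (c' x) + 1)"
    by (simp add: w_def sum_subtractf)
  also have "(\<Sum>x\<in>A. 2 * int (c' x) + 1) = col_stat \<nu>"
    using sum.reindex_bij_betw[OF nu, of "\<lambda>p. 2 * int (snd p) + 1"] by (simp add: col_stat_def)
  finally have E: "sum w E = (\<Sum>x\<in>A. 2 * int (row_len \<mu> (r x))) - col_stat \<nu>" .
  have "sum w (diagram \<mu>) = (\<Sum>x\<in>A. w (r x, c x))"
    using sum.reindex_bij_betw[OF mu, of w] by simp
  also have "\<dots> = (\<Sum>x\<in>A. 2 * int (row_len \<mu> (r x))) - (\<Sum>x\<in>A. 2 * int (c x) + 1)"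
    by (simp add: w_def sum_subtractf)
  also have "(\<Sum>x\<in>A. 2 * int (c x) + 1) = col_stat \<mu>"
    using sum.reindex_bij_betw[OF mu, of "\<lambda>p. 2 * int (snd p) + 1"] by (simp add: col_stat_def)
  finally have D: "sum w (diagram \<mu>) = (\<Sum>x\<in>A. 2 * int (row_len \<mu> (r x))) - col_stat \<mu>" .
  have 1: "sum w E = sum w (E \<inter> diagram \<mu>) + sum w (E - diagram \<mu>)"
    using sum.Int_Diff[OF finE] .
  have 2: "sum w (diagram \<mu>) = sum w (E \<inter> diagram \<mu>) + sum w (diagram \<mu> - E)"
    using sum.Int_Diff[OF finite_diagram, of w \<mu> E] by (simp add: Int_commute)
  have 3: "sum w (E - diagram \<mu>) \<le> 0" using neg by (intro sum_nonpos) (auto intro: less_imp_le)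
  have 4: "sum w (diagram \<mu> - E) \<ge> 0" using pos by (intro sum_nonneg) (auto intro: less_imp_le)
  show "col_stat \<mu> \<le> col_stat \<nu>" using E D 1 2 3 4 by linarith
  assume "col_stat \<mu> = col_stat \<nu>"
  then have z: "sum w (E - diagram \<mu>) = 0" "sum w (diagram \<mu> - E) = 0" using E D 1 2 3 4 by linarith+
  have "E - diagram \<mu> = {}"
  proof (rule ccontr)
    assume "E - diagram \<mu> \<noteq> {}"
    then have "(\<Sum>p\<in>E - diagram \<mu>. - w p) > 0" using neg finE by (intro sum_pos) auto
    then show False using z by (simp add: sum_negf)
  qed
  moreover have "diagram \<mu> - E = {}"
  proof (rule ccontr)
    assume "diagram \<mu> - E \<noteq> {}"
    then have "sum w (diagram \<mu> - E) > 0" using pos by (intro sum_pos) auto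
    then show False using z by simp
  qed
  ultimately show "(\<lambda>x. (r x, c' x)) ` A = diagram \<mu>" unfolding E_def by blast
qed

text \<open>In the extremal case the cells form the diagram of \<open>\<mu>\<close> but have the column lengths of \<open>\<nu>\<close>.\<close>

lemma filling_rigid:
  fixes r c r' c' :: "'a \<Rightarrow> nat"
  assumes A: "finite A" and P: "\<mu> \<in> Par n" "\<nu> \<in> Par m"
    and mu: "bij_betw (\<lambda>x. (r x, c x)) A (diagram \<mu>)"
    and nu: "bij_betw (\<lambda>x. (r' x, c' x)) A (diagram \<nu>)"
    and inj: "inj_on (\<lambda>x. (r x, c' x)) A"
    and eq: "col_stat \<mu> = col_stat \<nu>"
  shows "\<mu> = \<nu>"
proof (rule diagram_inject[OF P])
  have bij: "bij_betw (\<lambda>x. (r x, c' x)) A (diagram \<mu>)"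
    using inj filling_compare(2)[OF A mu nu inj eq] by (simp add: bij_betw_def)
  have col: "card {p \<in> D. snd p = j} = card {x \<in> A. c' x = j}"
    if "bij_betw (\<lambda>x. (q x, c' x)) A D" for D j and q :: "'a \<Rightarrow> nat"
  proof -
    have "bij_betw (\<lambda>x. (q x, c' x)) {x \<in> A. c' x = j} {p \<in> D. snd p = j}"
      using that by (auto simp: bij_betw_def intro: inj_on_subset)
    then show ?thesis using bij_betw_same_card by fastforce
  qed
  show "diagram \<mu> = diagram \<nu>"
    using diagram_columns[OF P(1)] diagram_columns[OF P(2)] col[OF bij] col[OF nu]
    by (auto simp: set_eq_iff)
qed

section \<open>Young symmetrizers\<close>

context ground
begin

text \<open>Row and column groups are the stabilizers of a labelling of the points; the same notion
  applied to words describes the action on tensor powers below.\<close>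

definition stab :: "(nat \<Rightarrow> 'b) \<Rightarrow> perm_fun set" where
  "stab r = {\<sigma> \<in> G. \<forall>x\<in>A. r (\<sigma> x) = r x}"

definition sym_sum :: "(nat \<Rightarrow> 'b) \<Rightarrow> galg" where
  "sym_sum r = (\<Sum>\<sigma>\<in>stab r. gdelta \<sigma>)"

definition alt_sum :: "(nat \<Rightarrow> 'b) \<Rightarrow> galg" where
  "alt_sum r = (\<Sum>\<sigma>\<in>stab r. gscale (of_int (sign \<sigma>)) (gdelta \<sigma>))"

lemma stab_G: "\<sigma> \<in> stab r \<Longrightarrow> \<sigma> \<in> G" by (simp add: stab_def)
lemma finite_stab [simp]: "finite (stab r)" by (simp add: stab_def)
lemma stab_id [simp]: "id \<in> stab r" by (simp add: stab_def)
lemma stab_comp: "\<sigma> \<in> stab r \<Longrightarrow> \<tau> \<in> stab r \<Longrightarrow> \<sigma> \<circ> \<tau> \<in> stab r"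
  by (simp add: stab_def)
lemma stab_inv: "\<sigma> \<in> stab r \<Longrightarrow> inv \<sigma> \<in> stab r"
proof -
  assume s: "\<sigma> \<in> stab r"
  have "r (inv \<sigma> x) = r x" if "x \<in> A" for x
  proof -
    have "inv \<sigma> x \<in> A" using that stab_G[OF s] by simp
    then have "r (\<sigma> (inv \<sigma> x)) = r (inv \<sigma> x)" using s unfolding stab_def by blast
    then show ?thesis using stab_G[OF s] by simp
  qed
  then show ?thesis using stab_G[OF s] by (simp add: stab_def)
qed

lemma G_permutation: "\<sigma> \<in> G \<Longrightarrow> permutation \<sigma>"
  using permutes_imp_permutation[OF fin] by (simp add: Sym_def)

lemma sign_comp: "\<sigma> \<in> G \<Longrightarrow> \<tau> \<in> G \<Longrightarrow> sign (\<sigma> \<circ> \<tau>) = sign \<sigma> * sign \<tau>"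
  by (simp add: sign_compose G_permutation)

lemma sign_inv: "\<sigma> \<in> G \<Longrightarrow> sign (inv \<sigma>) = sign \<sigma>"
  by (simp add: sign_inverse G_permutation)

lemma sum_stab_translate:
  assumes "\<rho> \<in> stab r" shows "(\<Sum>\<tau>\<in>stab r. F (\<rho> \<circ> \<tau>)) = (\<Sum>\<tau>\<in>stab r. F \<tau>)"
  by (rule sum.reindex_bij_witness[where i="\<lambda>\<tau>. inv \<rho> \<circ> \<tau>" and j="\<lambda>\<tau>. \<rho> \<circ> \<tau>"])
     (use assms in \<open>auto simp: stab_G intro: stab_comp stab_inv\<close>)

lemma sum_stab_inv: "(\<Sum>\<tau>\<in>stab r. F (inv \<tau>)) = (\<Sum>\<tau>\<in>stab r. F \<tau>)"
  by (rule sum.reindex_bij_witness[where i=inv and j=inv]) (auto simp: stab_G intro: stab_inv)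

lemma sym_sum_GA [simp]: "sym_sum r \<in> GA"
  unfolding sym_sum_def by (intro GA_sum GA_delta stab_G)
lemma alt_sum_GA [simp]: "alt_sum r \<in> GA"
  unfolding alt_sum_def by (intro GA_sum GA_scale GA_delta stab_G)

lemma adj_sym_sum [simp]: "adj (sym_sum r) = sym_sum r"
  unfolding sym_sum_def adj_sum
  by (subst sum_stab_inv[symmetric], rule sum.cong) (auto simp: adj_delta stab_G)

lemma adj_alt_sum [simp]: "adj (alt_sum r) = alt_sum r"
  unfolding alt_sum_def adj_sum
  by (subst sum_stab_inv[symmetric], rule sum.cong)
     (auto simp: adj_delta stab_G sign_inv)

lemma delta_sym_sum: "\<sigma> \<in> stab r \<Longrightarrow> gdelta \<sigma> \<odot> sym_sum r = sym_sum r"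
  by (simp add: sym_sum_def mul_sum_right stab_G sum_stab_translate[where F=gdelta])

lemma sign_square: "complex_of_int (sign h) * of_int (sign h) = 1"
  by (metis of_int_1 of_int_mult sign_idempotent)

lemma delta_alt_sum:
  assumes "\<sigma> \<in> stab r" shows "gdelta \<sigma> \<odot> alt_sum r = gscale (of_int (sign \<sigma>)) (alt_sum r)"
proof -
  have "alt_sum r = (\<Sum>\<tau>\<in>stab r. gscale (of_int (sign (\<sigma> \<circ> \<tau>))) (gdelta (\<sigma> \<circ> \<tau>)))"
    unfolding alt_sum_def by (rule sum_stab_translate[OF assms, symmetric])
  also have "\<dots> = (\<Sum>\<tau>\<in>stab r. gscale (of_int (sign \<sigma>)) (gscale (of_int (sign \<tau>)) (gdelta (\<sigma> \<circ> \<tau>))))"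
    by (rule sum.cong) (use assms in \<open>auto simp: sign_comp stab_G\<close>)
  also have "\<dots> = gscale (of_int (sign \<sigma>)) (gdelta \<sigma> \<odot> alt_sum r)"
    unfolding alt_sum_def mul_sum_right gvs.scale_sum_right
    by (rule sum.cong) (use assms in \<open>auto simp: stab_G\<close>)
  finally have *: "alt_sum r = gscale (of_int (sign \<sigma>)) (gdelta \<sigma> \<odot> alt_sum r)" .
  have "gscale (of_int (sign \<sigma>)) (alt_sum r) =
      gscale (of_int (sign \<sigma>) * of_int (sign \<sigma>)) (gdelta \<sigma> \<odot> alt_sum r)"
    by (subst *) simp
  then show ?thesis by (simp only: sign_square gvs.scale_one)
qed

lemma sym_sum_delta: "\<sigma> \<in> stab r \<Longrightarrow> sym_sum r \<odot> gdelta \<sigma> = sym_sum r"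
  using arg_cong[OF delta_sym_sum[OF stab_inv], of \<sigma> r adj]
  by (simp add: adj_mul adj_delta stab_G)

lemma sum_const: "(\<Sum>i\<in>I. x) = gscale (of_nat (card I)) x"
  by (simp add: fun_eq_iff sum_apply gscale_def)

lemma sym_sum_square: "sym_sum r \<odot> sym_sum r = gscale (of_nat (card (stab r))) (sym_sum r)"
  unfolding sym_sum_def[of r] mul_sum_right unfolding sym_sum_def[of r, symmetric] sum_const[symmetric]
  by (rule sum.cong) (simp_all add: sym_sum_delta)

lemma alt_sum_square: "alt_sum r \<odot> alt_sum r = gscale (of_nat (card (stab r))) (alt_sum r)"
proof -
  have "alt_sum r \<odot> alt_sum r = (\<Sum>\<sigma>\<in>stab r. gscale (of_int (sign \<sigma>)) (gdelta \<sigma> \<odot> alt_sum r))"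
    by (simp add: alt_sum_def[of r] mul_sum_left)
  also have "\<dots> = (\<Sum>\<sigma>\<in>stab r. alt_sum r)"
    by (rule sum.cong) (simp_all add: delta_alt_sum sign_square)
  finally show ?thesis by (simp only: sum_const)
qed

text \<open>Inserting the transposition of \<open>g x\<close> and \<open>g y\<close> behind the symmetrizer changes nothing, but moved
  across \<open>g\<close> it becomes the transposition of \<open>x\<close> and \<open>y\<close>, which changes the sign.\<close>

lemma sym_alt_eq_0:
  assumes g: "g \<in> G" and xy: "x \<in> A" "y \<in> A" "x \<noteq> y" and r: "r (g x) = r (g y)" and c: "c x = c y"
  shows "sym_sum r \<odot> (gdelta g \<odot> alt_sum c) = 0"
proof -
  define t where "t = transpose x y"
  define t' where "t' = transpose (g x) (g y)"
  have t: "t \<in> stab c" using xy c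
    by (auto simp: stab_def Sym_def t_def permutes_swap_id transpose_def)
  have t': "t' \<in> stab r" using xy r g
    by (auto simp: stab_def Sym_def t'_def permutes_swap_id transpose_def permutes_in_image)
  have "inj g" using G_bij[OF g] by (simp add: bij_is_inj)
  then have gt: "t' \<circ> g = g \<circ> t"
    by (auto simp: t_def t'_def transpose_def fun_eq_iff inj_eq)
  have "sym_sum r \<odot> (gdelta g \<odot> alt_sum c) = sym_sum r \<odot> gdelta t' \<odot> (gdelta g \<odot> alt_sum c)"
    by (simp add: sym_sum_delta[OF t'])
  also have "\<dots> = sym_sum r \<odot> (gdelta g \<odot> (gdelta t \<odot> alt_sum c))"
    using t' t g gt by (simp add: mul_assoc stab_G)
  also have "\<dots> = gscale (- 1) (sym_sum r \<odot> (gdelta g \<odot> alt_sum c))"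
    unfolding delta_alt_sum[OF t] using xy by (simp add: t_def sign_swap_id)
  finally have "gscale (1 - (- 1)) (sym_sum r \<odot> (gdelta g \<odot> alt_sum c)) = 0"
    by (simp only: gvs.scale_left_diff_distrib gvs.scale_one) simp
  then show ?thesis by simp
qed

lemma sym_alt_inj:
  assumes "g \<in> G" "sym_sum r \<odot> (gdelta g \<odot> alt_sum c) \<noteq> 0"
  shows "inj_on (\<lambda>x. (r (g x), c x)) A"
  using assms sym_alt_eq_0 unfolding inj_on_def by blast

lemma bij_comp_G: "g \<in> G \<Longrightarrow> bij_betw (\<lambda>x. f x) A D \<Longrightarrow> bij_betw (\<lambda>x. f (g x)) A D"
  using bij_betw_trans[of g A A f D] by (auto simp: Sym_def permutes_imp_bij comp_def)

text \<open>A tableau enters only through the row and the column number of each point.\<close>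

definition tab :: "nat list \<Rightarrow> (nat \<Rightarrow> nat) \<Rightarrow> (nat \<Rightarrow> nat) \<Rightarrow> bool" where
  "tab \<mu> r c \<longleftrightarrow> bij_betw (\<lambda>x. (r x, c x)) A (diagram \<mu>)"

lemma sym_alt_disjoint:
  assumes "tab \<mu> r c" "tab \<nu> r' c'" "x \<in> GA" "sym_sum r \<odot> (x \<odot> alt_sum c') \<noteq> 0"
  shows "col_stat \<mu> \<le> col_stat \<nu>"
    and "\<mu> \<in> Par n \<Longrightarrow> \<nu> \<in> Par m \<Longrightarrow> col_stat \<mu> = col_stat \<nu> \<Longrightarrow> \<mu> = \<nu>"
proof -
  have "\<exists>g\<in>G. sym_sum r \<odot> (gdelta g \<odot> alt_sum c') \<noteq> 0"
  proof (rule ccontr)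
    assume "\<not> ?thesis"
    then have "sym_sum r \<odot> (x \<odot> alt_sum c') = 0"
      by (simp add: mul_expand_left[of x] mul_sum_right)
    then show False using assms by simp
  qed
  then obtain g where g: "g \<in> G" "sym_sum r \<odot> (gdelta g \<odot> alt_sum c') \<noteq> 0" by blast
  have inj: "inj_on (\<lambda>x. (r (g x), c' x)) A" by (rule sym_alt_inj[OF g])
  have mu: "bij_betw (\<lambda>x. (r (g x), c (g x))) A (diagram \<mu>)"
    using bij_comp_G[OF g(1)] assms(1) unfolding tab_def by fastforce
  have nu: "bij_betw (\<lambda>x. (r' x, c' x)) A (diagram \<nu>)" using assms(2) by (simp add: tab_def)
  show "col_stat \<mu> \<le> col_stat \<nu>" by (rule filling_compare(1)[OF fin mu nu inj])
  show "\<mu> \<in> Par n \<Longrightarrow> \<nu> \<in> Par m \<Longrightarrow> col_stat \<mu> = col_stat \<nu> \<Longrightarrow> \<mu> = \<nu>"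
    by (rule filling_rigid[OF fin _ _ mu nu inj])
qed

text \<open>If no two points of the same column are mapped to the same row by \<open>g\<close>, then reading rows
  after \<open>g\<close> and columns before \<open>g\<close> is again a bijection onto the diagram by rigidity; this is the
  intermediate tableau through which \<open>g\<close> factors.\<close>

lemma row_column_factor:
  assumes tab: "tab \<mu> r c" and g: "g \<in> G" and inj: "inj_on (\<lambda>x. (r (g x), c x)) A"
  obtains p q where "p \<in> stab r" "q \<in> stab c" "g = p \<circ> q"
proof -
  let ?h = "\<lambda>x. (r x, c x)" and ?\<phi> = "\<lambda>x. (r (g x), c x)"
  have h: "bij_betw ?h A (diagram \<mu>)" using tab by (simp add: tab_def)
  have "bij_betw (\<lambda>x. (r (g x), c (g x))) A (diagram \<mu>)"
    using bij_comp_G[OF g] tab unfolding tab_def by fastforce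
  from filling_compare(2)[OF fin this h inj]
  have \<phi>: "bij_betw ?\<phi> A (diagram \<mu>)" using inj by (simp add: bij_betw_def)
  define q where "q x = (if x \<in> A then inv_into A ?h (?\<phi> x) else x)" for x
  have "bij_betw (inv_into A ?h \<circ> ?\<phi>) A A"
    by (rule bij_betw_trans[OF \<phi> bij_betw_inv_into[OF h]])
  then have "bij_betw q A A"
    by (rule bij_betw_cong[THEN iffD1, rotated]) (simp add: q_def)
  then have "q permutes A" by (rule bij_imp_permutes) (simp add: q_def)
  then have qG: "q \<in> G" by (simp add: Sym_def)
  have hq: "?h (q x) = ?\<phi> x" if "x \<in> A" for x
    unfolding q_def using that bij_betw_inv_into_right[OF h] \<phi> by (auto simp: bij_betw_def)
  have q: "q \<in> stab c" using qG hq by (simp add: stab_def)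
  have "r ((g \<circ> inv q) x) = r x" if x: "x \<in> A" for x
    using hq[of "inv q x"] x qG by simp
  then have "g \<circ> inv q \<in> stab r" using g qG by (simp add: stab_def)
  moreover have "g = (g \<circ> inv q) \<circ> q" using qG by simp
  ultimately show ?thesis using that q by blast
qed

abbreviation young :: "(nat \<Rightarrow> nat) \<Rightarrow> (nat \<Rightarrow> nat) \<Rightarrow> galg" where
  "young r c \<equiv> sym_sum r \<odot> alt_sum c"

lemma young_sandwich:
  assumes tab: "tab \<mu> r c" and x: "x \<in> GA"
  shows "\<exists>s. sym_sum r \<odot> (x \<odot> alt_sum c) = gscale s (young r c)"
proof -
  have "\<exists>s. sym_sum r \<odot> (gdelta g \<odot> alt_sum c) = gscale s (young r c)" if g: "g \<in> G" for g
  proof (cases "inj_on (\<lambda>x. (r (g x), c x)) A")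
    case True
    obtain p q where pq: "p \<in> stab r" "q \<in> stab c" "g = p \<circ> q"
      using row_column_factor[OF tab g True] .
    have "sym_sum r \<odot> (gdelta g \<odot> alt_sum c) = sym_sum r \<odot> gdelta p \<odot> (gdelta q \<odot> alt_sum c)"
      using pq by (simp add: mul_assoc stab_G)
    also have "\<dots> = gscale (of_int (sign q)) (young r c)"
      by (simp add: sym_sum_delta[OF pq(1)] delta_alt_sum[OF pq(2)])
    finally show ?thesis by blast
  next
    case False
    then have "sym_sum r \<odot> (gdelta g \<odot> alt_sum c) = gscale 0 (young r c)"
      using sym_alt_inj[OF g] by auto
    then show ?thesis by blast
  qed
  then obtain s where s: "\<And>g. g \<in> G \<Longrightarrow> sym_sum r \<odot> (gdelta g \<odot> alt_sum c) = gscale (s g) (young r c)"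
    by metis
  have "sym_sum r \<odot> (x \<odot> alt_sum c) = (\<Sum>g\<in>G. gscale (x g) (sym_sum r \<odot> (gdelta g \<odot> alt_sum c)))"
    by (simp add: mul_expand_left[of x] mul_sum_right)
  also have "\<dots> = gscale (\<Sum>g\<in>G. x g * s g) (young r c)"
    by (simp add: s gvs.scale_sum_left)
  finally show ?thesis by blast
qed

lemma alt_sum_apply: "alt_sum c \<sigma> = (if \<sigma> \<in> stab c then of_int (sign \<sigma>) else 0)"
  by (simp add: alt_sum_def sum_delta_apply)

lemma sym_sum_apply: "sym_sum c \<sigma> = (if \<sigma> \<in> stab c then 1 else 0)"
  using sum_delta_apply[of "\<lambda>_. 1" "stab c"] by (simp add: sym_sum_def)

lemma young_id:
  assumes "tab \<mu> r c" shows "young r c id = 1"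
proof -
  have "p = id" if p: "p \<in> stab r" "inv p \<in> stab c" for p
  proof
    fix x
    have pG: "p \<in> G" using p by (simp add: stab_G)
    have pc: "p \<in> stab c" using stab_inv[OF p(2)] pG by simp
    show "p x = id x"
    proof (cases "x \<in> A")
      case True
      then show ?thesis using p(1) pc assms pG
        by (auto simp: tab_def stab_def bij_betw_def dest!: inj_onD[of _ A "p x" x])
    next
      case False
      then show ?thesis using pG by (simp add: Sym_def permutes_def)
    qed
  qed
  then have "sym_sum r \<tau> * alt_sum c (inv \<tau> \<circ> id) = (if \<tau> = id then 1 else 0)" for \<tau>
    by (auto simp: sym_sum_apply alt_sum_apply)
  then show ?thesis by (simp add: gmul_def)
qed

lemma real_elt_young: "real_elt (young r c)"
  by (intro real_elt_mul) (auto simp: real_elt_def sym_sum_apply alt_sum_apply)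

text \<open>The square of a Young symmetrizer \<open>c = a b\<close> is a multiple of \<open>c\<close>. It does not vanish: \<open>a\<close> and \<open>b\<close>
  are self-adjoint with \<open>a\<^sup>2\<close> and \<open>b\<^sup>2\<close> positive multiples of them, so \<open>a b a b = 0\<close> would give
  \<open>(a b a) (a b a)\<^sup>* = 0\<close>, then \<open>(a b) (a b)\<^sup>* = 0\<close> and finally \<open>a b = 0\<close>.\<close>

lemma young_square_nonzero:
  assumes tab: "tab \<mu> r c" shows "young r c \<odot> young r c \<noteq> 0"
proof
  let ?a = "sym_sum r" and ?b = "alt_sum c"
  have a2: "?a \<odot> (?a \<odot> x) = gscale (of_nat (card (stab r))) (?a \<odot> x)" for x
    by (simp add: mul_assoc[symmetric] sym_sum_square)
  have b2: "?b \<odot> (?b \<odot> x) = gscale (of_nat (card (stab c))) (?b \<odot> x)" for x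
    by (simp add: mul_assoc[symmetric] alt_sum_square)
  assume zero: "?a \<odot> ?b \<odot> (?a \<odot> ?b) = 0"
  have zero': "?a \<odot> (?b \<odot> (?a \<odot> (?b \<odot> x))) = 0" for x
    using zero by (simp add: mul_assoc[symmetric])
  have "(?a \<odot> (?b \<odot> ?a)) \<odot> adj (?a \<odot> (?b \<odot> ?a)) = 0"
    by (simp add: adj_mul mul_assoc a2 zero')
  then have aba: "?a \<odot> (?b \<odot> ?a) = 0" by (rule mul_adj_eq_0[rotated]) simp
  then have "young r c \<odot> adj (young r c) = 0" by (simp add: adj_mul mul_assoc b2)
  then have "young r c = 0" by (rule mul_adj_eq_0[rotated]) simp
  then show False using young_id[OF tab] by simp
qed

definition young_idem :: "(nat \<Rightarrow> nat) \<Rightarrow> (nat \<Rightarrow> nat) \<Rightarrow> galg" where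
  "young_idem r c = gscale (1 / (young r c \<odot> young r c) id) (young r c)"

lemma young_idem_prim:
  assumes tab: "tab \<mu> r c"
  shows "prim (young_idem r c)" "real_elt (young_idem r c)"
    "\<exists>s. s \<noteq> 0 \<and> young r c = gscale s (young_idem r c)"
proof -
  let ?y = "young r c"
  define k where "k = (?y \<odot> ?y) id"
  have sand: "\<exists>s. ?y \<odot> (x \<odot> ?y) = gscale s ?y" if "x \<in> GA" for x
    using young_sandwich[OF tab, of "alt_sum c \<odot> (x \<odot> sym_sum r)"] by (simp add: mul_assoc)
  obtain s where s: "?y \<odot> (one \<odot> ?y) = gscale s ?y" using sand by (meson GA_delta G_id)
  then have sk: "s = k" using young_id[OF tab] by (simp add: k_def gscale_def)
  have y2: "?y \<odot> ?y = gscale k ?y" using s sk by simp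
  have k0: "k \<noteq> 0" using young_square_nonzero[OF tab] y2 by auto
  have e: "young_idem r c = gscale (1 / k) ?y" by (simp add: young_idem_def k_def)
  show "\<exists>s. s \<noteq> 0 \<and> ?y = gscale s (young_idem r c)" by (rule exI[of _ k]) (simp add: e k0)
  have yid: "?y id = 1" by (rule young_id[OF tab])
  show "prim (young_idem r c)" unfolding prim_def
  proof (intro conjI ballI)
    show "young_idem r c \<in> GA" by (simp add: e)
    show "young_idem r c \<odot> young_idem r c = young_idem r c"
      unfolding e mul_scale_left mul_scale_right y2 using k0 by simp
    show "young_idem r c id \<noteq> 0" using k0 yid by (simp add: e gscale_def)
    fix x assume "x \<in> GA"
    then obtain s where s: "?y \<odot> (x \<odot> ?y) = gscale s ?y" using sand by blast
    have "young_idem r c \<odot> x \<odot> young_idem r c = gscale (1 / k * (1 / k)) (?y \<odot> (x \<odot> ?y))"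
      by (simp only: e mul_scale_left mul_scale_right mul_assoc gvs.scale_scale)
    also have "\<dots> = gscale (1 / k * s) (young_idem r c)"
      by (simp only: s e gvs.scale_scale) (simp add: mult_ac)
    finally show "\<exists>s. young_idem r c \<odot> x \<odot> young_idem r c = gscale s (young_idem r c)" by blast
  qed
  have "k \<in> \<real>" using real_elt_mul[OF real_elt_young real_elt_young] by (auto simp: real_elt_def k_def)
  then show "real_elt (young_idem r c)" unfolding e by (intro real_elt_scale real_elt_young) auto
qed

text \<open>A nonzero product \<open>c\<^sub>\<mu> x c\<^sub>\<nu>\<close> would give one of the form \<open>c\<^sub>\<nu> x' c\<^sub>\<mu>\<close>, and the two together force
  equal column statistics, hence \<open>\<mu> = \<nu>\<close>.\<close>

lemma young_idem_disjoint:
  assumes mu: "tab \<mu> r c" "\<mu> \<in> Par n" and nu: "tab \<nu> r' c'" "\<nu> \<in> Par m" and ne: "\<mu> \<noteq> \<nu>"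
    and x: "x \<in> GA"
  shows "young_idem r c \<odot> (x \<odot> young_idem r' c') = 0"
proof -
  have main: "young r c \<odot> (x \<odot> young r' c') = 0"
    if "tab \<mu> r c" "\<mu> \<in> Par n" "tab \<nu> r' c'" "\<nu> \<in> Par m" "\<mu> \<noteq> \<nu>" "col_stat \<mu> \<ge> col_stat \<nu>" "x \<in> GA"
    for \<mu> \<nu> n m r r' c c' x
  proof (rule ccontr)
    assume "\<not> ?thesis"
    then have "sym_sum r \<odot> ((alt_sum c \<odot> (x \<odot> sym_sum r')) \<odot> alt_sum c') \<noteq> 0"
      by (simp add: mul_assoc)
    from sym_alt_disjoint[OF that(1,3) _ this] that show False by simp
  qed
  have "young r c \<odot> (x \<odot> young r' c') = 0"
  proof (cases "col_stat \<mu> \<ge> col_stat \<nu>")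
    case True
    then show ?thesis using main[OF mu nu ne _ x] by simp
  next
    case False
    then have "young r' c' \<odot> (y \<odot> young r c) = 0" if "y \<in> GA" for y
      using main[OF nu mu _ _ that] ne by simp
    from disjoint_sym[OF _ _ this x] show ?thesis by simp
  qed
  then show ?thesis by (simp add: young_idem_def)
qed

definition row :: "nat list \<Rightarrow> nat \<Rightarrow> nat" where
  "row \<mu> x = fst (inv_into (diagram \<mu>) (tableau A \<mu>) x)"
definition col :: "nat list \<Rightarrow> nat \<Rightarrow> nat" where
  "col \<mu> x = snd (inv_into (diagram \<mu>) (tableau A \<mu>) x)"

lemma tableau_bij:
  assumes "sum_list \<mu> = card A" shows "bij_betw (tableau A \<mu>) (diagram \<mu>) A"
proof -
  have "\<exists>t. bij_betw t (diagram \<mu>) A"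
    by (rule finite_same_card_bij) (use assms fin in \<open>auto simp: card_diagram\<close>)
  then show ?thesis unfolding tableau_def by (rule someI_ex)
qed

lemma row_col_tab:
  assumes "sum_list \<mu> = card A" shows "tab \<mu> (row \<mu>) (col \<mu>)"
  unfolding tab_def row_def col_def
  using bij_betw_inv_into[OF tableau_bij[OF assms]] by simp

lemma row_col_tableau:
  assumes "sum_list \<mu> = card A" "(i, j) \<in> diagram \<mu>"
  shows "row \<mu> (tableau A \<mu> (i, j)) = i" "col \<mu> (tableau A \<mu> (i, j)) = j"
    "tableau A \<mu> (i, j) \<in> A"
  using tableau_bij[OF assms(1)] assms(2)
  by (auto simp: row_def col_def bij_betw_def)

lemma tableau_row_col:
  assumes "sum_list \<mu> = card A" "x \<in> A"
  shows "tableau A \<mu> (row \<mu> x, col \<mu> x) = x" "(row \<mu> x, col \<mu> x) \<in> diagram \<mu>"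
  using bij_betw_inv_into_right[OF tableau_bij[OF assms(1)] assms(2)]
    bij_betw_inv_into[OF tableau_bij[OF assms(1)]] assms(2)
  by (auto simp: row_def col_def bij_betw_def)

lemma stab_tableau_iff:
  assumes \<mu>: "sum_list \<mu> = card A" and \<sigma>: "\<sigma> \<in> G"
    and f: "\<And>i j. (i, j) \<in> diagram \<mu> \<Longrightarrow> f (tableau A \<mu> (i, j)) = h (i, j)"
  shows "\<sigma> \<in> stab f \<longleftrightarrow> (\<forall>i j. (i, j) \<in> diagram \<mu> \<longrightarrow>
    (\<exists>p\<in>diagram \<mu>. h p = h (i, j) \<and> \<sigma> (tableau A \<mu> (i, j)) = tableau A \<mu> p))"
proof
  assume s: "\<sigma> \<in> stab f"
  have "\<exists>p\<in>diagram \<mu>. h p = h (i, j) \<and> \<sigma> (tableau A \<mu> (i, j)) = tableau A \<mu> p"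
    if ij: "(i, j) \<in> diagram \<mu>" for i j
  proof -
    let ?x = "tableau A \<mu> (i, j)"
    have x: "?x \<in> A" "\<sigma> ?x \<in> A" using row_col_tableau(3)[OF \<mu> ij] \<sigma> by simp_all
    note t = tableau_row_col[OF \<mu> x(2)]
    have "h (row \<mu> (\<sigma> ?x), col \<mu> (\<sigma> ?x)) = f (\<sigma> ?x)" using f[OF t(2)] t(1) by simp
    also have "\<dots> = h (i, j)" using s x(1) f[OF ij] by (simp add: stab_def)
    finally show ?thesis using t by (intro bexI[of _ "(row \<mu> (\<sigma> ?x), col \<mu> (\<sigma> ?x))"]) simp_all
  qed
  then show "\<forall>i j. (i, j) \<in> diagram \<mu> \<longrightarrow>
    (\<exists>p\<in>diagram \<mu>. h p = h (i, j) \<and> \<sigma> (tableau A \<mu> (i, j)) = tableau A \<mu> p)" by blast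
next
  assume R: "\<forall>i j. (i, j) \<in> diagram \<mu> \<longrightarrow>
    (\<exists>p\<in>diagram \<mu>. h p = h (i, j) \<and> \<sigma> (tableau A \<mu> (i, j)) = tableau A \<mu> p)"
  have "f (\<sigma> x) = f x" if x: "x \<in> A" for x
  proof -
    note t = tableau_row_col[OF \<mu> x]
    obtain i j where "(i, j) \<in> diagram \<mu>" "h (i, j) = h (row \<mu> x, col \<mu> x)" "\<sigma> x = tableau A \<mu> (i, j)"
      using R t by (metis surj_pair)
    then show ?thesis using f[OF t(2)] f t(1) by simp
  qed
  then show "\<sigma> \<in> stab f" using \<sigma> by (simp add: stab_def)
qed

lemma row_group_eq:
  assumes "sum_list \<mu> = card A" shows "row_group A \<mu> = stab (row \<mu>)"
proof (rule set_eqI)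
  fix \<sigma>
  have ex: "(\<exists>p\<in>D. fst p = i \<and> P p) \<longleftrightarrow> (\<exists>k. (i, k) \<in> D \<and> P (i, k))"
    for D i and P :: "nat \<times> nat \<Rightarrow> bool" by force
  show "\<sigma> \<in> row_group A \<mu> \<longleftrightarrow> \<sigma> \<in> stab (row \<mu>)"
  proof (cases "\<sigma> \<in> G")
    case True
    have "\<And>i j. (i, j) \<in> diagram \<mu> \<Longrightarrow> row \<mu> (tableau A \<mu> (i, j)) = fst (i, j)"
      using row_col_tableau(1)[OF assms] by simp
    from stab_tableau_iff[where f="row \<mu>" and h=fst, OF assms True this, unfolded fst_conv ex] show ?thesis
      using True by (simp add: row_group_def)
  next
    case False
    then show ?thesis using stab_G[of \<sigma> "row \<mu>"] by (auto simp: row_group_def)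
  qed
qed

lemma column_group_eq:
  assumes "sum_list \<mu> = card A" shows "column_group A \<mu> = stab (col \<mu>)"
proof (rule set_eqI)
  fix \<sigma>
  have ex: "(\<exists>p\<in>D. snd p = j \<and> P p) \<longleftrightarrow> (\<exists>k. (k, j) \<in> D \<and> P (k, j))"
    for D j and P :: "nat \<times> nat \<Rightarrow> bool" by force
  show "\<sigma> \<in> column_group A \<mu> \<longleftrightarrow> \<sigma> \<in> stab (col \<mu>)"
  proof (cases "\<sigma> \<in> G")
    case True
    have "\<And>i j. (i, j) \<in> diagram \<mu> \<Longrightarrow> col \<mu> (tableau A \<mu> (i, j)) = snd (i, j)"
      using row_col_tableau(2)[OF assms] by simp
    from stab_tableau_iff[where f="col \<mu>" and h=snd, OF assms True this, unfolded snd_conv ex] show ?thesis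
      using True by (simp add: column_group_def)
  next
    case False
    then show ?thesis using stab_G[of \<sigma> "col \<mu>"] by (auto simp: column_group_def)
  qed
qed

definition idem :: "nat list \<Rightarrow> galg" where "idem \<mu> = young_idem (row \<mu>) (col \<mu>)"

lemma young_symmetrizer_eq:
  "sum_list \<mu> = card A \<Longrightarrow> young_symmetrizer A \<mu> = young (row \<mu>) (col \<mu>)"
  by (simp add: young_symmetrizer_def row_group_eq column_group_eq sym_sum_def alt_sum_def)

lemma idem_prim: "sum_list \<mu> = card A \<Longrightarrow> prim (idem \<mu>)"
  unfolding idem_def by (rule young_idem_prim(1)[OF row_col_tab])

lemma real_elt_idem: "sum_list \<mu> = card A \<Longrightarrow> real_elt (idem \<mu>)"
  unfolding idem_def by (rule young_idem_prim(2)[OF row_col_tab])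

lemma irrep_space_eq:
  assumes "sum_list \<mu> = card A" shows "irrep_space A \<mu> = {x \<odot> idem \<mu> |x. x \<in> GA}"
proof -
  obtain s where s: "s \<noteq> 0" "young (row \<mu>) (col \<mu>) = gscale s (idem \<mu>)"
    using young_idem_prim(3)[OF row_col_tab[OF assms]] by (auto simp: idem_def)
  have "x \<odot> idem \<mu> = gscale (1 / s) x \<odot> gscale s (idem \<mu>)" for x using s(1) by simp
  moreover have "x \<odot> gscale s (idem \<mu>) = gscale s x \<odot> idem \<mu>" for x by simp
  ultimately show ?thesis unfolding irrep_space_def young_symmetrizer_eq[OF assms] s(2)
    using GA_scale by blast
qed

end

section \<open>Marked cycle types\<close>

lemma funpow_eq_iff:
  assumes "f permutes A" "finite A"
  shows "(f ^^ i) x = (f ^^ j) x \<longleftrightarrow> i mod card (orbit f x) = j mod card (orbit f x)"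
    and "card (orbit f x) > 0"
proof -
  let ?p = "funpow_dist1 f x x"
  have x: "x \<in> orbit f x"
    using assms by (meson permutation_self_in_orbit permutes_imp_permutation)
  have inj: "inj_on (\<lambda>n. (f ^^ n) x) {0..<?p}" by (rule inj_on_funpow_dist1[OF x])
  have p: "card (orbit f x) = ?p"
    using orbit_conv_funpow_dist1[OF x] card_image[OF inj] by simp
  have "(f ^^ ?p) x = x" by (rule funpow_dist1_prop[OF x])
  then have m: "(f ^^ k) x = (f ^^ (k mod ?p)) x" for k using funpow_mod_eq[of ?p f x k] by simp
  show "card (orbit f x) > 0" using p by simp
  have "(f ^^ i) x = (f ^^ j) x \<longleftrightarrow> (f ^^ (i mod ?p)) x = (f ^^ (j mod ?p)) x"
    using m[of i] m[of j] by simp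
  also have "\<dots> \<longleftrightarrow> i mod ?p = j mod ?p"
    using inj_on_eq_iff[OF inj, of "i mod ?p" "j mod ?p"] by simp
  finally show "(f ^^ i) x = (f ^^ j) x \<longleftrightarrow> i mod card (orbit f x) = j mod card (orbit f x)"
    unfolding p .
qed

lemma orbit_facts:
  assumes "f permutes A" "finite A"
  shows "x \<in> orbit f x" "y \<in> orbit f x \<Longrightarrow> orbit f y = orbit f x"
    "y \<in> orbit f x \<Longrightarrow> \<exists>k. y = (f ^^ k) x" "(f ^^ k) x \<in> orbit f x"
    "x \<in> A \<Longrightarrow> orbit f x \<subseteq> A"
proof -
  have p: "permutation f" using assms by (meson permutes_imp_permutation)
  show x: "x \<in> orbit f x" using permutation_self_in_orbit[OF p] .
  show "y \<in> orbit f x \<Longrightarrow> orbit f y = orbit f x"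
    using orbit_cyclic_eq3[OF cyclic_on_orbit[OF assms]] by blast
  show "y \<in> orbit f x \<Longrightarrow> \<exists>k. y = (f ^^ k) x"
    by (auto simp: orbit_altdef_self_in[OF x])
  show "(f ^^ k) x \<in> orbit f x" by (auto simp: orbit_altdef_self_in[OF x])
  show "x \<in> A \<Longrightarrow> orbit f x \<subseteq> A" using permutes_orbit_subset[OF assms(1)] .
qed

text \<open>Any bijection that respects the weights can be corrected by a transposition inside one level so
  that it maps \<open>a\<close> to \<open>b\<close>.\<close>

lemma level_bijection:
  assumes fin: "finite S" "finite T" and ab: "a \<in> S" "b \<in> T" "wt a = wt' b"
    and cnt: "\<And>l. card {x \<in> S. wt x = l} = card {y \<in> T. wt' y = l}"
  obtains F where "bij_betw F S T" "\<And>x. x \<in> S \<Longrightarrow> wt' (F x) = wt x" "F a = b"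
proof -
  have "\<exists>f. bij_betw f {x \<in> S. wt x = l} {y \<in> T. wt' y = l}" for l
    using fin by (intro finite_same_card_bij cnt) simp_all
  then obtain f where f: "\<And>l. bij_betw (f l) {x \<in> S. wt x = l} {y \<in> T. wt' y = l}" by metis
  define F where "F x = f (wt x) x" for x
  have F: "F x \<in> T" "wt' (F x) = wt x" if "x \<in> S" for x
    using bij_betwE[OF f[of "wt x"]] that by (auto simp: F_def)
  have "inj_on F S"
  proof (rule inj_onI)
    fix x y assume xy: "x \<in> S" "y \<in> S" "F x = F y"
    then have w: "wt x = wt y" using F by metis
    show "x = y"
      by (rule inj_onD[OF bij_betw_imp_inj_on[OF f[of "wt x"]]]) (use xy w in \<open>auto simp: F_def\<close>)
  qed
  moreover have "F ` S = T"
  proof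
    show "F ` S \<subseteq> T" using F by auto
    show "T \<subseteq> F ` S"
    proof
      fix y assume "y \<in> T"
      then have "y \<in> f (wt' y) ` {x \<in> S. wt x = wt' y}"
        using bij_betw_imp_surj_on[OF f[of "wt' y"]] by simp
      then obtain x where "x \<in> S" "wt x = wt' y" "y = f (wt' y) x" by blast
      then have "y = F x" by (simp add: F_def)
      then show "y \<in> F ` S" using \<open>x \<in> S\<close> by blast
    qed
  qed
  ultimately have bij: "bij_betw F S T" by (simp add: bij_betw_def)
  let ?t = "transpose (F a) b"
  have "bij_betw ?t T T" using permutes_swap_id[OF F(1)[OF ab(1)] ab(2)] by (rule permutes_imp_bij)
  with bij have "bij_betw (?t \<circ> F) S T" by (rule bij_betw_trans)
  moreover have "wt' (?t y) = wt' y" for y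
    by (simp add: transpose_def F(2)[OF ab(1)] ab(3))
  then have "wt' ((?t \<circ> F) x) = wt x" if "x \<in> S" for x
    by (simp add: F(2)[OF that])
  moreover have "(?t \<circ> F) a = b" by simp
  ultimately show ?thesis using that by blast
qed

text \<open>Match the cycles of both permutations by length and the cycles through \<open>a\<close> with each other,
  choose a base point on every cycle, namely \<open>a\<close> on the marked ones, and move along the cycles
  simultaneously.\<close>

lemma marked_conjugate:
  fixes \<sigma> \<tau> :: "'a \<Rightarrow> 'a"
  assumes A: "finite A" and s: "\<sigma> permutes A" and t: "\<tau> permutes A" and a: "a \<in> A"
    and mark: "card (orbit \<sigma> a) = card (orbit \<tau> a)"
    and type: "\<And>l. card {Z \<in> orbit \<sigma> ` A. card Z = l} = card {Z \<in> orbit \<tau> ` A. card Z = l}"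
  obtains h where "h permutes A" "h a = a" "h \<circ> \<sigma> = \<tau> \<circ> h"
proof -
  note so = orbit_facts[OF s A] and to = orbit_facts[OF t A]
  obtain F where F: "bij_betw F (orbit \<sigma> ` A) (orbit \<tau> ` A)"
      "\<And>Z. Z \<in> orbit \<sigma> ` A \<Longrightarrow> card (F Z) = card Z" "F (orbit \<sigma> a) = orbit \<tau> a"
    using level_bijection[of "orbit \<sigma> ` A" "orbit \<tau> ` A" "orbit \<sigma> a" "orbit \<tau> a" card card]
      A a mark type by auto
  define r where "r Z = (if Z = orbit \<sigma> a then a else SOME x. x \<in> Z)" for Z
  define r' where "r' Z = (if Z = orbit \<tau> a then a else SOME x. x \<in> Z)" for Z
  have r: "r (orbit \<sigma> x) \<in> orbit \<sigma> x" for x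
    using so(1) someI[of "\<lambda>y. y \<in> orbit \<sigma> x", OF so(1)] by (simp add: r_def)
  have r': "r' Z \<in> Z" if "Z \<in> orbit \<tau> ` A" for Z
  proof -
    from that obtain x where "Z = orbit \<tau> x" by blast
    then show ?thesis
      using to(1) someI[of "\<lambda>y. y \<in> orbit \<tau> x", OF to(1)] by (simp add: r'_def)
  qed
  define b where "b x = r (orbit \<sigma> x)" for x
  define b' where "b' x = r' (F (orbit \<sigma> x))" for x
  have b: "orbit \<sigma> (b x) = orbit \<sigma> x" for x unfolding b_def by (rule so(2)[OF r])
  have b': "orbit \<tau> (b' x) = F (orbit \<sigma> x)" "b' x \<in> A" if x: "x \<in> A" for x
  proof -
    have FO: "F (orbit \<sigma> x) \<in> orbit \<tau> ` A" using F(1) x by (auto simp: bij_betw_def)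
    then obtain y where y: "y \<in> A" "F (orbit \<sigma> x) = orbit \<tau> y" by auto
    have "b' x \<in> orbit \<tau> y" using r'[OF FO] y by (simp add: b'_def)
    then show "orbit \<tau> (b' x) = F (orbit \<sigma> x)" "b' x \<in> A"
      using to(2)[of "b' x" y] to(5)[OF y(1)] y by auto
  qed
  have "\<exists>k. x = (\<sigma> ^^ k) (b x)" for x using so(1)[of x] so(3)[of x "b x"] b by simp
  then obtain k where k: "\<And>x. x = (\<sigma> ^^ k x) (b x)" by metis
  define h where "h x = (if x \<in> A then (\<tau> ^^ k x) (b' x) else x)" for x
  have h_in: "h x \<in> F (orbit \<sigma> x)" if "x \<in> A" for x
    using to(4)[of "k x" "b' x"] b'(1)[OF that] that by (simp add: h_def)
  have hA: "h x \<in> A" if "x \<in> A" for x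
    using to(4)[of "k x" "b' x"] to(5)[OF b'(2)[OF that]] that by (auto simp: h_def)
  have period: "card (orbit \<tau> (b' x)) = card (orbit \<sigma> (b x))" if "x \<in> A" for x
    using b'(1)[OF that] b[of x] F(2) that by simp
  have inj: "inj_on h A"
  proof (rule inj_onI)
    fix x y assume xy: "x \<in> A" "y \<in> A" "h x = h y"
    obtain x' y' where o: "F (orbit \<sigma> x) = orbit \<tau> x'" "F (orbit \<sigma> y) = orbit \<tau> y'"
      using b'(1)[OF xy(1)] b'(1)[OF xy(2)] by metis
    then have "F (orbit \<sigma> x) = F (orbit \<sigma> y)"
      using h_in[OF xy(1)] h_in[OF xy(2)] to(2) xy(3) by metis
    then have oxy: "orbit \<sigma> x = orbit \<sigma> y"
      using F(1) xy(1,2) by (auto simp: bij_betw_def inj_on_def)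
    then have bb: "b x = b y" "b' x = b' y" by (simp_all add: b_def b'_def)
    then have "(\<tau> ^^ k x) (b' x) = (\<tau> ^^ k y) (b' x)" using xy by (simp add: h_def)
    then have "k x mod card (orbit \<sigma> (b x)) = k y mod card (orbit \<sigma> (b x))"
      by (simp add: funpow_eq_iff(1)[OF t A] period[OF xy(1)])
    then have "(\<sigma> ^^ k x) (b x) = (\<sigma> ^^ k y) (b x)"
      by (simp add: funpow_eq_iff(1)[OF s A])
    then show "x = y" using k bb by metis
  qed
  have "bij_betw h A A" using inj hA A by (simp add: bij_betw_def endo_inj_surj image_subset_iff)
  then have hp: "h permutes A" by (rule bij_imp_permutes) (simp add: h_def)
  have hk: "h x = (\<tau> ^^ m) (b' x)" if "x \<in> A" "x = (\<sigma> ^^ m) (b x)" for x m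
  proof -
    have "(\<sigma> ^^ k x) (b x) = (\<sigma> ^^ m) (b x)" using k[of x] that(2) by simp
    then have "(\<tau> ^^ k x) (b' x) = (\<tau> ^^ m) (b' x)"
      by (simp add: funpow_eq_iff(1)[OF t A] funpow_eq_iff(1)[OF s A] period[OF that(1)])
    then show ?thesis using that by (simp add: h_def)
  qed
  have "h a = (\<tau> ^^ 0) (b' a)" by (rule hk) (simp_all add: a b_def r_def)
  then have ha: "h a = a" using F(3) by (simp add: b'_def r'_def)
  have "h (\<sigma> x) = \<tau> (h x)" for x
  proof (cases "x \<in> A")
    case True
    have "\<sigma> x \<in> orbit \<sigma> x" using so(4)[of 1 x] by simp
    then have o: "orbit \<sigma> (\<sigma> x) = orbit \<sigma> x" by (rule so(2))
    have "h (\<sigma> x) = (\<tau> ^^ Suc (k x)) (b' (\<sigma> x))"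
      by (rule hk) (use True s k[of x] o in \<open>auto simp: b_def permutes_in_image\<close>)
    then show ?thesis using True o by (simp add: h_def b'_def)
  next
    case False
    then show ?thesis using permutes_not_in[OF s] permutes_not_in[OF t] by (simp add: h_def)
  qed
  then have "h \<circ> \<sigma> = \<tau> \<circ> h" by (simp add: fun_eq_iff)
  then show ?thesis by (rule that[OF hp ha])
qed

text \<open>In a decreasing list the entries exceeding \<open>j\<close> form an initial segment, so the length of
  column \<open>j\<close> of the diagram is the number of these entries.\<close>

lemma desc_filter:
  fixes xs :: "nat list"
  assumes "sorted_wrt (\<ge>) xs"
  shows "i < length xs \<and> j < xs ! i \<longleftrightarrow> i < length (filter (\<lambda>x. j < x) xs)"
  using assms
proof (induction xs arbitrary: i)
  case (Cons x xs)
  show ?case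
  proof (cases "j < x")
    case True
    then show ?thesis using Cons by (cases i) auto
  next
    case False
    then have "\<forall>y\<in>set (x # xs). \<not> j < y" using Cons.prems by auto
    then have "filter (\<lambda>x. j < x) (x # xs) = []" by (simp only: filter_False)
    moreover have "\<not> (i < length (x # xs) \<and> j < (x # xs) ! i)"
      using \<open>\<forall>y\<in>set (x # xs). \<not> j < y\<close> nth_mem by metis
    ultimately show ?thesis by (metis list.size(3) not_less_zero)
  qed
qed simp

definition desc :: "nat multiset \<Rightarrow> nat list" where
  "desc M = rev (sorted_list_of_multiset M)"

lemma mset_desc [simp]: "mset (desc M) = M"
  by (simp add: desc_def)

lemma desc_Par: "0 \<notin># M \<Longrightarrow> desc M \<in> Par (\<Sum>\<^sub># M)"
  unfolding Par_def using sorted_sorted_list_of_multiset[of M]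
  by (auto simp: desc_def sorted_wrt_rev simp flip: sum_mset_sum_list)

lemma diagram_desc: "(i, j) \<in> diagram (desc M) \<longleftrightarrow> i < size (filter_mset (\<lambda>x. j < x) M)"
proof -
  have "sorted_wrt (\<ge>) (desc M)"
    using sorted_sorted_list_of_multiset[of M] by (simp add: desc_def sorted_wrt_rev)
  moreover have "size (filter_mset (\<lambda>x. j < x) M) = length (filter (\<lambda>x. j < x) (desc M))"
    by (metis mset_filter mset_desc size_mset)
  ultimately show ?thesis using desc_filter[of "desc M" i j] by (simp add: diagram_def)
qed

definition shrink_part :: "nat \<Rightarrow> nat multiset \<Rightarrow> nat multiset" where
  "shrink_part l M = (M - {#l#}) + (if l = 1 then {#} else {#l - 1#})"

text \<open>The last of the rows of length \<open>l\<close> loses its final box. Since this box lies in column \<open>l - 1\<close>, the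
  two diagrams together remember \<open>l\<close>.\<close>

lemma diagram_shrink_part:
  assumes "l \<in># M" "l > 0"
  shows "\<exists>i. (i, l - 1) \<in> diagram (desc M) \<and>
    diagram (desc (shrink_part l M)) = diagram (desc M) - {(i, l - 1)}"
proof -
  define s where "s j = size (filter_mset (\<lambda>x. j < x) M)" for j
  obtain M' where M': "M = add_mset l M'" using assms(1) by (meson multi_member_split)
  have s': "size (filter_mset (\<lambda>x. j < x) (shrink_part l M)) = s j - (if j = l - 1 then 1 else 0)" for j
    using assms(2) by (auto simp: s_def shrink_part_def M')
  have pos: "s (l - 1) > 0" using assms(2) by (simp add: s_def M')
  show ?thesis
  proof (intro exI conjI set_eqI)
    show "(s (l - 1) - 1, l - 1) \<in> diagram (desc M)" using pos by (simp add: diagram_desc s_def)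
    fix p :: "nat \<times> nat"
    obtain i j where "p = (i, j)" by (cases p)
    then show "p \<in> diagram (desc (shrink_part l M)) \<longleftrightarrow>
        p \<in> diagram (desc M) - {(s (l - 1) - 1, l - 1)}"
      using pos by (auto simp: diagram_desc s' simp flip: s_def)
  qed
qed

definition cycle_type :: "nat \<Rightarrow> perm_fun \<Rightarrow> nat multiset" where
  "cycle_type n \<sigma> = image_mset card (mset_set (orbit \<sigma> ` {0..n}))"

text \<open>A partition with a marked part is encoded as a pair of shapes: the partition and the result of
  shrinking the marked part. Here the marked part is the length of the cycle through \<open>0\<close>.\<close>

definition marked_shape :: "nat \<Rightarrow> perm_fun \<Rightarrow> nat \<times> nat list \<times> nat list" where
  "marked_shape n \<sigma> =
     (n, desc (shrink_part (card (orbit \<sigma> 0)) (cycle_type n \<sigma>)), desc (cycle_type n \<sigma>))"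

lemma cycle_type_facts:
  assumes "\<sigma> \<in> Sym {0..n}"
  shows "card (orbit \<sigma> 0) \<in># cycle_type n \<sigma>" "0 \<notin># cycle_type n \<sigma>" "\<Sum>\<^sub># (cycle_type n \<sigma>) = n + 1"
    "card (orbit \<sigma> 0) > 0"
proof -
  have s: "\<sigma> permutes {0..n}" using assms by (simp add: Sym_def)
  note o = orbit_facts[OF s finite_atLeastAtMost] and pos = funpow_eq_iff(2)[OF s finite_atLeastAtMost]
  show "card (orbit \<sigma> 0) > 0" by (rule pos)
  show "card (orbit \<sigma> 0) \<in># cycle_type n \<sigma>" by (auto simp: cycle_type_def)
  show "0 \<notin># cycle_type n \<sigma>" using pos by (auto simp: cycle_type_def) (metis less_irrefl)
  have "\<Sum>\<^sub># (cycle_type n \<sigma>) = (\<Sum>Z\<in>orbit \<sigma> ` {0..n}. card Z)"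
    by (simp add: cycle_type_def sum_unfold_sum_mset)
  also have "\<dots> = card (\<Union> (orbit \<sigma> ` {0..n}))"
  proof (rule card_Union_disjoint[symmetric])
    show "pairwise disjnt (orbit \<sigma> ` {0..n})"
      using o(2) by (auto simp: pairwise_def disjnt_def) blast+
  qed (use o(5) finite_subset in blast)
  also have "\<Union> (orbit \<sigma> ` {0..n}) = {0..n}" using o(1,5) by blast
  finally show "\<Sum>\<^sub># (cycle_type n \<sigma>) = n + 1" by simp
qed

lemma marked_shape_box_pair:
  assumes "\<sigma> \<in> Sym {0..n}" shows "marked_shape n \<sigma> \<in> box_pairs"
proof -
  let ?M = "cycle_type n \<sigma>" and ?l = "card (orbit \<sigma> 0)"
  note f = cycle_type_facts[OF assms]
  obtain M' where M': "?M = add_mset ?l M'" using f(1) by (meson multi_member_split)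
  have "\<Sum>\<^sub># (shrink_part ?l ?M) = n" using f(3,4) by (auto simp: shrink_part_def M')
  moreover have "0 \<notin># shrink_part ?l ?M"
    using f(2,4) by (auto simp: shrink_part_def M' split: if_splits)
  ultimately have "desc (shrink_part ?l ?M) \<in> Par n" using desc_Par by metis
  moreover have "desc ?M \<in> Par (n + 1)" using desc_Par[OF f(2)] f(3) by simp
  moreover have "adds_box (desc (shrink_part ?l ?M)) (desc ?M)"
    using diagram_shrink_part[OF f(1,4)] unfolding adds_box_def by blast
  ultimately show ?thesis by (simp add: marked_shape_def box_pairs_def)
qed

lemma marked_shape_conjugate:
  assumes s: "\<sigma> \<in> Sym {0..n}" and t: "\<tau> \<in> Sym {0..n}" and eq: "marked_shape n \<sigma> = marked_shape n \<tau>"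
  obtains h where "h \<in> Sym {1..n}" "\<tau> = h \<circ> \<sigma> \<circ> inv h"
proof -
  let ?M = "cycle_type n \<sigma>"
  have M: "cycle_type n \<tau> = ?M" using eq mset_desc by (metis marked_shape_def prod.inject)
  have "\<exists>i. {(i, card (orbit \<rho> 0) - 1)} =
      diagram (snd (snd (marked_shape n \<rho>))) - diagram (fst (snd (marked_shape n \<rho>)))"
    if "\<rho> \<in> Sym {0..n}" for \<rho>
    using diagram_shrink_part[OF cycle_type_facts(1,4)[OF that]] by (auto simp: marked_shape_def)
  from this[OF s] this[OF t] have "card (orbit \<sigma> 0) - 1 = card (orbit \<tau> 0) - 1"
    using eq by (metis prod.inject singleton_inject)
  then have mark: "card (orbit \<sigma> 0) = card (orbit \<tau> 0)"
    using cycle_type_facts(4)[OF s] cycle_type_facts(4)[OF t] by simp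
  have cnt: "card {Z \<in> orbit \<rho> ` {0..n}. card Z = l} = count (cycle_type n \<rho>) l" for \<rho> l
  proof -
    have "count (cycle_type n \<rho>) l = (\<Sum>Z | Z \<in> orbit \<rho> ` {0..n} \<and> l = card Z. 1)"
      unfolding cycle_type_def count_image_mset' by (rule sum.cong) auto
    then show ?thesis by (simp add: conj_commute eq_commute)
  qed
  obtain h where h: "h permutes {0..n}" "h 0 = 0" "h \<circ> \<sigma> = \<tau> \<circ> h"
    using marked_conjugate[of "{0..n}" \<sigma> \<tau> 0] s t mark cnt M by (auto simp: Sym_def)
  have "h permutes {1..n}"
    by (rule permutes_superset[OF h(1)]) (use h(2) in \<open>auto simp: Suc_le_eq\<close>)
  moreover have "\<tau> = h \<circ> \<sigma> \<circ> inv h"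
    using h(3) permutes_inv_o(1)[OF h(1)] by (metis comp_assoc comp_id)
  ultimately show ?thesis using that by (simp add: Sym_def)
qed

section \<open>The relative center\<close>

(* keeps the interval {1..n} from being rewritten to {Suc 0..n} *)
declare One_nat_def [simp del]

locale rel_pair = ground_pair "{0..n}" "{1..n}" for n :: nat

lemma is_rel_pair: "rel_pair n"
  by unfold_locales auto

context rel_pair
begin

notation mul (infixl "\<odot>" 70)

abbreviation z_small :: "nat list \<Rightarrow> galg" where "z_small \<mu> \<equiv> small.central_proj (small.idem \<mu>)"
abbreviation z_big :: "nat list \<Rightarrow> galg" where "z_big \<nu> \<equiv> central_proj (idem \<nu>)"

text \<open>Multiplication by the product of the two projections cuts out the part of type \<open>\<mu>\<close> from the
  representations of type \<open>\<nu>\<close>.\<close>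

definition block :: "nat list \<Rightarrow> nat list \<Rightarrow> galg" where "block \<mu> \<nu> = z_small \<mu> \<odot> z_big \<nu>"

lemma small_idem_prim: "\<mu> \<in> Par n \<Longrightarrow> small.prim (small.idem \<mu>)"
  by (rule small.idem_prim) (simp add: Par_def)
lemma big_idem_prim: "\<nu> \<in> Par (n + 1) \<Longrightarrow> prim (idem \<nu>)"
  by (rule idem_prim) (simp add: Par_def)

lemma z_small_GA: "\<mu> \<in> Par n \<Longrightarrow> z_small \<mu> \<in> small.GA"
  using small.primD(1)[OF small_idem_prim] by simp

lemma z_small_GA' [simp]: "\<mu> \<in> Par n \<Longrightarrow> z_small \<mu> \<in> GA"
  by (rule small_GA[OF z_small_GA])

lemma z_big_GA [simp]: "\<nu> \<in> Par (n + 1) \<Longrightarrow> z_big \<nu> \<in> GA"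
  using primD(1)[OF big_idem_prim] by simp

lemma block_GA [simp]: "\<nu> \<in> Par (n + 1) \<Longrightarrow> block \<mu> \<nu> \<in> GA"
  by (simp add: block_def)

lemma z_big_commute: "x \<in> GA \<Longrightarrow> x \<odot> z_big \<nu> = z_big \<nu> \<odot> x"
  by (rule central_proj_commute)

lemma z_small_idem: "\<mu> \<in> Par n \<Longrightarrow> z_small \<mu> \<odot> z_small \<mu> = z_small \<mu>"
  using small.central_proj_idem[OF small_idem_prim] small_mul[OF z_small_GA] by simp

lemma z_small_left: "\<mu> \<in> Par n \<Longrightarrow> z_small \<mu> \<odot> small.idem \<mu> = small.idem \<mu>"
  using small.central_proj_left[OF small_idem_prim] small_mul[OF z_small_GA] by simp

lemma z_small_commute: "\<mu> \<in> Par n \<Longrightarrow> x \<in> small.GA \<Longrightarrow> x \<odot> z_small \<mu> = z_small \<mu> \<odot> x"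
  using small.central_proj_commute[of x "small.idem \<mu>"] small_mul[OF z_small_GA] small_mul by metis

lemma z_small_adj: "\<mu> \<in> Par n \<Longrightarrow> adj (z_small \<mu>) = z_small \<mu>"
  using small.central_proj_adj[OF small_idem_prim] small_adj[OF z_small_GA] by simp

lemma z_small_orthogonal:
  assumes "\<mu> \<in> Par n" "\<mu>' \<in> Par n" "\<mu> \<noteq> \<mu>'" shows "z_small \<mu> \<odot> z_small \<mu>' = 0"
proof -
  have tab: "small.tab \<kappa> (small.row \<kappa>) (small.col \<kappa>)" if "\<kappa> \<in> Par n" for \<kappa>
    by (rule small.row_col_tab) (use that in \<open>simp add: Par_def\<close>)
  have "gmul {1..n} (z_small \<mu>) (z_small \<mu>') = 0"
    by (rule small.central_proj_orthogonal)
       (use assms small.primD(1)[OF small_idem_prim] small.young_idem_disjoint[OF tab _ tab]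
        in \<open>simp_all add: small.idem_def\<close>)
  then show ?thesis using small_mul[OF z_small_GA[OF assms(1)]] by simp
qed

lemma z_big_orthogonal:
  assumes "\<nu> \<in> Par (n + 1)" "\<nu>' \<in> Par (n + 1)" "\<nu> \<noteq> \<nu>'" shows "z_big \<nu> \<odot> z_big \<nu>' = 0"
proof -
  have tab: "tab \<kappa> (row \<kappa>) (col \<kappa>)" if "\<kappa> \<in> Par (n + 1)" for \<kappa>
    by (rule row_col_tab) (use that in \<open>simp add: Par_def\<close>)
  show ?thesis
    by (rule central_proj_orthogonal)
       (use assms primD(1)[OF big_idem_prim] young_idem_disjoint[OF tab _ tab]
        in \<open>simp_all add: idem_def\<close>)
qed

lemma block_mul_block:
  assumes "\<mu> \<in> Par n" "\<nu> \<in> Par (n + 1)" "\<mu>' \<in> Par n" "\<nu>' \<in> Par (n + 1)"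
  shows "block \<mu> \<nu> \<odot> block \<mu>' \<nu>' = (if \<mu> = \<mu>' \<and> \<nu> = \<nu>' then block \<mu> \<nu> else 0)"
proof -
  have "block \<mu> \<nu> \<odot> block \<mu>' \<nu>' = z_small \<mu> \<odot> (z_big \<nu> \<odot> z_small \<mu>') \<odot> z_big \<nu>'"
    by (simp add: block_def mul_assoc)
  also have "z_big \<nu> \<odot> z_small \<mu>' = z_small \<mu>' \<odot> z_big \<nu>"
    using z_big_commute[OF z_small_GA'[OF assms(3)]] by simp
  also have "z_small \<mu> \<odot> (z_small \<mu>' \<odot> z_big \<nu>) \<odot> z_big \<nu>' =
      (z_small \<mu> \<odot> z_small \<mu>') \<odot> (z_big \<nu> \<odot> z_big \<nu>')"
    by (simp add: mul_assoc)
  also have "\<dots> = (if \<mu> = \<mu>' \<and> \<nu> = \<nu>' then block \<mu> \<nu> else 0)"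
    using z_small_orthogonal[OF assms(1,3)] z_big_orthogonal[OF assms(2,4)]
      z_small_idem[OF assms(1)] central_proj_idem[OF big_idem_prim[OF assms(2)]]
    by (auto simp: block_def)
  finally show ?thesis .
qed

lemma block_adj: "\<mu> \<in> Par n \<Longrightarrow> \<nu> \<in> Par (n + 1) \<Longrightarrow> adj (block \<mu> \<nu>) = block \<mu> \<nu>"
  by (simp add: block_def adj_mul z_small_adj central_proj_adj[OF big_idem_prim] z_big_commute)

lemma real_elt_block:
  assumes "\<mu> \<in> Par n" "\<nu> \<in> Par (n + 1)" shows "real_elt (block \<mu> \<nu>)"
proof -
  have "small.real_elt (z_small \<mu>)"
    by (intro small.real_elt_central_proj small.real_elt_idem) (use assms in \<open>simp add: Par_def\<close>)
  then have "real_elt (z_small \<mu>)" by (simp add: real_elt_def small.real_elt_def)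
  moreover have "real_elt (z_big \<nu>)"
    by (intro real_elt_central_proj real_elt_idem) (use assms in \<open>simp add: Par_def\<close>)
  ultimately show ?thesis unfolding block_def by (rule real_elt_mul)
qed

lemma rel_center_iff:
  "\<eta> \<in> rel_center n \<longleftrightarrow> \<eta> \<in> GA \<and> (\<forall>g\<in>small.G. gdelta g \<odot> \<eta> = \<eta> \<odot> gdelta g)"
proof -
  have "gdelta (inv g) \<odot> \<eta> \<odot> gdelta g = \<eta> \<longleftrightarrow> gdelta g \<odot> \<eta> = \<eta> \<odot> gdelta g"
    if "\<eta> \<in> GA" "g \<in> small.G" for g
  proof
    note g = small_G[OF that(2)]
    { assume "gdelta (inv g) \<odot> \<eta> \<odot> gdelta g = \<eta>"
      then have "gdelta g \<odot> \<eta> = gdelta g \<odot> (gdelta (inv g) \<odot> \<eta> \<odot> gdelta g)" by simp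
      then show "gdelta g \<odot> \<eta> = \<eta> \<odot> gdelta g" using g by (simp add: mul_assoc) }
    { assume "gdelta g \<odot> \<eta> = \<eta> \<odot> gdelta g"
      then have "gdelta (inv g) \<odot> \<eta> \<odot> gdelta g = gdelta (inv g) \<odot> (gdelta g \<odot> \<eta>)"
        by (simp only: mul_assoc)
      then show "gdelta (inv g) \<odot> \<eta> \<odot> gdelta g = \<eta>" using g by simp }
  qed
  then show ?thesis by (auto simp: rel_center_def)
qed

lemma subspace_rel_center: "gvs.subspace (rel_center n)"
  by (rule gvs.subspaceI) (auto simp: rel_center_iff mul_add_left mul_add_right)

lemma block_rel_center:
  assumes "\<mu> \<in> Par n" "\<nu> \<in> Par (n + 1)" shows "block \<mu> \<nu> \<in> rel_center n"
proof -
  have "gdelta g \<odot> block \<mu> \<nu> = block \<mu> \<nu> \<odot> gdelta g" if g: "g \<in> small.G" for g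
  proof -
    have "gdelta g \<odot> block \<mu> \<nu> = (gdelta g \<odot> z_small \<mu>) \<odot> z_big \<nu>" by (simp add: block_def mul_assoc)
    also have "\<dots> = z_small \<mu> \<odot> (gdelta g \<odot> z_big \<nu>)"
      using z_small_commute[OF assms(1) small.GA_delta[OF g]] by (simp add: mul_assoc)
    also have "\<dots> = block \<mu> \<nu> \<odot> gdelta g"
      using z_big_commute[OF GA_delta[OF small_G[OF g]]] by (simp add: block_def mul_assoc)
    finally show ?thesis .
  qed
  then show ?thesis using assms by (simp add: rel_center_iff)
qed

text \<open>
  The existence half of the branching rule. After conjugation by a permutation \<open>\<pi>\<close> the chosen
  tableau of \<open>\<mu>\<close> becomes a part of that of \<open>\<nu>\<close>. Then the row and column groups of \<open>\<mu>\<close> are absorbed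
  by the row and column sums \<open>a\<^sub>\<nu>\<close> and \<open>b\<^sub>\<nu>\<close>, so that a multiple of \<open>(a\<^sub>\<nu> b\<^sub>\<nu>)\<^sup>2 \<noteq> 0\<close> contains the
  symmetrizer of \<open>\<mu>\<close> as a factor.
\<close>

lemma branching_nonzero:
  assumes mu: "\<mu> \<in> Par n" and nu: "\<nu> \<in> Par (n + 1)" and box: "adds_box \<mu> \<nu>"
  shows "\<exists>x\<in>GA. small.idem \<mu> \<odot> (x \<odot> idem \<nu>) \<noteq> 0"
proof (rule ccontr)
  assume contra: "\<not> ?thesis"
  have cmu: "sum_list \<mu> = card {1..n}" and cnu: "sum_list \<nu> = card {0..n}"
    using mu nu by (auto simp: Par_def)
  obtain b where b: "b \<in> diagram \<nu>" "diagram \<mu> = diagram \<nu> - {b}"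
    using box by (auto simp: adds_box_def)
  let ?T = "tableau {0..n} \<nu>"
  \<comment> \<open>carries the tableau of \<open>\<mu>\<close> to the corresponding cells of \<open>\<nu>\<close>, and \<open>0\<close> to the added box\<close>
  define \<pi> where "\<pi> x = (if x = 0 then ?T b
      else if x \<in> {1..n} then ?T (small.row \<mu> x, small.col \<mu> x) else x)" for x
  have sm: "(small.row \<mu> x, small.col \<mu> x) \<in> diagram \<mu>" if "x \<in> {1..n}" for x
    by (rule small.tableau_row_col(2)[OF cmu that])
  have injT: "inj_on ?T (diagram \<nu>)" using tableau_bij[OF cnu] by (simp add: bij_betw_def)
  have b_ne: "?T (small.row \<mu> x, small.col \<mu> x) \<noteq> ?T b" if "x \<in> {1..n}" for x
    using inj_onD[OF injT, of "(small.row \<mu> x, small.col \<mu> x)" b] sm[OF that] b by auto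
  have inj: "inj_on \<pi> {0..n}"
  proof (rule inj_onI)
    fix x y assume xy: "x \<in> {0..n}" "y \<in> {0..n}" "\<pi> x = \<pi> y"
    show "x = y"
    proof (cases "x = 0 \<or> y = 0")
      case True
      then show ?thesis using xy b_ne[of x] b_ne[of y] by (auto simp: \<pi>_def split: if_splits)
    next
      case False
      then have r: "x \<in> {1..n}" "y \<in> {1..n}" using xy by auto
      then have "?T (small.row \<mu> x, small.col \<mu> x) = ?T (small.row \<mu> y, small.col \<mu> y)"
        using xy False by (simp add: \<pi>_def)
      then have "(small.row \<mu> x, small.col \<mu> x) = (small.row \<mu> y, small.col \<mu> y)"
        by (rule inj_onD[OF injT]) (use sm r b in auto)
      then show ?thesis
        using small.tableau_row_col(1)[OF cmu r(1)] small.tableau_row_col(1)[OF cmu r(2)] by metis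
    qed
  qed
  have into: "\<pi> x \<in> {0..n}" if "x \<in> {0..n}" for x
    using that tableau_bij[OF cnu] b sm by (auto simp: \<pi>_def bij_betw_def)
  have "bij_betw \<pi> {0..n} {0..n}"
    unfolding bij_betw_def
    by (intro conjI inj endo_inj_surj finite_atLeastAtMost) (use into in blast)
  then have "\<pi> permutes {0..n}" by (rule bij_imp_permutes) (auto simp: \<pi>_def)
  then have pG: "\<pi> \<in> G" by (simp add: Sym_def)
  have rc: "row \<nu> (\<pi> x) = small.row \<mu> x" "col \<nu> (\<pi> x) = small.col \<mu> x" if "x \<in> {1..n}" for x
    using row_col_tableau[OF cnu, of "small.row \<mu> x" "small.col \<mu> x"] sm[OF that] b(2) that
    by (auto simp: \<pi>_def)
  have conj: "\<pi> \<circ> \<sigma> \<circ> inv \<pi> \<in> stab f"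
    if \<sigma>: "\<sigma> \<in> small.stab f'" and ff: "\<And>x. x \<in> {1..n} \<Longrightarrow> f (\<pi> x) = f' x"
    for \<sigma> and f f' :: "nat \<Rightarrow> nat"
  proof -
    have sG: "\<sigma> \<in> small.G" "\<sigma> \<in> G" using \<sigma> small.stab_G small_G by blast+
    have "f (\<pi> (\<sigma> (inv \<pi> x))) = f x" if x: "x \<in> {0..n}" for x
    proof (cases "inv \<pi> x \<in> {1..n}")
      case True
      then have "f (\<pi> (\<sigma> (inv \<pi> x))) = f' (\<sigma> (inv \<pi> x))" using sG(1) small.G_in_A ff by blast
      also have "\<dots> = f' (inv \<pi> x)" using \<sigma> True by (simp add: small.stab_def)
      also have "\<dots> = f (\<pi> (inv \<pi> x))" using ff[OF True] by simp
      finally show ?thesis using pG by simp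
    next
      case False
      then have "\<sigma> (inv \<pi> x) = inv \<pi> x" using sG(1) by (simp add: Sym_def permutes_def)
      then show ?thesis using pG by simp
    qed
    then show ?thesis using sG pG by (simp add: stab_def)
  qed
  have conj_delta: "gdelta \<pi> \<odot> gdelta \<sigma> \<odot> gdelta (inv \<pi>) = gdelta (\<pi> \<circ> \<sigma> \<circ> inv \<pi>)"
    if "\<sigma> \<in> small.stab f" for \<sigma> and f :: "nat \<Rightarrow> nat"
    using pG small_G[OF small.stab_G[OF that]] by simp
  let ?a = "sym_sum (row \<nu>)" and ?b = "alt_sum (col \<nu>)"
  let ?a' = "small.sym_sum (small.row \<mu>)" and ?b' = "small.alt_sum (small.col \<mu>)"
  have A: "?a \<odot> (gdelta \<pi> \<odot> ?a' \<odot> gdelta (inv \<pi>)) =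
      gscale (of_nat (card (small.stab (small.row \<mu>)))) ?a"
  proof -
    have "?a \<odot> (gdelta \<pi> \<odot> ?a' \<odot> gdelta (inv \<pi>)) =
        (\<Sum>\<sigma>\<in>small.stab (small.row \<mu>). ?a \<odot> gdelta (\<pi> \<circ> \<sigma> \<circ> inv \<pi>))"
      unfolding small.sym_sum_def mul_sum_left mul_sum_right
      by (rule sum.cong) (simp_all only: conj_delta)
    also have "\<dots> = (\<Sum>\<sigma>\<in>small.stab (small.row \<mu>). ?a)"
      by (rule sum.cong) (use conj rc in \<open>auto intro!: sym_sum_delta\<close>)
    finally show ?thesis by (simp only: sum_const)
  qed
  have B: "(gdelta \<pi> \<odot> ?b' \<odot> gdelta (inv \<pi>)) \<odot> ?b =
      gscale (of_nat (card (small.stab (small.col \<mu>)))) ?b"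
  proof -
    have "(gdelta \<pi> \<odot> ?b' \<odot> gdelta (inv \<pi>)) \<odot> ?b =
        (\<Sum>\<sigma>\<in>small.stab (small.col \<mu>). gscale (of_int (sign \<sigma>)) (gdelta (\<pi> \<circ> \<sigma> \<circ> inv \<pi>) \<odot> ?b))"
      unfolding small.alt_sum_def mul_sum_left mul_sum_right mul_scale_left mul_scale_right
      by (rule sum.cong) (simp_all only: conj_delta)
    also have "\<dots> = (\<Sum>\<sigma>\<in>small.stab (small.col \<mu>). ?b)"
    proof (rule sum.cong[OF refl])
      fix \<sigma> assume s: "\<sigma> \<in> small.stab (small.col \<mu>)"
      have sG: "\<sigma> \<in> G" using small_G[OF small.stab_G[OF s]] .
      have "sign (\<pi> \<circ> \<sigma> \<circ> inv \<pi>) = sign \<sigma>" using sG pG by (simp add: sign_comp sign_inv)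
      then show "gscale (of_int (sign \<sigma>)) (gdelta (\<pi> \<circ> \<sigma> \<circ> inv \<pi>) \<odot> ?b) = ?b"
        using delta_alt_sum[OF conj[OF s, of "col \<nu>"]] rc by (simp add: sign_square)
    qed
    finally show ?thesis by (simp only: sum_const)
  qed
  let ?y = "young (row \<nu>) (col \<nu>)"
  obtain s where s: "s \<noteq> 0" "?y = gscale s (idem \<nu>)"
    using young_idem_prim(3)[OF row_col_tab[OF cnu]] by (auto simp: idem_def)
  obtain t where t: "?a' \<odot> ?b' = gscale t (small.idem \<mu>)"
    using small.young_idem_prim(3)[OF small.row_col_tab[OF cmu]]
    unfolding small.idem_def small_mul[OF small.sym_sum_GA] by blast
  have "gscale (of_nat (card (small.stab (small.row \<mu>))) * of_nat (card (small.stab (small.col \<mu>)))) (?y \<odot> ?y) =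
      gscale (of_nat (card (small.stab (small.row \<mu>)))) ?a \<odot>
      (gscale (of_nat (card (small.stab (small.col \<mu>)))) ?b \<odot> ?y)"
    by (simp add: mul_assoc)
  also have "\<dots> = ?a \<odot> (gdelta \<pi> \<odot> ?a' \<odot> gdelta (inv \<pi>)) \<odot>
      ((gdelta \<pi> \<odot> ?b' \<odot> gdelta (inv \<pi>)) \<odot> ?b \<odot> ?y)"
    by (simp only: A B)
  also have "\<dots> = ?a \<odot> (gdelta \<pi> \<odot> ((?a' \<odot> ?b') \<odot> ((gdelta (inv \<pi>) \<odot> ?b) \<odot> ?y)))"
    using pG by (simp add: mul_assoc)
  also have "(?a' \<odot> ?b') \<odot> ((gdelta (inv \<pi>) \<odot> ?b) \<odot> ?y) = 0"
    using contra by (simp only: t s(2) mul_scale_left mul_scale_right) (simp add: s(1))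
  finally have "gscale (of_nat (card (small.stab (small.row \<mu>))) *
      of_nat (card (small.stab (small.col \<mu>)))) (?y \<odot> ?y) = 0"
    by (simp only: mul_0_right)
  moreover have "card (small.stab f) \<noteq> 0" for f :: "nat \<Rightarrow> nat"
    using small.stab_id[of f] small.finite_stab[of f] card_0_eq by blast
  ultimately have "?y \<odot> ?y = 0" by (simp only: gvs.scale_eq_0_iff) simp
  then show False using young_square_nonzero[OF row_col_tab[OF cnu]] by simp
qed

lemma block_nonzero:
  assumes mu: "\<mu> \<in> Par n" and nu: "\<nu> \<in> Par (n + 1)" and box: "adds_box \<mu> \<nu>"
  shows "block \<mu> \<nu> \<noteq> 0"
proof
  assume zero: "block \<mu> \<nu> = 0"
  obtain x where x: "x \<in> GA" "small.idem \<mu> \<odot> (x \<odot> idem \<nu>) \<noteq> 0"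
    using branching_nonzero[OF assms] by blast
  have f: "small.idem \<mu> \<odot> z_small \<mu> = small.idem \<mu>"
    using z_small_left[OF mu] z_small_commute[OF mu small.primD(1)[OF small_idem_prim[OF mu]]] by simp
  have "small.idem \<mu> \<odot> (x \<odot> idem \<nu>) = small.idem \<mu> \<odot> z_small \<mu> \<odot> ((x \<odot> z_big \<nu>) \<odot> idem \<nu>)"
    using f central_proj_left[OF big_idem_prim[OF nu]] by (simp add: mul_assoc)
  also have "\<dots> = small.idem \<mu> \<odot> (block \<mu> \<nu> \<odot> (x \<odot> idem \<nu>))"
    using z_big_commute[OF x(1)] by (simp add: block_def mul_assoc)
  finally show False using x(2) zero by simp
qed

lemma orthogonal_idempotents_independent:
  assumes "\<And>x. x \<in> S \<Longrightarrow> x \<odot> x = x \<and> x \<noteq> 0" "\<And>x y. x \<in> S \<Longrightarrow> y \<in> S \<Longrightarrow> x \<noteq> y \<Longrightarrow> x \<odot> y = 0"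
  shows "gvs.independent S"
  unfolding gvs.dependent_def
proof (rule notI, elim bexE)
  fix x assume x: "x \<in> S" "x \<in> gvs.span (S - {x})"
  have "gvs.subspace {y. x \<odot> y = 0}" by (rule gvs.subspaceI) (auto simp: mul_add_right)
  moreover have "S - {x} \<subseteq> {y. x \<odot> y = 0}" using assms(2)[OF x(1)] by auto
  ultimately have "x \<odot> x = 0" using gvs.span_minimal x(2) by blast
  then show False using assms(1)[OF x(1)] by simp
qed

definition block_of :: "nat \<times> nat list \<times> nat list \<Rightarrow> galg" where
  "block_of p = block (fst (snd p)) (snd (snd p))"

definition shapes :: "(nat \<times> nat list \<times> nat list) set" where
  "shapes = {p \<in> box_pairs. fst p = n}"

lemma shapesE:
  assumes "p \<in> shapes"
  obtains \<mu> \<nu> where "p = (n, \<mu>, \<nu>)" "\<mu> \<in> Par n" "\<nu> \<in> Par (n + 1)" "adds_box \<mu> \<nu>" "block_of p = block \<mu> \<nu>"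
  using assms by (auto simp: shapes_def box_pairs_def block_of_def)

text \<open>The dimension of the relative center is the number of orbits of \<open>S(n)\<close> acting by conjugation,
  hence at most the number of pairs of shapes; so the independent elements found so far span.\<close>

lemma rel_center_span: "rel_center n = gvs.span (block_of ` shapes)"
proof
  have "block_of ` shapes \<subseteq> rel_center n"
    using block_rel_center by (auto elim!: shapesE)
  then show "gvs.span (block_of ` shapes) \<subseteq> rel_center n"
    by (rule gvs.span_minimal[OF _ subspace_rel_center])
  have idem: "block_of p \<odot> block_of p = block_of p" "block_of p \<noteq> 0" if "p \<in> shapes" for p
    using that block_mul_block block_nonzero by (auto elim!: shapesE)
  have orth: "block_of p \<odot> block_of p' = 0" if "p \<in> shapes" "p' \<in> shapes" "p \<noteq> p'" for p p'
    using that block_mul_block by (auto elim!: shapesE)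
  have inj: "inj_on block_of shapes"
    by (rule inj_onI) (use idem orth in metis)
  show "rel_center n \<subseteq> gvs.span (block_of ` shapes)"
  proof
    fix v assume v: "v \<in> rel_center n"
    show "v \<in> gvs.span (block_of ` shapes)"
    proof (rule ccontr)
      assume nv: "v \<notin> gvs.span (block_of ` shapes)"
      define \<Omega> where "\<Omega> = marked_shape n ` G"
      have sub: "\<Omega> \<subseteq> shapes"
        using marked_shape_box_pair by (auto simp: \<Omega>_def shapes_def marked_shape_def)
      have fin\<Omega>: "finite \<Omega>" by (simp add: \<Omega>_def)
      \<comment> \<open>the class indicators span the relative center, so their number bounds its dimension\<close>
      define ind :: "nat \<times> nat list \<times> nat list \<Rightarrow> galg" where
        "ind \<omega> = (\<lambda>\<sigma>. if \<sigma> \<in> G \<and> marked_shape n \<sigma> = \<omega> then 1 else 0)" for \<omega>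
      have center_span: "\<eta> \<in> gvs.span (ind ` \<Omega>)" if \<eta>: "\<eta> \<in> rel_center n" for \<eta>
      proof -
        have const_on: "\<eta> \<tau> = \<eta> \<sigma>"
          if st: "\<sigma> \<in> G" "\<tau> \<in> G" "marked_shape n \<sigma> = marked_shape n \<tau>" for \<sigma> \<tau>
        proof -
          obtain h where h: "h \<in> small.G" "\<tau> = h \<circ> \<sigma> \<circ> inv h" using marked_shape_conjugate[OF st] .
          have hG: "h \<in> G" by (rule small_G[OF h(1)])
          have "gdelta h \<odot> \<eta> = \<eta> \<odot> gdelta h" using \<eta> h(1) by (simp add: rel_center_iff)
          then have eta: "\<eta> = gdelta (inv h) \<odot> (\<eta> \<odot> gdelta h)" using hG by (metis delta_delta' G_inv G_inv_o(1) mul_one_left)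
          have "\<eta> \<sigma> = (\<eta> \<odot> gdelta h) (h \<circ> \<sigma>)"
            by (subst eta) (use hG in \<open>simp add: delta_mul\<close>)
          also have "\<dots> = (\<eta> \<odot> gdelta h \<odot> gdelta (inv (h \<circ> \<sigma>))) id"
            using hG st(1) by (subst coeff_mul_delta) simp_all
          also have "\<dots> = (\<eta> \<odot> gdelta (inv \<tau>)) id"
            using hG st(1) by (simp add: mul_assoc h(2) G_inv_comp comp_assoc)
          also have "\<dots> = \<eta> \<tau>" using st(2) by (simp add: coeff_mul_delta)
          finally show ?thesis by simp
        qed
        define rep where "rep \<omega> = (SOME \<sigma>. \<sigma> \<in> G \<and> marked_shape n \<sigma> = \<omega>)" for \<omega>
        have rep: "rep \<omega> \<in> G \<and> marked_shape n (rep \<omega>) = \<omega>" if "\<omega> \<in> \<Omega>" for \<omega>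
        proof -
          have "\<exists>\<sigma>. \<sigma> \<in> G \<and> marked_shape n \<sigma> = \<omega>" using that by (auto simp: \<Omega>_def)
          then show ?thesis unfolding rep_def by (rule someI_ex)
        qed
        have "\<eta> = (\<Sum>\<omega>\<in>\<Omega>. gscale (\<eta> (rep \<omega>)) (ind \<omega>))"
        proof
          fix \<sigma>
          show "\<eta> \<sigma> = (\<Sum>\<omega>\<in>\<Omega>. gscale (\<eta> (rep \<omega>)) (ind \<omega>)) \<sigma>"
          proof (cases "\<sigma> \<in> G")
            case True
            then have m: "marked_shape n \<sigma> \<in> \<Omega>" by (simp add: \<Omega>_def)
            have "(\<Sum>\<omega>\<in>\<Omega>. gscale (\<eta> (rep \<omega>)) (ind \<omega>)) \<sigma> =
                (\<Sum>\<omega>\<in>\<Omega>. if \<omega> = marked_shape n \<sigma> then \<eta> (rep \<omega>) else 0)"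
              unfolding sum_apply by (rule sum.cong) (use True in \<open>auto simp: ind_def gscale_def\<close>)
            also have "\<dots> = \<eta> (rep (marked_shape n \<sigma>))" using m fin\<Omega> by simp
            also have "\<dots> = \<eta> \<sigma>" by (rule const_on) (use True rep[OF m] in auto)
            finally show ?thesis by simp
          next
            case False
            then have "\<eta> \<sigma> = 0" using \<eta> GA_zero_outside by (simp add: rel_center_iff)
            moreover have "(\<Sum>\<omega>\<in>\<Omega>. gscale (\<eta> (rep \<omega>)) (ind \<omega>)) \<sigma> = 0"
              unfolding sum_apply by (rule sum.neutral) (use False in \<open>auto simp: ind_def gscale_def\<close>)
            ultimately show ?thesis by simp
          qed
        qed
        moreover have "(\<Sum>\<omega>\<in>\<Omega>. gscale (\<eta> (rep \<omega>)) (ind \<omega>)) \<in> gvs.span (ind ` \<Omega>)"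
          by (intro gvs.span_sum gvs.span_scale gvs.span_base) auto
        ultimately show ?thesis by simp
      qed
      have indep: "gvs.independent (insert v (block_of ` \<Omega>))"
      proof (rule gvs.independent_insertI)
        show "v \<notin> gvs.span (block_of ` \<Omega>)" using nv gvs.span_mono[OF image_mono[OF sub]] by blast
        show "gvs.independent (block_of ` \<Omega>)"
        proof (rule orthogonal_idempotents_independent)
          fix x assume "x \<in> block_of ` \<Omega>"
          then obtain p where p: "p \<in> shapes" "x = block_of p" using sub by blast
          then show "x \<odot> x = x \<and> x \<noteq> 0" using idem by simp
          fix y assume "y \<in> block_of ` \<Omega>" "x \<noteq> y"
          then obtain p' where "p' \<in> shapes" "y = block_of p'" "p \<noteq> p'" using sub p by blast
          then show "x \<odot> y = 0" using p orth by simp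
        qed
      qed
      have "insert v (block_of ` \<Omega>) \<subseteq> gvs.span (ind ` \<Omega>)"
        using center_span v block_rel_center sub by (force elim!: shapesE)
      then have "card (insert v (block_of ` \<Omega>)) \<le> card (ind ` \<Omega>)"
        using gvs.independent_span_bound[OF _ indep] fin\<Omega> by blast
      also have "\<dots> \<le> card \<Omega>" using fin\<Omega> by (rule card_image_le)
      also have "card \<Omega> = card (block_of ` \<Omega>)"
        using card_image[OF inj_on_subset[OF inj sub]] by simp
      finally have "card (insert v (block_of ` \<Omega>)) \<le> card (block_of ` \<Omega>)" .
      moreover have "v \<notin> block_of ` \<Omega>" using nv sub gvs.span_base by blast
      ultimately show False using fin\<Omega> by simp
    qed
  qed
qed

text \<open>The relative center acts on each block by scalars, because its spanning elements do.\<close>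

lemma rel_center_scalar:
  assumes mu: "\<mu> \<in> Par n" and nu: "\<nu> \<in> Par (n + 1)" and y: "y \<in> rel_center n"
  shows "\<exists>t. block \<mu> \<nu> \<odot> y = gscale t (block \<mu> \<nu>)"
proof -
  let ?S = "{y. \<exists>t. block \<mu> \<nu> \<odot> y = gscale t (block \<mu> \<nu>)}"
  have "gvs.subspace ?S"
  proof (rule gvs.subspaceI)
    show "0 \<in> ?S" by (auto intro!: exI[of _ 0])
    show "x + y \<in> ?S" if "x \<in> ?S" "y \<in> ?S" for x y
      using that by (auto simp: mul_add_right gvs.scale_left_distrib[symmetric])
    show "gscale c x \<in> ?S" if "x \<in> ?S" for c x
      using that by auto
  qed
  moreover have "block_of ` shapes \<subseteq> ?S"
  proof
    fix x assume "x \<in> block_of ` shapes"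
    then obtain \<mu>' \<nu>' where "\<mu>' \<in> Par n" "\<nu>' \<in> Par (n + 1)" "x = block \<mu>' \<nu>'"
      by (auto elim!: shapesE)
    then have "block \<mu> \<nu> \<odot> x = gscale (if \<mu> = \<mu>' \<and> \<nu> = \<nu>' then 1 else 0) (block \<mu> \<nu>)"
      using block_mul_block[OF mu nu] by simp
    then show "x \<in> ?S" by blast
  qed
  ultimately show ?thesis using y gvs.span_minimal unfolding rel_center_span by blast
qed

end

section \<open>Relative characters\<close>

context ground
begin

text \<open>On a left ideal \<open>\<complex>[G] e\<close> the trace can be computed on the spanning vectors \<open>g e\<close>, because
  every vector \<open>b\<close> of it is \<open>\<Sum>\<^sub>g b(g) g e\<close>.\<close>

lemma trace_on_left_ideal:
  assumes e: "e \<in> GA" "e \<odot> e = e" and y: "y \<in> GA"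
    and V: "V = {x \<odot> e |x. x \<in> GA}" and T: "\<And>v. v \<in> V \<Longrightarrow> T v = y \<odot> v"
  shows "trace_on V T = (\<Sum>g\<in>G. (y \<odot> (gdelta g \<odot> e)) g)"
proof -
  have sub: "gvs.subspace V"
  proof (rule gvs.subspaceI)
    show "0 \<in> V" unfolding V using mul_0_left[of e] GA_0 by (intro CollectI exI[of _ 0]) simp
    show "u + v \<in> V" if "u \<in> V" "v \<in> V" for u v
    proof -
      from that V obtain x x' where "u = x \<odot> e" "v = x' \<odot> e" "x \<in> GA" "x' \<in> GA" by blast
      then have "u + v = (x + x') \<odot> e" "x + x' \<in> GA" by (simp_all add: mul_add_left)
      then show ?thesis unfolding V by blast
    qed
    show "gscale c u \<in> V" if "u \<in> V" for c u
    proof -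
      from that V obtain x where "u = x \<odot> e" "x \<in> GA" by blast
      then have "gscale c u = gscale c x \<odot> e" "gscale c x \<in> GA" by simp_all
      then show ?thesis unfolding V by blast
    qed
  qed
  have VGA: "v \<in> GA" if "v \<in> V" for v using that e(1) by (auto simp: V)
  have Ve: "v \<odot> e = v" if "v \<in> V" for v using that e(2) by (auto simp: V mul_assoc)
  define B where "B = basis_of V"
  have "\<exists>B. gvs.independent B \<and> gvs.span B = V"
    using gvs.maximal_independent_subset[of V] gvs.span_minimal[OF _ sub] by (metis subset_antisym)
  then have B: "gvs.independent B" "gvs.span B = V"
    unfolding B_def basis_of_def by (metis (mono_tags, lifting) someI_ex)+
  have BV: "b \<in> V" if "b \<in> B" for b using gvs.span_base[OF that] B(2) by simp
  have "finite B"
  proof -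
    have "B \<subseteq> gvs.span (gdelta ` G)"
    proof
      fix b assume "b \<in> B"
      then have "b = (\<Sum>\<sigma>\<in>G. gscale (b \<sigma>) (gdelta \<sigma>))" using expand[OF VGA[OF BV]] by simp
      also have "\<dots> \<in> gvs.span (gdelta ` G)"
        by (intro gvs.span_sum gvs.span_scale gvs.span_base) auto
      finally show "b \<in> gvs.span (gdelta ` G)" .
    qed
    then show ?thesis using gvs.independent_span_bound[OF _ B(1)] by (meson finite_G finite_imageI)
  qed
  define u where "u g = y \<odot> (gdelta g \<odot> e)" for g
  have uV: "u g \<in> gvs.span B" if "g \<in> G" for g
    unfolding B(2) V u_def using y that by (auto intro!: exI[of _ "y \<odot> gdelta g"] simp: mul_assoc)
  let ?R = "gvs.representation B"
  have "trace_on V T = (\<Sum>b\<in>B. \<Sum>g\<in>G. b g * ?R (u g) b)"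
    unfolding trace_on_def B_def[symmetric]
  proof (rule sum.cong[OF refl])
    fix b assume b: "b \<in> B"
    have "b = (\<Sum>g\<in>G. gscale (b g) (gdelta g \<odot> e))"
      using Ve[OF BV[OF b]] mul_expand_left[of b e] by simp
    then have "T b = y \<odot> (\<Sum>g\<in>G. gscale (b g) (gdelta g \<odot> e))" using T[OF BV[OF b]] by simp
    also have "\<dots> = (\<Sum>g\<in>G. gscale (b g) (u g))"
      unfolding mul_sum_right mul_scale_right u_def ..
    finally have "?R (T b) b = (\<Sum>g\<in>G. ?R (gscale (b g) (u g)) b)"
      using gvs.representation_sum[OF B(1), of G "\<lambda>g. gscale (b g) (u g)"] uV gvs.span_scale by simp
    also have "\<dots> = (\<Sum>g\<in>G. b g * ?R (u g) b)"
      by (rule sum.cong) (simp_all add: gvs.representation_scale[OF B(1) uV])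
    finally show "?R (T b) b = (\<Sum>g\<in>G. b g * ?R (u g) b)" .
  qed
  also have "\<dots> = (\<Sum>g\<in>G. \<Sum>b\<in>B. b g * ?R (u g) b)" by (rule sum.swap)
  also have "\<dots> = (\<Sum>g\<in>G. u g g)"
  proof (rule sum.cong[OF refl])
    fix g assume "g \<in> G"
    then have "(\<Sum>b\<in>B. gscale (?R (u g) b) b) = u g"
      by (intro gvs.sum_representation_eq[OF B(1) uV \<open>finite B\<close>]) simp_all
    then have "u g g = (\<Sum>b\<in>B. gscale (?R (u g) b) b) g" by simp
    then show "(\<Sum>b\<in>B. b g * ?R (u g) b) = u g g"
      by (simp add: sum_apply gscale_def mult.commute)
  qed
  finally show ?thesis by (simp add: u_def)
qed

end

context rel_pair
begin

context
  fixes \<mu> \<nu>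
  assumes mu: "\<mu> \<in> Par n" and nu: "\<nu> \<in> Par (n + 1)" and box: "adds_box \<mu> \<nu>"
begin

private abbreviation "f \<equiv> small.idem \<mu>"
private abbreviation "e \<equiv> idem \<nu>"
private abbreviation "V \<equiv> irrep_space {0..n} \<nu>"

lemma f_facts: "small.prim f" "f \<in> small.GA" "f \<in> GA" "f \<odot> f = f" "f \<odot> (f \<odot> x) = f \<odot> x"
  "z_small \<mu> \<odot> f = f"
  using small_idem_prim[OF mu] small.primD(1)[OF small_idem_prim[OF mu]]
    small_primD[OF small_idem_prim[OF mu]] z_small_left[OF mu] by auto

lemma e_facts: "prim e" "e \<in> GA" "e \<odot> e = e" "e id \<noteq> 0"
  using big_idem_prim[OF nu] primD[OF big_idem_prim[OF nu]] by auto

lemma V_eq: "V = {x \<odot> e |x. x \<in> GA}"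
  by (rule irrep_space_eq) (use nu in \<open>simp add: Par_def\<close>)

lemma small_V_eq: "irrep_space {1..n} \<mu> = {x \<odot> f |x. x \<in> small.GA}"
  using small.irrep_space_eq[of \<mu>] mu small_mul by (force simp: Par_def)

lemma V_GA: "v \<in> V \<Longrightarrow> v \<in> GA"
  using e_facts by (auto simp: V_eq)

lemma V_right: "v \<in> V \<Longrightarrow> v \<odot> e = v"
  using e_facts by (auto simp: V_eq mul_assoc)

lemma VI: "v \<in> GA \<Longrightarrow> v \<odot> e = v \<Longrightarrow> v \<in> V"
  unfolding V_eq by force

lemma V_diff: "u \<in> V \<Longrightarrow> v \<in> V \<Longrightarrow> u - v \<in> V"
  by (intro VI GA_diff) (simp_all add: V_GA V_right mul_diff_left)

text \<open>All vectors of \<open>f V\<close> are multiples of one of them, say \<open>w\<close>. A subrepresentation of \<open>V\<close> isomorphic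
  to \<open>\<mu>\<close> is generated by the image of \<open>f\<close>, which lies in \<open>f V\<close>; so it is generated by \<open>w\<close>. The
  module generated by \<open>w\<close> is the image of the central projection of \<open>\<mu>\<close>.\<close>

lemma branch_component_eq: "branch_component n \<mu> \<nu> = {z_small \<mu> \<odot> v |v. v \<in> V}"
proof -
  obtain x where x: "x \<in> GA" "f \<odot> (x \<odot> e) \<noteq> 0"
    using branching_nonzero[OF mu nu box] by blast
  define w where "w = f \<odot> (x \<odot> e)"
  have w: "w \<in> GA" "f \<odot> w = w" "w \<odot> e = w" "w \<noteq> 0"
    using x e_facts f_facts by (simp_all add: w_def mul_assoc)
  have one_dim: "\<exists>t. w' = gscale t w" if "w' \<in> GA" "f \<odot> w' = w'" "w' \<odot> e = w'" for w'
  proof (rule intertwiners_one_dim[OF f_facts(1) e_facts(1) _ w that])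
    fix y assume "y \<in> GA" "\<And>g. g \<in> small.G \<Longrightarrow> gdelta g \<odot> y = y \<odot> gdelta g"
    then have "y \<in> rel_center n" by (simp add: rel_center_iff)
    then show "\<exists>t. z_small \<mu> \<odot> z_big \<nu> \<odot> y = gscale t (z_small \<mu> \<odot> z_big \<nu>)"
      using rel_center_scalar[OF mu nu] by (simp add: block_def)
  qed
  define W where "W = {y \<odot> w |y. y \<in> small.GA}"
  have W_sub: "W \<subseteq> V"
    using w by (auto simp: W_def mul_assoc intro!: VI)
  have inj: "u = 0" if u: "u \<in> small.GA" "u \<odot> f = u" "u \<odot> w = 0" for u
  proof (rule ccontr)
    assume "u \<noteq> 0"
    have "gmul {1..n} u f = u" using small_mul[OF u(1)] u(2) by simp
    from small.prim_left_inverse[OF f_facts(1) u(1) this \<open>u \<noteq> 0\<close>]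
    obtain v where "v \<in> small.GA" "gmul {1..n} v u = f" by blast
    then have "f = v \<odot> u" using small_mul by simp
    then have "f \<odot> w = 0" using u(3) by (simp add: mul_assoc)
    then show False using w by simp
  qed
  let ?P = "\<lambda>W. W \<subseteq> V \<and> (\<exists>\<phi>. Vector_Spaces.linear gscale gscale \<phi> \<and>
          bij_betw \<phi> (irrep_space {1..n} \<mu>) W \<and>
          (\<forall>\<sigma>\<in>Sym {1..n}. \<forall>v\<in>irrep_space {1..n} \<mu>.
             \<phi> (irrep_action {1..n} \<sigma> v) = irrep_action {0..n} \<sigma> (\<phi> v)))"
  have act: "irrep_action {1..n} \<sigma> v = gdelta \<sigma> \<odot> v" if "\<sigma> \<in> small.G" for \<sigma> v
    unfolding irrep_action_def by (rule small_mul) (use that in simp)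
  have "?P W"
  proof (intro conjI W_sub exI[of _ "\<lambda>v. v \<odot> w"] ballI)
    show "Vector_Spaces.linear gscale gscale (\<lambda>v. v \<odot> w)"
      unfolding Vector_Spaces.linear_iff using gvs.vector_space_axioms by (simp add: mul_add_left)
    show "bij_betw (\<lambda>v. v \<odot> w) (irrep_space {1..n} \<mu>) W"
      unfolding bij_betw_def
    proof
      show "inj_on (\<lambda>v. v \<odot> w) (irrep_space {1..n} \<mu>)"
      proof (rule inj_onI)
        fix a b assume ab: "a \<in> irrep_space {1..n} \<mu>" "b \<in> irrep_space {1..n} \<mu>" "a \<odot> w = b \<odot> w"
        then obtain x y where xy: "a = x \<odot> f" "b = y \<odot> f" "x \<in> small.GA" "y \<in> small.GA"
          by (auto simp: small_V_eq)
        have ab_small: "a \<in> small.GA" "b \<in> small.GA"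
          using xy small_mul small.GA_mul[OF f_facts(2)] by metis+
        have "a - b = 0"
        proof (rule inj)
          show "(a - b) \<odot> f = a - b" using xy f_facts(4) by (simp add: mul_diff_left mul_assoc)
          show "(a - b) \<odot> w = 0" using ab(3) by (simp add: mul_diff_left)
        qed (use ab_small in simp)
        then show "a = b" by simp
      qed
      show "(\<lambda>v. v \<odot> w) ` irrep_space {1..n} \<mu> = W"
      proof -
        have "x \<odot> f \<odot> w = x \<odot> w" for x using w(2) by (simp add: mul_assoc)
        then show ?thesis unfolding W_def small_V_eq by (auto simp: image_iff) metis
      qed
    qed
    fix \<sigma> v assume "\<sigma> \<in> small.G" "v \<in> irrep_space {1..n} \<mu>"
    then show "irrep_action {1..n} \<sigma> v \<odot> w = irrep_action {0..n} \<sigma> (v \<odot> w)"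
      by (simp add: act) (simp add: irrep_action_def mul_assoc)
  qed
  moreover have "W' = W" if W': "?P W'" for W'
  proof -
    obtain \<phi> where \<phi>: "Vector_Spaces.linear gscale gscale \<phi>"
        "bij_betw \<phi> (irrep_space {1..n} \<mu>) W'"
        "\<And>\<sigma> v. \<sigma> \<in> small.G \<Longrightarrow> v \<in> irrep_space {1..n} \<mu> \<Longrightarrow> \<phi> (gdelta \<sigma> \<odot> v) = gdelta \<sigma> \<odot> \<phi> v"
      using W' act unfolding irrep_action_def[of "{0..n}"] by auto
    have fV: "f \<in> irrep_space {1..n} \<mu>"
      unfolding small_V_eq using f_facts(2,4) by (metis (mono_tags, lifting) mem_Collect_eq)
    have lin: "\<phi> (\<Sum>i\<in>I. gscale (c i) (v i)) = (\<Sum>i\<in>I. gscale (c i) (\<phi> (v i)))" for I c and v :: "perm_fun \<Rightarrow> galg"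
      using \<phi>(1) by (simp add: linear_iff_module_hom module_hom.sum module_hom.scale)
    have \<phi>_mul: "\<phi> (y \<odot> f) = y \<odot> \<phi> f" if "y \<in> small.GA" for y
      by (subst (1 2) small_expand_left[OF that]) (simp add: lin \<phi>(3)[OF _ fV])
    have \<phi>V: "\<phi> f \<in> V" using W' \<phi>(2) fV by (auto simp: bij_betw_def)
    have "f \<odot> \<phi> f = \<phi> f" using \<phi>_mul[OF f_facts(2)] f_facts(4) by simp
    then obtain t where t: "\<phi> f = gscale t w"
      using one_dim V_GA[OF \<phi>V] V_right[OF \<phi>V] by blast
    have "\<phi> 0 = 0" using lin[of "\<lambda>_. 0" "\<lambda>_. 0" "{}"] by (simp only: sum.empty)
    moreover have "f \<noteq> 0" using small.primD(4)[OF f_facts(1)] .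
    moreover have "0 \<in> irrep_space {1..n} \<mu>"
      unfolding small_V_eq using small.GA_0 mul_0_left[of f] by (metis (mono_tags, lifting) mem_Collect_eq)
    ultimately have "\<phi> f \<noteq> 0"
      using \<phi>(2) fV unfolding bij_betw_def inj_on_def by metis
    then have t0: "t \<noteq> 0" using t by auto
    have "W' = {\<phi> (y \<odot> f) |y. y \<in> small.GA}"
      using \<phi>(2) by (auto simp: bij_betw_def small_V_eq)
    also have "\<dots> = {gscale t y \<odot> w |y. y \<in> small.GA}"
    proof -
      have "\<phi> (y \<odot> f) = gscale t y \<odot> w" if "y \<in> small.GA" for y using \<phi>_mul[OF that] t by simp
      then show ?thesis by (metis (no_types, lifting))
    qed
    also have "\<dots> = W"
    proof (intro set_eqI iffI)
      fix v assume "v \<in> W"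
      then obtain y where y: "y \<in> small.GA" "v = y \<odot> w" by (auto simp: W_def)
      then have "v = gscale t (gscale (1 / t) y) \<odot> w" "gscale (1 / t) y \<in> small.GA" using t0 by simp_all
      then show "v \<in> {gscale t y \<odot> w |y. y \<in> small.GA}" by blast
    qed (use small.GA_scale in \<open>auto simp: W_def simp del: mul_scale_left\<close>)
    finally show ?thesis .
  qed
  ultimately have "branch_component n \<mu> \<nu> = W"
    unfolding branch_component_def by (rule the_equality)
  also have "W = {z_small \<mu> \<odot> v |v. v \<in> V}"
  proof (intro set_eqI iffI)
    fix u assume "u \<in> W"
    then obtain y where y: "y \<in> small.GA" "u = y \<odot> w" by (auto simp: W_def)
    have "z_small \<mu> \<odot> w = w" using w(2) f_facts(6) by (metis mul_assoc)
    then have "u = z_small \<mu> \<odot> (y \<odot> w)"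
      using y z_small_commute[OF mu y(1)] by (metis mul_assoc)
    moreover have "y \<odot> w \<in> V" using y(2) \<open>u \<in> W\<close> W_sub by blast
    ultimately show "u \<in> {z_small \<mu> \<odot> v |v. v \<in> V}" by blast
  next
    fix u assume "u \<in> {z_small \<mu> \<odot> v |v. v \<in> V}"
    then obtain v where v: "v \<in> V" "u = z_small \<mu> \<odot> v" by blast
    have "\<exists>t. f \<odot> (gdelta (inv g) \<odot> v) = gscale t w" for g
      by (rule one_dim) (use V_GA[OF v(1)] V_right[OF v(1)] f_facts in \<open>simp_all add: mul_assoc\<close>)
    then obtain t where t: "\<And>g. f \<odot> (gdelta (inv g) \<odot> v) = gscale (t g) w" by metis
    have "z_small \<mu> = gscale (f id) (\<Sum>g\<in>small.G. gdelta g \<odot> f \<odot> gdelta (inv g))"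
    proof -
      have "gmul {1..n} (gmul {1..n} (gdelta g) f) (gdelta (inv g)) = gdelta g \<odot> f \<odot> gdelta (inv g)"
        if "g \<in> small.G" for g
        using small_mul[OF small.GA_delta[OF that]] small_mul[OF small.GA_mul[OF f_facts(2)], of "gdelta g"]
        by simp
      then show ?thesis unfolding small.central_proj_def by (simp cong: sum.cong)
    qed
    then have "u = gscale (f id) (\<Sum>g\<in>small.G. gdelta g \<odot> (f \<odot> (gdelta (inv g) \<odot> v)))"
      by (simp add: v(2) mul_sum_left mul_assoc)
    also have "\<dots> = gscale (f id) (\<Sum>g\<in>small.G. gscale (t g) (gdelta g)) \<odot> w"
      by (simp add: t mul_sum_left)
    finally show "u \<in> W"
      unfolding W_def using small.GA_scale small.GA_sum small.GA_delta
      by (metis (mono_tags, lifting) mem_Collect_eq)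
  qed
  finally show ?thesis .
qed

lemma orth_proj_eq:
  assumes v: "v \<in> V"
  shows "orth_proj {0..n} (branch_component n \<mu> \<nu>) v = z_small \<mu> \<odot> v"
  unfolding orth_proj_def
proof (rule the_equality)
  let ?W = "branch_component n \<mu> \<nu>"
  have perp: "ginner {0..n} (v - z_small \<mu> \<odot> v) u = 0" if u: "u \<in> ?W" for u
  proof -
    obtain u' where u': "u' \<in> V" "u = z_small \<mu> \<odot> u'" using u branch_component_eq by blast
    have "ginner {0..n} (v - z_small \<mu> \<odot> v) u =
        (((v - z_small \<mu> \<odot> v) \<odot> adj u') \<odot> z_small \<mu>) id"
      using mu by (simp add: ginner_eq u'(2) adj_mul z_small_adj mul_assoc)
    also have "\<dots> = (z_small \<mu> \<odot> ((v - z_small \<mu> \<odot> v) \<odot> adj u')) id" by (rule trace_commute)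
    also have "z_small \<mu> \<odot> ((v - z_small \<mu> \<odot> v) \<odot> adj u') =
        (z_small \<mu> \<odot> v - (z_small \<mu> \<odot> z_small \<mu>) \<odot> v) \<odot> adj u'"
      by (simp add: mul_diff_left mul_diff_right mul_assoc)
    also have "\<dots> = 0" by (simp only: z_small_idem[OF mu] diff_self mul_0_left)
    finally show ?thesis by (simp only: zero_fun_apply)
  qed
  show "z_small \<mu> \<odot> v \<in> ?W \<and> (\<forall>u\<in>?W. ginner {0..n} (v - z_small \<mu> \<odot> v) u = 0)"
    using v perp by (auto simp: branch_component_eq)
  fix w assume w: "w \<in> ?W \<and> (\<forall>u\<in>?W. ginner {0..n} (v - w) u = 0)"
  define d where "d = z_small \<mu> \<odot> v - w"
  obtain w' where w': "w' \<in> V" "w = z_small \<mu> \<odot> w'" using w branch_component_eq by blast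
  have d: "d = z_small \<mu> \<odot> (v - w')" by (simp add: d_def w'(2) mul_diff_right)
  then have dW: "d \<in> ?W" using V_diff[OF v w'(1)] branch_component_eq by blast
  have "ginner {0..n} d d = ginner {0..n} (v - w) d - ginner {0..n} (v - z_small \<mu> \<odot> v) d"
    unfolding ginner_def sum_subtractf[symmetric]
    by (rule sum.cong) (simp_all add: d_def algebra_simps)
  then have "ginner {0..n} d d = 0" using w perp dW by simp
  moreover have "d \<in> GA" unfolding d by (intro GA_mul V_GA V_diff v w'(1))
  ultimately have "d = 0" by (rule ginner_self_eq_0[rotated])
  then show "w = z_small \<mu> \<odot> v" by (simp add: d_def)
qed

text \<open>The trace formula and the centrality of the block projection turn the relative character into
  the coefficient function of the product of the two central projections.\<close>

lemma rel_char_eq: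
  assumes \<sigma>: "\<sigma> \<in> G"
  shows "rel_char n \<mu> \<nu> \<sigma> = block \<mu> \<nu> \<sigma> / e id"
proof -
  let ?z = "z_small \<mu>"
  define y where "y = ?z \<odot> (gdelta \<sigma> \<odot> ?z)"
  define p where "p = orth_proj {0..n} (branch_component n \<mu> \<nu>)"
  have yGA: "y \<in> GA" using mu by (simp add: y_def)
  have T: "(p \<circ> irrep_action {0..n} \<sigma> \<circ> p) v = y \<odot> v" if v: "v \<in> V" for v
  proof -
    have "gdelta \<sigma> \<odot> (?z \<odot> v) \<in> V"
      by (rule VI) (simp_all add: V_GA[OF v] V_right[OF v] mul_assoc)
    then show ?thesis
      by (simp add: p_def irrep_action_def orth_proj_eq[OF v] orth_proj_eq y_def mul_assoc)
  qed
  have "rel_char n \<mu> \<nu> \<sigma> = trace_on V (p \<circ> irrep_action {0..n} \<sigma> \<circ> p)"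
    by (simp add: rel_char_def p_def Let_def)
  also have "\<dots> = (\<Sum>g\<in>G. (y \<odot> (gdelta g \<odot> e)) g)"
    by (rule trace_on_left_ideal[OF e_facts(2,3) yGA V_eq T])
  also have "\<dots> = (\<Sum>g\<in>G. (y \<odot> (gdelta g \<odot> e \<odot> gdelta (inv g))) id)"
  proof (rule sum.cong[OF refl])
    fix g assume g: "g \<in> G"
    show "(y \<odot> (gdelta g \<odot> e)) g = (y \<odot> (gdelta g \<odot> e \<odot> gdelta (inv g))) id"
      using coeff_mul_delta[OF G_inv[OF g], of "y \<odot> (gdelta g \<odot> e)"] g by (simp add: mul_assoc)
  qed
  also have "\<dots> = (y \<odot> (\<Sum>g\<in>G. gdelta g \<odot> e \<odot> gdelta (inv g))) id"
    by (simp add: mul_sum_right sum_apply)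
  also have "(\<Sum>g\<in>G. gdelta g \<odot> e \<odot> gdelta (inv g)) = gscale (1 / e id) (z_big \<nu>)"
    unfolding central_proj_def gvs.scale_scale using e_facts(4) by simp
  also have "(y \<odot> gscale (1 / e id) (z_big \<nu>)) id = (y \<odot> z_big \<nu>) id / e id"
    unfolding mul_scale_right by (simp add: gscale_def)
  also have "(y \<odot> z_big \<nu>) id = block \<mu> \<nu> \<sigma>"
  proof -
    have "(y \<odot> z_big \<nu>) id = (?z \<odot> (gdelta \<sigma> \<odot> (?z \<odot> z_big \<nu>))) id"
      by (simp add: y_def mul_assoc)
    also have "\<dots> = (gdelta \<sigma> \<odot> (?z \<odot> z_big \<nu>) \<odot> ?z) id" by (rule trace_commute)
    also have "gdelta \<sigma> \<odot> (?z \<odot> z_big \<nu>) \<odot> ?z = gdelta \<sigma> \<odot> ((?z \<odot> ?z) \<odot> z_big \<nu>)"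
    proof -
      have "(?z \<odot> z_big \<nu>) \<odot> ?z = (?z \<odot> ?z) \<odot> z_big \<nu>"
        unfolding mul_assoc by (simp only: z_big_commute[OF z_small_GA'[OF mu]])
      then show ?thesis by (simp only: mul_assoc)
    qed
    also have "\<dots> = gdelta \<sigma> \<odot> block \<mu> \<nu>" by (simp add: z_small_idem[OF mu] block_def)
    also have "(gdelta \<sigma> \<odot> block \<mu> \<nu>) id = block \<mu> \<nu> (inv \<sigma>)" using \<sigma> by (simp add: delta_mul)
    also have "\<dots> = block \<mu> \<nu> \<sigma>"
      by (rule real_selfadj_inv[OF real_elt_block[OF mu nu] block_adj[OF mu nu] \<sigma>])
    finally show ?thesis .
  qed
  finally show ?thesis .
qed

lemma rel_char_elt_eq: "\<exists>c. c \<noteq> 0 \<and> rel_char_elt n \<mu> \<nu> = gscale c (block \<mu> \<nu>)"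
proof (intro exI conjI)
  show "1 / e id \<noteq> 0" using e_facts(4) by simp
  have "rel_char_elt n \<mu> \<nu> = (\<Sum>\<sigma>\<in>G. gscale (1 / e id) (gscale (block \<mu> \<nu> \<sigma>) (gdelta \<sigma>)))"
    unfolding rel_char_elt_def by (rule sum.cong) (simp_all add: rel_char_eq)
  also have "\<dots> = gscale (1 / e id) (block \<mu> \<nu>)"
    using expand[OF block_GA[OF nu, of \<mu>]] by (simp only: gvs.scale_sum_right[symmetric])
  finally show "rel_char_elt n \<mu> \<nu> = gscale (1 / e id) (block \<mu> \<nu>)" .
qed

end

end

section \<open>The functional \<open>\<chi>\<^sub>q\<close> for \<open>q = 1/N\<close>\<close>

context rel_pair
begin

definition words :: "nat \<Rightarrow> (nat \<Rightarrow> nat) set" where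
  "words N = {0..n} \<rightarrow>\<^sub>E {..<N}"

lemma finite_words [simp]: "finite (words N)"
  by (simp add: words_def finite_PiE)

lemma words_comp:
  assumes "w \<in> words N" "\<sigma> \<in> G" shows "w \<circ> \<sigma> \<in> words N"
  unfolding words_def
proof (rule PiE_I)
  fix x assume "x \<in> {0..n}"
  then have "\<sigma> x \<in> {0..n}" using assms(2) by (simp only: G_in_A)
  then show "(w \<circ> \<sigma>) x \<in> {..<N}" using assms(1) by (auto simp: words_def)
next
  fix x assume x: "x \<notin> {0..n}"
  then have "\<sigma> x = x" using assms(2) by (simp add: Sym_def permutes_def)
  then show "(w \<circ> \<sigma>) x = undefined" using x assms(1) by (auto simp: words_def PiE_def extensional_def)
qed

lemma word_stab: "w \<in> words N \<Longrightarrow> h \<in> G \<Longrightarrow> w \<circ> h = w \<longleftrightarrow> h \<in> stab w"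
proof -
  assume w: "w \<in> words N" "h \<in> G"
  have "w (h x) = w x" if "x \<notin> {0..n}" for x
    using w(2) that by (simp add: Sym_def permutes_def)
  then show ?thesis using w(2) by (auto simp: stab_def fun_eq_iff)
qed

text \<open>A word is fixed by a permutation if and only if it is constant on the cycles.\<close>

lemma card_fixed_words:
  assumes \<alpha>: "\<alpha> \<in> G"
  shows "card {w \<in> words N. w \<circ> \<alpha> = w} = N ^ card (orbit \<alpha> ` {0..n})"
proof -
  have p: "\<alpha> permutes {0..n}" using \<alpha> by (simp add: Sym_def)
  note o = orbit_facts[OF p finite_atLeastAtMost]
  let ?R = "orbit \<alpha> ` {0..n}"
  let ?\<Phi> = "\<lambda>v. restrict (\<lambda>x. v (orbit \<alpha> x)) {0..n}"
  have const: "w y = w x" if "w \<circ> \<alpha> = w" "y \<in> orbit \<alpha> x" for w :: "nat \<Rightarrow> nat" and x y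
  proof -
    have "w ((\<alpha> ^^ k) x) = w x" for k
      by (induction k) (use fun_cong[OF that(1)] in simp_all)
    then show ?thesis using o(3)[OF that(2)] by auto
  qed
  have "bij_betw ?\<Phi> (?R \<rightarrow>\<^sub>E {..<N}) {w \<in> words N. w \<circ> \<alpha> = w}"
    unfolding bij_betw_def
  proof
    show "inj_on ?\<Phi> (?R \<rightarrow>\<^sub>E {..<N})"
    proof (rule inj_onI)
      fix u v assume uv: "u \<in> ?R \<rightarrow>\<^sub>E {..<N}" "v \<in> ?R \<rightarrow>\<^sub>E {..<N}" "?\<Phi> u = ?\<Phi> v"
      show "u = v"
      proof (rule PiE_ext[OF uv(1,2)])
        fix Z assume "Z \<in> ?R"
        then obtain x where "x \<in> {0..n}" "Z = orbit \<alpha> x" by blast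
        then show "u Z = v Z" using fun_cong[OF uv(3), of x] by simp
      qed
    qed
    show "?\<Phi> ` (?R \<rightarrow>\<^sub>E {..<N}) = {w \<in> words N. w \<circ> \<alpha> = w}"
    proof (intro set_eqI iffI)
      fix w assume "w \<in> ?\<Phi> ` (?R \<rightarrow>\<^sub>E {..<N})"
      then obtain v where v: "v \<in> ?R \<rightarrow>\<^sub>E {..<N}" "w = ?\<Phi> v" by blast
      have "w \<in> words N" using v by (auto simp: words_def)
      moreover have "(w \<circ> \<alpha>) x = w x" for x
      proof (cases "x \<in> {0..n}")
        case True
        have "\<alpha> x \<in> orbit \<alpha> x" using o(4)[of "Suc 0" x] by simp
        then have "orbit \<alpha> (\<alpha> x) = orbit \<alpha> x" by (rule o(2))
        moreover have "\<alpha> x \<in> {0..n}" using True \<alpha> by (simp only: G_in_A)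
        ultimately show ?thesis using True by (simp add: v(2))
      next
        case False
        then show ?thesis using p by (simp add: permutes_def)
      qed
      ultimately show "w \<in> {w \<in> words N. w \<circ> \<alpha> = w}" by auto
    next
      fix w assume w: "w \<in> {w \<in> words N. w \<circ> \<alpha> = w}"
      define v where "v = restrict (\<lambda>Z. w (SOME x. x \<in> Z)) ?R"
      have some: "w (SOME y. y \<in> orbit \<alpha> x) = w x" for x
        using const[of w] w someI[of "\<lambda>y. y \<in> orbit \<alpha> x", OF o(1)] by blast
      have "v \<in> ?R \<rightarrow>\<^sub>E {..<N}" using w by (auto simp: v_def some words_def)
      moreover have "?\<Phi> v = w"
        using w by (auto simp: v_def some fun_eq_iff words_def PiE_def extensional_def)
      ultimately show "w \<in> ?\<Phi> ` (?R \<rightarrow>\<^sub>E {..<N})" by (metis (no_types, lifting) imageI)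
    qed
  qed
  from bij_betw_same_card[OF this] show ?thesis by (simp add: card_PiE)
qed

text \<open>For \<open>q = 1/N\<close> the functional is the normalized trace of the representation on the \<open>n + 1\<close>-fold
  tensor power of \<open>\<complex>\<^sup>N\<close>, whose standard basis is indexed by words. Accordingly \<open>amp w w' x\<close> is the matrix
  entry of \<open>x\<close> at \<open>(w, w')\<close>, and \<open>\<chi>\<^sub>q(x y\<^sup>*)\<close> is a Hilbert-Schmidt inner product.\<close>

definition amp :: "(nat \<Rightarrow> nat) \<Rightarrow> (nat \<Rightarrow> nat) \<Rightarrow> galg \<Rightarrow> complex" where
  "amp w w' x = (\<Sum>\<tau>\<in>G. if w \<circ> \<tau> = w' then x \<tau> else 0)"

lemma chi_q_words:
  assumes N: "N \<ge> 1"
  shows "chi_q (1 / real N) n x = (\<Sum>w\<in>words N. amp w w x) / of_nat N ^ (n + 1)"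
proof -
  have len: "complex_of_real ((1 / real N) ^ perm_length n \<alpha>) =
      (\<Sum>w\<in>words N. if w \<circ> \<alpha> = w then 1 else 0) / of_nat N ^ (n + 1)" if "\<alpha> \<in> G" for \<alpha>
  proof -
    let ?k = "card (orbit \<alpha> ` {0..n})"
    have k: "?k \<le> n + 1" using card_image_le[of "{0..n}" "orbit \<alpha>"] by simp
    have "(\<Sum>w\<in>words N. if w \<circ> \<alpha> = w then 1 else 0 :: complex) = of_nat (N ^ ?k)"
      by (simp add: sum.If_cases card_fixed_words[OF that, symmetric] Int_def)
    moreover have "(1 / complex_of_nat N) ^ (n + 1 - ?k) = of_nat N ^ ?k / of_nat N ^ (n + 1)"
      using N k by (simp add: power_diff field_simps)
    ultimately show ?thesis by (simp add: perm_length_def)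
  qed
  have "chi_q (1 / real N) n x =
      (\<Sum>\<alpha>\<in>G. \<Sum>w\<in>words N. (if w \<circ> \<alpha> = w then x \<alpha> else 0) / of_nat N ^ (n + 1))"
    unfolding chi_q_def
  proof (rule sum.cong[OF refl])
    fix \<alpha> assume a: "\<alpha> \<in> G"
    show "x \<alpha> * complex_of_real ((1 / real N) ^ perm_length n \<alpha>) =
        (\<Sum>w\<in>words N. (if w \<circ> \<alpha> = w then x \<alpha> else 0) / of_nat N ^ (n + 1))"
      unfolding len[OF a] sum_divide_distrib sum_distrib_left by (rule sum.cong) auto
  qed
  also have "\<dots> = (\<Sum>w\<in>words N. \<Sum>\<alpha>\<in>G. (if w \<circ> \<alpha> = w then x \<alpha> else 0) / of_nat N ^ (n + 1))"
    by (rule sum.swap)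
  finally show ?thesis by (simp add: amp_def sum_divide_distrib)
qed

lemma chi_q_gram:
  assumes N: "N \<ge> 1"
  shows "chi_q (1 / real N) n (x \<odot> adj y) =
    (\<Sum>w\<in>words N. \<Sum>w'\<in>words N. amp w w' x * cnj (amp w w' y)) / of_nat N ^ (n + 1)"
proof -
  have "amp w w (x \<odot> adj y) = (\<Sum>w'\<in>words N. amp w w' x * cnj (amp w w' y))"
    if w: "w \<in> words N" for w
  proof -
    let ?x = "\<lambda>\<tau> w'. if w \<circ> \<tau> = w' then x \<tau> else 0"
    let ?y = "\<lambda>\<pi> w'. if w \<circ> \<pi> = w' then cnj (y \<pi>) else 0"
    let ?F = "\<lambda>\<tau> \<alpha>. if w \<circ> \<alpha> = w then x \<tau> * adj y (inv \<tau> \<circ> \<alpha>) else 0"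
    let ?G = "\<lambda>\<tau> \<pi>. if w \<circ> \<tau> = w \<circ> \<pi> then x \<tau> * cnj (y \<pi>) else 0"
    have "amp w w (x \<odot> adj y) =
        (\<Sum>\<alpha>\<in>G. \<Sum>\<tau>\<in>G. ?F \<tau> \<alpha>)"
      unfolding amp_def gmul_def by (rule sum.cong) auto
    also have "\<dots> = (\<Sum>\<tau>\<in>G. \<Sum>\<alpha>\<in>G. ?F \<tau> \<alpha>)"
      by (rule sum.swap)
    also have "\<dots> = (\<Sum>\<tau>\<in>G. \<Sum>\<pi>\<in>G. ?G \<tau> \<pi>)"
    proof (rule sum.cong[OF refl])
      fix \<tau> assume t: "\<tau> \<in> G"
      have "(\<Sum>\<alpha>\<in>G. ?F \<tau> \<alpha>) =
          (\<Sum>\<rho>\<in>G. ?F \<tau> (\<tau> \<circ> \<rho>))"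
        by (rule sum_translate[OF t, symmetric])
      also have "\<dots> = (\<Sum>\<pi>\<in>G. ?F \<tau> (\<tau> \<circ> inv \<pi>))"
        by (rule sum_inv[symmetric])
      also have "\<dots> = (\<Sum>\<pi>\<in>G. ?G \<tau> \<pi>)"
      proof (rule sum.cong[OF refl])
        fix \<pi> assume p: "\<pi> \<in> G"
        have "w \<circ> (\<tau> \<circ> inv \<pi>) = w \<longleftrightarrow> w \<circ> \<tau> = w \<circ> \<pi>"
          using p by (metis G_cancel(3,4) comp_assoc)
        then show "?F \<tau> (\<tau> \<circ> inv \<pi>) =
            ?G \<tau> \<pi>"
          using t p by (simp add: adj_apply)
      qed
      finally show "(\<Sum>\<alpha>\<in>G. ?F \<tau> \<alpha>) =
          (\<Sum>\<pi>\<in>G. ?G \<tau> \<pi>)" .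
    qed
    also have "\<dots> = (\<Sum>\<tau>\<in>G. \<Sum>\<pi>\<in>G. \<Sum>w'\<in>words N.
        ?x \<tau> w' * ?y \<pi> w')"
    proof (intro sum.cong refl)
      fix \<tau> \<pi> assume g: "\<tau> \<in> G" "\<pi> \<in> G"
      have "(\<Sum>w'\<in>words N. ?x \<tau> w' * ?y \<pi> w') =
          (\<Sum>w'\<in>words N. if w' = w \<circ> \<tau> then ?G \<tau> \<pi> else 0)"
        by (rule sum.cong) auto
      then show "?G \<tau> \<pi> = (\<Sum>w'\<in>words N.
          ?x \<tau> w' * ?y \<pi> w')"
        using words_comp[OF w g(1)] by simp
    qed
    also have "\<dots> = (\<Sum>\<tau>\<in>G. \<Sum>w'\<in>words N. \<Sum>\<pi>\<in>G.
        ?x \<tau> w' * ?y \<pi> w')"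
      by (rule sum.cong[OF refl], rule sum.swap)
    also have "\<dots> = (\<Sum>w'\<in>words N. \<Sum>\<tau>\<in>G. \<Sum>\<pi>\<in>G.
        ?x \<tau> w' * ?y \<pi> w')"
      by (rule sum.swap)
    also have "\<dots> = (\<Sum>w'\<in>words N. amp w w' x * cnj (amp w w' y))"
    proof (rule sum.cong[OF refl])
      fix w'
      have c: "cnj (amp w w' y) = (\<Sum>\<pi>\<in>G. if w \<circ> \<pi> = w' then cnj (y \<pi>) else 0)"
        unfolding amp_def cnj_sum by (rule sum.cong) auto
      show "(\<Sum>\<tau>\<in>G. \<Sum>\<pi>\<in>G. ?x \<tau> w' * ?y \<pi> w') =
          amp w w' x * cnj (amp w w' y)"
        unfolding c unfolding amp_def sum_product ..
    qed
    finally show ?thesis .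
  qed
  then show ?thesis by (simp add: chi_q_words[OF N])
qed

lemma chi_q_norm:
  assumes N: "N \<ge> 1"
  shows "chi_q (1 / real N) n (x \<odot> adj x) =
    of_real ((\<Sum>w\<in>words N. \<Sum>w'\<in>words N. (cmod (amp w w' x))\<^sup>2) / real N ^ (n + 1))"
  unfolding chi_q_gram[OF N] of_real_divide of_real_sum complex_norm_square by simp

lemma chi_q_norm_eq_0:
  assumes N: "N \<ge> 1"
  shows "chi_q (1 / real N) n (x \<odot> adj x) = 0 \<longleftrightarrow> (\<forall>w\<in>words N. \<forall>w'\<in>words N. amp w w' x = 0)"
  using N by (simp only: chi_q_norm[OF N] of_real_eq_0_iff)
     (simp add: sum_nonneg_eq_0_iff sum_nonneg)

lemma amp_scale: "amp w w' (gscale c x) = c * amp w w' x"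
  unfolding amp_def sum_distrib_left by (rule sum.cong) (auto simp: gscale_def)

lemma amp_delta:
  assumes s: "\<sigma> \<in> G"
  shows "amp w w' (gdelta \<sigma> \<odot> x) = amp (w \<circ> \<sigma>) w' x"
proof -
  have "amp w w' (gdelta \<sigma> \<odot> x) = (\<Sum>\<tau>\<in>G. if w \<circ> (\<sigma> \<circ> \<tau>) = w' then (gdelta \<sigma> \<odot> x) (\<sigma> \<circ> \<tau>) else 0)"
    unfolding amp_def by (rule sum_translate[OF s, symmetric])
  then show ?thesis unfolding amp_def using s by (simp add: delta_mul comp_assoc cong: if_cong)
qed

lemma amp_stab:
  assumes w: "w \<in> words N" and t: "\<tau>\<^sub>0 \<in> G"
  shows "amp w (w \<circ> \<tau>\<^sub>0) x = (sym_sum w \<odot> x) \<tau>\<^sub>0"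
proof -
  have "amp w (w \<circ> \<tau>\<^sub>0) x = (\<Sum>\<tau> | \<tau> \<in> G \<and> w \<circ> \<tau> = w \<circ> \<tau>\<^sub>0. x \<tau>)"
    unfolding amp_def by (simp add: sum.inter_filter)
  also have "\<dots> = (\<Sum>h\<in>stab w. x (h \<circ> \<tau>\<^sub>0))"
  proof (rule sum.reindex_bij_witness[where i="\<lambda>h. h \<circ> \<tau>\<^sub>0" and j="\<lambda>\<tau>. \<tau> \<circ> inv \<tau>\<^sub>0"])
    fix \<tau> assume "\<tau> \<in> {\<tau> \<in> G. w \<circ> \<tau> = w \<circ> \<tau>\<^sub>0}"
    then have "w \<circ> (\<tau> \<circ> inv \<tau>\<^sub>0) = w" "\<tau> \<in> G" using t by (auto simp: comp_assoc[symmetric])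
    then show "\<tau> \<circ> inv \<tau>\<^sub>0 \<in> stab w" using word_stab[OF w] t by simp
  next
    fix h assume "h \<in> stab w"
    then have "w \<circ> h = w" "h \<in> G" using word_stab[OF w] stab_G by blast+
    then show "h \<circ> \<tau>\<^sub>0 \<in> {\<tau> \<in> G. w \<circ> \<tau> = w \<circ> \<tau>\<^sub>0}" using t by (simp add: comp_assoc[symmetric])
  qed (use t in auto)
  also have "\<dots> = (\<Sum>h\<in>stab w. x (inv h \<circ> \<tau>\<^sub>0))" by (rule sum_stab_inv[symmetric])
  also have "\<dots> = (sym_sum w \<odot> x) \<tau>\<^sub>0"
    unfolding sym_sum_def mul_sum_left sum_apply
    by (rule sum.cong) (simp_all add: delta_mul stab_G)
  finally show ?thesis .
qed

lemma amp_eq_0_iff: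
  assumes "x \<in> GA"
  shows "(\<forall>w\<in>words N. \<forall>w'\<in>words N. amp w w' x = 0) \<longleftrightarrow> (\<forall>w\<in>words N. sym_sum w \<odot> x = 0)"
proof
  assume L: "\<forall>w\<in>words N. \<forall>w'\<in>words N. amp w w' x = 0"
  show "\<forall>w\<in>words N. sym_sum w \<odot> x = 0"
  proof (intro ballI ext)
    fix w \<tau> assume w: "w \<in> words N"
    show "(sym_sum w \<odot> x) \<tau> = 0 \<tau>"
    proof (cases "\<tau> \<in> G")
      case True
      then show ?thesis using L w words_comp[OF w True] amp_stab[OF w True, of x] by simp
    next
      case False
      then show ?thesis using GA_zero_outside[OF GA_mul[OF assms]] by simp
    qed
  qed
next
  assume R: "\<forall>w\<in>words N. sym_sum w \<odot> x = 0"
  show "\<forall>w\<in>words N. \<forall>w'\<in>words N. amp w w' x = 0"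
  proof (intro ballI)
    fix w w' assume w: "w \<in> words N"
    show "amp w w' x = 0"
    proof (cases "\<exists>\<tau>\<^sub>0\<in>G. w \<circ> \<tau>\<^sub>0 = w'")
      case True
      then obtain \<tau>\<^sub>0 where "\<tau>\<^sub>0 \<in> G" "w' = w \<circ> \<tau>\<^sub>0" by blast
      then show ?thesis using amp_stab[OF w, of \<tau>\<^sub>0 x] bspec[OF R w] by (simp only: zero_fun_apply)
    next
      case False
      then show ?thesis unfolding amp_def by (intro sum.neutral) auto
    qed
  qed
qed

text \<open>A word in \<open>N\<close> letters repeats a letter on the first column of \<open>\<nu>\<close> if this column is longer than
  \<open>N\<close>, so its symmetrizer annihilates the column antisymmetrizer. If \<open>\<nu>\<close> has at most \<open>N\<close> rows, the row
  number is itself such a word, and its stabilizer is the row group.\<close>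

lemma null_iff:
  assumes mu: "\<mu> \<in> Par n" and nu: "\<nu> \<in> Par (n + 1)" and box: "adds_box \<mu> \<nu>"
  shows "(\<forall>w\<in>words N. \<forall>w'\<in>words N. amp w w' (block \<mu> \<nu>) = 0) \<longleftrightarrow> N < length \<nu>"
proof
  have cnu: "sum_list \<nu> = card {0..n}" using nu by (simp add: Par_def)
  have e: "\<exists>s. idem \<nu> = gscale s (sym_sum (row \<nu>) \<odot> alt_sum (col \<nu>))"
    unfolding idem_def young_idem_def by blast
  have first_col: "(i, 0) \<in> diagram \<nu>" if "i < length \<nu>" for i
  proof -
    have "\<nu> ! i \<noteq> 0" using nth_mem[OF that] nu by (metis (mono_tags, lifting) Par_def mem_Collect_eq)
    then show ?thesis using that by (simp add: diagram_def)
  qed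
  { assume L: "\<forall>w\<in>words N. \<forall>w'\<in>words N. amp w w' (block \<mu> \<nu>) = 0"
    show "N < length \<nu>"
    proof (rule ccontr)
      assume "\<not> N < length \<nu>"
      define w where "w = restrict (row \<nu>) {0..n}"
      have "row \<nu> x < N" if "x \<in> {0..n}" for x
        using tableau_row_col(2)[OF cnu that] \<open>\<not> N < length \<nu>\<close> by (auto simp: diagram_def)
      then have w: "w \<in> words N" by (auto simp: w_def words_def)
      have "stab w = stab (row \<nu>)" unfolding stab_def w_def
        by (intro Collect_cong conj_cong ball_cong refl) (simp_all del: atLeastAtMost_iff)
      then have sw: "sym_sum w = sym_sum (row \<nu>)" by (simp only: sym_sum_def)
      \<comment> \<open>a translate of an element acting as zero acts as zero, which gives the factor \<open>\<sigma>\<close>\<close>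
      have row_kill: "sym_sum (row \<nu>) \<odot> (gdelta \<sigma> \<odot> block \<mu> \<nu>) = 0" if s: "\<sigma> \<in> G" for \<sigma>
      proof -
        have "\<forall>w\<in>words N. \<forall>w'\<in>words N. amp w w' (gdelta \<sigma> \<odot> block \<mu> \<nu>) = 0"
          using L words_comp[OF _ s] by (simp add: amp_delta[OF s])
        then show ?thesis
          unfolding sw[symmetric] using w amp_eq_0_iff[of "gdelta \<sigma> \<odot> block \<mu> \<nu>" N] nu by simp
      qed
      have ann: "block \<mu> \<nu> \<odot> (gdelta g \<odot> sym_sum (row \<nu>)) = 0" if "g \<in> G" for g
      proof -
        have "adj (sym_sum (row \<nu>) \<odot> (gdelta (inv g) \<odot> block \<mu> \<nu>)) =
            block \<mu> \<nu> \<odot> (gdelta g \<odot> sym_sum (row \<nu>))"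
          using that mu nu by (simp add: adj_mul adj_delta block_adj mul_assoc)
        then show ?thesis by (simp only: row_kill[OF G_inv[OF that]] adj_0)
      qed
      obtain s where s: "idem \<nu> = gscale s (sym_sum (row \<nu>) \<odot> alt_sum (col \<nu>))" using e by blast
      have conj_kill: "block \<mu> \<nu> \<odot> (gdelta g \<odot> idem \<nu> \<odot> gdelta (inv g)) = 0" if "g \<in> G" for g
      proof -
        have "block \<mu> \<nu> \<odot> (gdelta g \<odot> idem \<nu> \<odot> gdelta (inv g)) =
            gscale s (block \<mu> \<nu> \<odot> (gdelta g \<odot> sym_sum (row \<nu>)) \<odot> (alt_sum (col \<nu>) \<odot> gdelta (inv g)))"
          by (simp add: s mul_assoc)
        then show ?thesis by (simp only: ann[OF that] mul_0_left gvs.scale_zero_right)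
      qed
      have "(\<Sum>g\<in>G. block \<mu> \<nu> \<odot> (gdelta g \<odot> idem \<nu> \<odot> gdelta (inv g))) = 0"
        by (intro sum.neutral ballI conj_kill)
      then have "block \<mu> \<nu> \<odot> z_big \<nu> = 0"
        unfolding central_proj_def mul_scale_right mul_sum_right by (simp only: gvs.scale_zero_right)
      moreover have "block \<mu> \<nu> \<odot> z_big \<nu> = block \<mu> \<nu>"
        using central_proj_idem[OF big_idem_prim[OF nu]] by (simp add: block_def mul_assoc)
      ultimately show False using block_nonzero[OF mu nu box] by simp
    qed }
  { assume len: "N < length \<nu>"
    have "sym_sum w \<odot> block \<mu> \<nu> = 0" if w: "w \<in> words N" for w
    proof -
      have kill: "sym_sum w \<odot> (gdelta h \<odot> alt_sum (col \<nu>)) = 0" if h: "h \<in> G" for h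
      proof -
        define pt where "pt i = tableau {0..n} \<nu> (i, 0)" for i
        have pt: "pt i \<in> {0..n}" "row \<nu> (pt i) = i" "col \<nu> (pt i) = 0" if "i < length \<nu>" for i
          using row_col_tableau[OF cnu first_col[OF that]] by (simp_all add: pt_def)
        have "w (h (pt i)) \<in> {..<N}" if "i < length \<nu>" for i
        proof -
          have "h (pt i) \<in> {0..n}" using pt(1)[OF that] h by (simp only: G_in_A)
          then show ?thesis using w by (auto simp: words_def)
        qed
        then have "card ((\<lambda>i. w (h (pt i))) ` {..<length \<nu>}) \<le> card {..<N}"
          by (intro card_mono) auto
        then have "\<not> inj_on (\<lambda>i. w (h (pt i))) {..<length \<nu>}"
          using len by (intro pigeonhole) simp
        then obtain i j where ij: "i < length \<nu>" "j < length \<nu>" "i \<noteq> j" "w (h (pt i)) = w (h (pt j))"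
          by (auto simp: inj_on_def)
        show ?thesis
          by (rule sym_alt_eq_0[OF h pt(1)[OF ij(1)] pt(1)[OF ij(2)] _ ij(4)])
             (use pt(2,3)[OF ij(1)] pt(2,3)[OF ij(2)] ij(3) in auto)
      qed
      have kill': "sym_sum w \<odot> (y \<odot> alt_sum (col \<nu>)) = 0" if "y \<in> GA" for y
      proof -
        have "sym_sum w \<odot> (y \<odot> alt_sum (col \<nu>)) =
            (\<Sum>h\<in>G. gscale (y h) (sym_sum w \<odot> (gdelta h \<odot> alt_sum (col \<nu>))))"
          unfolding mul_expand_left[of y] mul_sum_right mul_scale_right ..
        also have "\<dots> = 0"
          by (intro sum.neutral ballI) (simp only: kill gvs.scale_zero_right)
        finally show ?thesis .
      qed
      obtain s where s: "idem \<nu> = gscale s (sym_sum (row \<nu>) \<odot> alt_sum (col \<nu>))" using e by blast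
      have conj_kill: "sym_sum w \<odot> (gdelta g \<odot> idem \<nu> \<odot> gdelta (inv g)) = 0" if "g \<in> G" for g
      proof -
        have "sym_sum w \<odot> (gdelta g \<odot> idem \<nu> \<odot> gdelta (inv g)) =
            gscale s (sym_sum w \<odot> ((gdelta g \<odot> sym_sum (row \<nu>)) \<odot> alt_sum (col \<nu>)) \<odot> gdelta (inv g))"
          by (simp add: s mul_assoc)
        then show ?thesis by (simp only: kill'[OF GA_mul[OF sym_sum_GA]] mul_0_left gvs.scale_zero_right)
      qed
      have "(\<Sum>g\<in>G. sym_sum w \<odot> (gdelta g \<odot> idem \<nu> \<odot> gdelta (inv g))) = 0"
        by (intro sum.neutral ballI conj_kill)
      then have "sym_sum w \<odot> z_big \<nu> = 0"
        unfolding central_proj_def mul_scale_right mul_sum_right by (simp only: gvs.scale_zero_right)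
      moreover have "block \<mu> \<nu> = z_big \<nu> \<odot> z_small \<mu>"
        using z_big_commute[OF z_small_GA'[OF mu]] by (simp add: block_def)
      ultimately show ?thesis by (metis mul_0_left mul_assoc)
    qed
    then show "\<forall>w\<in>words N. \<forall>w'\<in>words N. amp w w' (block \<mu> \<nu>) = 0"
      using amp_eq_0_iff[OF block_GA[OF nu]] by blast }
qed

lemma rel_char_elt_norm:
  assumes "\<mu> \<in> Par n" "\<nu> \<in> Par (n + 1)" "adds_box \<mu> \<nu>" "N \<ge> 1"
  shows "chi_q (1 / real N) n (rel_char_elt n \<mu> \<nu> \<odot> adj (rel_char_elt n \<mu> \<nu>)) = 0 \<longleftrightarrow> N < length \<nu>"
proof -
  obtain c where "c \<noteq> 0" "rel_char_elt n \<mu> \<nu> = gscale c (block \<mu> \<nu>)"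
    using rel_char_elt_eq[OF assms(1-3)] by blast
  then show ?thesis
    unfolding chi_q_norm_eq_0[OF assms(4)] using null_iff[OF assms(1-3), of N]
    by (simp add: amp_scale)
qed

end

section \<open>Completion of a semi-inner product space\<close>

locale semi_inner = vector_space s for s :: "complex \<Rightarrow> 'v \<Rightarrow> 'v::ab_group_add" +
  fixes V :: "'v set" and ip :: "'v \<Rightarrow> 'v \<Rightarrow> complex"
  assumes sub: "subspace V"
    and add_left: "x \<in> V \<Longrightarrow> y \<in> V \<Longrightarrow> z \<in> V \<Longrightarrow> ip (x + y) z = ip x z + ip y z"
    and scale_left: "x \<in> V \<Longrightarrow> z \<in> V \<Longrightarrow> ip (s c x) z = c * ip x z"
    and herm: "x \<in> V \<Longrightarrow> y \<in> V \<Longrightarrow> ip y x = cnj (ip x y)"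
    and pos: "x \<in> V \<Longrightarrow> 0 \<le> Re (ip x x)"
begin

abbreviation nm :: "'v \<Rightarrow> real" where "nm \<equiv> semi_norm ip"

lemma V_0 [simp]: "0 \<in> V" using sub by (rule subspace_0)
lemma V_add [simp]: "x \<in> V \<Longrightarrow> y \<in> V \<Longrightarrow> x + y \<in> V" using sub by (rule subspace_add)
lemma V_diff [simp]: "x \<in> V \<Longrightarrow> y \<in> V \<Longrightarrow> x - y \<in> V" using sub by (rule subspace_diff)
lemma V_scale [simp]: "x \<in> V \<Longrightarrow> s c x \<in> V" using sub by (rule subspace_scale)

lemma V_minus [simp]: "x \<in> V \<Longrightarrow> - x \<in> V" using sub by (rule subspace_neg)

lemma ip_add_right: "x \<in> V \<Longrightarrow> y \<in> V \<Longrightarrow> z \<in> V \<Longrightarrow> ip z (x + y) = ip z x + ip z y"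
  using herm[of "x + y" z] herm[of x z] herm[of y z] by (simp add: add_left)

lemma ip_scale_right: "x \<in> V \<Longrightarrow> z \<in> V \<Longrightarrow> ip z (s c x) = cnj c * ip z x"
  using herm[of "s c x" z] herm[of x z] by (simp add: scale_left)

lemma ip_diff_left: "x \<in> V \<Longrightarrow> y \<in> V \<Longrightarrow> z \<in> V \<Longrightarrow> ip (x - y) z = ip x z - ip y z"
  using add_left[of "x - y" y z] by simp

lemma ip_diff_right: "x \<in> V \<Longrightarrow> y \<in> V \<Longrightarrow> z \<in> V \<Longrightarrow> ip z (x - y) = ip z x - ip z y"
  using ip_add_right[of "x - y" y z] by simp

lemma ip_self: "x \<in> V \<Longrightarrow> ip x x = of_real ((nm x)\<^sup>2)"
  using herm[of x x] pos[of x] by (auto simp: semi_norm_def complex_eq_iff)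

lemma Re_ip_self: "x \<in> V \<Longrightarrow> Re (ip x x) = (nm x)\<^sup>2"
  by (simp only: ip_self Re_complex_of_real)

lemma nm_nonneg: "x \<in> V \<Longrightarrow> 0 \<le> nm x"
  using pos by (simp add: semi_norm_def)

lemma nm_scale: "x \<in> V \<Longrightarrow> nm (s c x) = cmod c * nm x"
proof -
  assume x: "x \<in> V"
  have "ip (s c x) (s c x) = of_real ((cmod c)\<^sup>2 * (nm x)\<^sup>2)"
    using x complex_norm_square[of c] by (simp add: scale_left ip_scale_right ip_self[OF x])
  then have "Re (ip (s c x) (s c x)) = (cmod c * nm x)\<^sup>2"
    by (simp only: Re_complex_of_real power_mult_distrib)
  then show ?thesis using nm_nonneg[OF x] unfolding semi_norm_def[of ip "s c x"] by simp
qed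

lemma nm_0 [simp]: "nm 0 = 0"
  using nm_scale[of 0 0] by simp

lemma nm_minus: "x \<in> V \<Longrightarrow> nm (- x) = nm x"
  using nm_scale[of x "- 1"] by simp

lemma nm_diff_commute: "x \<in> V \<Longrightarrow> y \<in> V \<Longrightarrow> nm (x - y) = nm (y - x)"
  using nm_minus[of "x - y"] by simp

text \<open>The form may be degenerate, so the case of a null vector \<open>y\<close> needs a separate choice of the
  parameter \<open>r\<close>, large enough to make the quadratic expression negative.\<close>

lemma cauchy_schwarz:
  assumes x: "x \<in> V" and y: "y \<in> V" shows "cmod (ip x y) \<le> nm x * nm y"
proof -
  let ?c = "ip x y"
  have *: "0 \<le> (nm x)\<^sup>2 - 2 * r * (cmod ?c)\<^sup>2 + r\<^sup>2 * (cmod ?c)\<^sup>2 * (nm y)\<^sup>2" for r :: real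
  proof -
    let ?t = "of_real r * ?c"
    have "ip (x - s ?t y) (x - s ?t y) =
        ip x x - cnj ?t * ?c - ?t * cnj ?c + ?t * cnj ?t * ip y y"
      using x y herm[OF x y]
      by (simp add: ip_diff_left ip_diff_right scale_left ip_scale_right algebra_simps)
    also have "\<dots> = of_real ((nm x)\<^sup>2) - 2 * of_real r * (?c * cnj ?c) +
        (of_real r)\<^sup>2 * (?c * cnj ?c) * of_real ((nm y)\<^sup>2)"
      by (simp add: ip_self[OF x] ip_self[OF y] power2_eq_square algebra_simps)
    also have "\<dots> = of_real ((nm x)\<^sup>2 - 2 * r * (cmod ?c)\<^sup>2 + r\<^sup>2 * (cmod ?c)\<^sup>2 * (nm y)\<^sup>2)"
      by (simp add: complex_norm_square[symmetric] del: of_real_power) simp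
    finally show ?thesis using pos[of "x - s ?t y"] x y by simp
  qed
  have "(cmod ?c)\<^sup>2 \<le> (nm x * nm y)\<^sup>2"
  proof (cases "nm y = 0")
    case True
    have "cmod ?c = 0"
    proof (rule ccontr)
      assume "cmod ?c \<noteq> 0"
      then show False
        using *[of "((nm x)\<^sup>2 + 1) / (2 * (cmod ?c)\<^sup>2)"] True by (simp add: field_simps)
    qed
    then show ?thesis by simp
  next
    case False
    then have "0 \<le> (nm x)\<^sup>2 - (cmod ?c)\<^sup>2 / (nm y)\<^sup>2"
      using *[of "1 / (nm y)\<^sup>2"] by (simp add: power2_eq_square field_simps)
    then show ?thesis using False by (simp add: field_simps power_mult_distrib)
  qed
  then show ?thesis by (rule power2_le_imp_le) (simp add: nm_nonneg x y)
qed

lemma nm_triangle: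
  assumes "x \<in> V" "y \<in> V" shows "nm (x + y) \<le> nm x + nm y"
proof (rule power2_le_imp_le)
  have "ip (x + y) (x + y) = ip x x + ip y y + (ip x y + cnj (ip x y))"
    using assms herm[of x y] by (simp add: add_left ip_add_right)
  from arg_cong[OF this, of Re]
  have "(nm (x + y))\<^sup>2 = (nm x)\<^sup>2 + (nm y)\<^sup>2 + 2 * Re (ip x y)"
    using assms by (simp add: Re_ip_self)
  also have "Re (ip x y) \<le> nm x * nm y"
    using cauchy_schwarz[OF assms] complex_Re_le_cmod order_trans by blast
  finally show "(nm (x + y))\<^sup>2 \<le> (nm x + nm y)\<^sup>2" by (simp add: power2_sum)
qed (use assms nm_nonneg in simp)

lemma nm_triangle_diff: "x \<in> V \<Longrightarrow> y \<in> V \<Longrightarrow> z \<in> V \<Longrightarrow> nm (x - z) \<le> nm (x - y) + nm (y - z)"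
  using nm_triangle[of "x - y" "y - z"] by simp

lemma nm_diff_abs: "x \<in> V \<Longrightarrow> y \<in> V \<Longrightarrow> \<bar>nm x - nm y\<bar> \<le> nm (x - y)"
  using nm_triangle[of "x - y" y] nm_triangle[of "y - x" x] nm_diff_commute[of x y] by simp

abbreviation C where "C \<equiv> cauchy_seqs V ip"
abbreviation R where "R \<equiv> cauchy_rel V ip"
abbreviation cls where "cls X \<equiv> R `` {X}"
abbreviation H where "H \<equiv> completion s V ip"
abbreviation emb where "emb \<equiv> completion_embed V ip"

lemma C_V: "X \<in> C \<Longrightarrow> X k \<in> V" by (auto simp: cauchy_seqs_def)

lemma C_cauchy: "X \<in> C \<Longrightarrow> \<epsilon> > 0 \<Longrightarrow> \<exists>M. \<forall>m\<ge>M. \<forall>k\<ge>M. nm (X m - X k) < \<epsilon>"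
  by (simp add: cauchy_seqs_def)

lemma C_const: "x \<in> V \<Longrightarrow> (\<lambda>k. x) \<in> C" by (auto simp: cauchy_seqs_def)

lemma C_add:
  assumes X: "X \<in> C" and Y: "Y \<in> C" shows "(\<lambda>k. X k + Y k) \<in> C"
  unfolding cauchy_seqs_def
proof (intro CollectI conjI allI impI)
  show "range (\<lambda>k. X k + Y k) \<subseteq> V" using C_V[OF X] C_V[OF Y] by auto
  fix \<epsilon> :: real assume "\<epsilon> > 0"
  then have e: "\<epsilon> / 2 > 0" by simp
  obtain M1 where M1: "\<forall>m\<ge>M1. \<forall>k\<ge>M1. nm (X m - X k) < \<epsilon> / 2"
    using C_cauchy[OF X e] by (rule exE)
  obtain M2 where M2: "\<forall>m\<ge>M2. \<forall>k\<ge>M2. nm (Y m - Y k) < \<epsilon> / 2"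
    using C_cauchy[OF Y e] by (rule exE)
  have "nm (X m + Y m - (X k + Y k)) < \<epsilon>" if "m \<ge> max M1 M2" "k \<ge> max M1 M2" for m k
  proof -
    have "nm (X m + Y m - (X k + Y k)) = nm ((X m - X k) + (Y m - Y k))" by (simp add: algebra_simps)
    also have "\<dots> \<le> nm (X m - X k) + nm (Y m - Y k)"
      by (rule nm_triangle) (simp_all add: C_V[OF X] C_V[OF Y])
    also have "\<dots> < \<epsilon>" using M1[rule_format, of m k] M2[rule_format, of m k] that by simp
    finally show ?thesis .
  qed
  then show "\<exists>M. \<forall>m\<ge>M. \<forall>k\<ge>M. nm (X m + Y m - (X k + Y k)) < \<epsilon>" by blast
qed

lemma C_scale:
  assumes X: "X \<in> C" shows "(\<lambda>k. s c (X k)) \<in> C"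
  unfolding cauchy_seqs_def
proof (intro CollectI conjI allI impI)
  show "range (\<lambda>k. s c (X k)) \<subseteq> V" using C_V[OF X] by auto
  fix \<epsilon> :: real assume "\<epsilon> > 0"
  then have "\<epsilon> / (cmod c + 1) > 0" by (simp add: add_nonneg_pos)
  from C_cauchy[OF X this]
  obtain M where M: "\<forall>m\<ge>M. \<forall>k\<ge>M. nm (X m - X k) < \<epsilon> / (cmod c + 1)" by (rule exE)
  have "nm (s c (X m) - s c (X k)) < \<epsilon>" if "m \<ge> M" "k \<ge> M" for m k
  proof -
    have "nm (s c (X m) - s c (X k)) = cmod c * nm (X m - X k)"
      using nm_scale[of "X m - X k" c] C_V[OF X] by (simp add: scale_right_diff_distrib)
    also have "\<dots> \<le> (cmod c + 1) * nm (X m - X k)"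
      using C_V[OF X] by (simp add: mult_right_mono nm_nonneg)
    also have "\<dots> < \<epsilon>" using M[rule_format, OF that] norm_ge_zero[of c] by (simp add: field_simps add_nonneg_pos)
    finally show ?thesis .
  qed
  then show "\<exists>M. \<forall>m\<ge>M. \<forall>k\<ge>M. nm (s c (X m) - s c (X k)) < \<epsilon>" by blast
qed

lemma R_iff: "(X, Y) \<in> R \<longleftrightarrow> X \<in> C \<and> Y \<in> C \<and> (\<lambda>k. nm (X k - Y k)) \<longlonglongrightarrow> 0"
  by (simp add: cauchy_rel_def)

lemma tendsto_0_le:
  fixes f g :: "nat \<Rightarrow> real"
  assumes "g \<longlonglongrightarrow> 0" "\<And>k. 0 \<le> f k" "\<And>k. f k \<le> g k" shows "f \<longlonglongrightarrow> 0"
  by (rule tendsto_sandwich[OF _ _ tendsto_const assms(1)]) (use assms in auto)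

lemma equiv_R: "equiv C R"
proof (rule equivI)
  show "R \<subseteq> C \<times> C" by (auto simp: R_iff)
  show "refl_on C R" by (auto simp: refl_on_def R_iff)
  show "sym R"
  proof (rule symI)
    fix X Y assume XY: "(X, Y) \<in> R"
    then have "nm (Y k - X k) = nm (X k - Y k)" for k
      using C_V nm_diff_commute by (simp add: R_iff)
    then show "(Y, X) \<in> R" using XY by (simp add: R_iff)
  qed
  show "trans R"
  proof (rule transI)
    fix X Y Z assume XY: "(X, Y) \<in> R" and YZ: "(Y, Z) \<in> R"
    have "(\<lambda>k. nm (X k - Y k) + nm (Y k - Z k)) \<longlonglongrightarrow> 0"
      using tendsto_add[of "\<lambda>k. nm (X k - Y k)" 0 sequentially "\<lambda>k. nm (Y k - Z k)" 0] XY YZ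
      by (simp add: R_iff)
    then have "(\<lambda>k. nm (X k - Z k)) \<longlonglongrightarrow> 0"
      by (rule tendsto_0_le) (use XY YZ in \<open>auto simp: R_iff C_V intro!: nm_nonneg nm_triangle_diff\<close>)
    then show "(X, Z) \<in> R" using XY YZ by (simp add: R_iff)
  qed
qed

lemma R_add:
  assumes XX: "(X, X') \<in> R" and YY: "(Y, Y') \<in> R"
  shows "(\<lambda>k. X k + Y k, \<lambda>k. X' k + Y' k) \<in> R"
proof -
  have c: "X \<in> C" "X' \<in> C" "Y \<in> C" "Y' \<in> C" using XX YY by (auto simp: R_iff)
  have "(\<lambda>k. nm (X k - X' k) + nm (Y k - Y' k)) \<longlonglongrightarrow> 0"
    using tendsto_add[of "\<lambda>k. nm (X k - X' k)" 0 sequentially "\<lambda>k. nm (Y k - Y' k)" 0] XX YY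
    by (simp add: R_iff)
  then have "(\<lambda>k. nm (X k + Y k - (X' k + Y' k))) \<longlonglongrightarrow> 0"
  proof (rule tendsto_0_le)
    fix k
    show "0 \<le> nm (X k + Y k - (X' k + Y' k))" using c by (intro nm_nonneg) (simp add: C_V)
    have "nm (X k + Y k - (X' k + Y' k)) = nm ((X k - X' k) + (Y k - Y' k))" by (simp add: algebra_simps)
    also have "\<dots> \<le> nm (X k - X' k) + nm (Y k - Y' k)" using c by (intro nm_triangle) (simp_all add: C_V)
    finally show "nm (X k + Y k - (X' k + Y' k)) \<le> nm (X k - X' k) + nm (Y k - Y' k)" .
  qed
  then show ?thesis using c by (simp add: R_iff C_add)
qed

lemma R_scale:
  assumes XX: "(X, X') \<in> R" shows "(\<lambda>k. s c (X k), \<lambda>k. s c (X' k)) \<in> R"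
proof -
  have cs: "X \<in> C" "X' \<in> C" using XX by (auto simp: R_iff)
  have "nm (s c (X k) - s c (X' k)) = cmod c * nm (X k - X' k)" for k
    using nm_scale[of "X k - X' k" c] cs by (simp add: C_V scale_right_diff_distrib)
  moreover have "(\<lambda>k. cmod c * nm (X k - X' k)) \<longlonglongrightarrow> 0"
    using tendsto_mult_right_zero[of "\<lambda>k. nm (X k - X' k)"] XX by (simp add: R_iff)
  ultimately show ?thesis using cs by (simp add: R_iff C_scale)
qed

lemma cls_self: "X \<in> C \<Longrightarrow> X \<in> cls X"
  using equiv_class_self[OF equiv_R] .

lemma emb_eq: "emb x = cls (\<lambda>k. x)"
  by (simp add: completion_embed_def)

text \<open>Sums and multiples in the completion are formed over all representatives; compatibility of the
  operations with the relation reduces this to one choice of representatives.\<close>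

lemma R_image_eq:
  assumes "Z \<in> S" "\<And>Y. Y \<in> S \<Longrightarrow> (Y, Z) \<in> R" shows "R `` S = cls Z"
proof
  have "cls Y = cls Z" if "Y \<in> S" for Y by (rule equiv_class_eq[OF equiv_R assms(2)[OF that]])
  then show "R `` S \<subseteq> cls Z" by blast
  show "cls Z \<subseteq> R `` S" using assms(1) by blast
qed

lemma hadd_cls:
  assumes "X \<in> C" "Y \<in> C" shows "hadd H (cls X) (cls Y) = cls (\<lambda>k. X k + Y k)"
proof -
  have "R `` {\<lambda>k. X' k + Y' k |X' Y'. X' \<in> cls X \<and> Y' \<in> cls Y} = cls (\<lambda>k. X k + Y k)"
  proof (rule R_image_eq)
    show "(\<lambda>k. X k + Y k) \<in> {\<lambda>k. X' k + Y' k |X' Y'. X' \<in> cls X \<and> Y' \<in> cls Y}"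
      using cls_self[OF assms(1)] cls_self[OF assms(2)] by blast
    fix Z assume "Z \<in> {\<lambda>k. X' k + Y' k |X' Y'. X' \<in> cls X \<and> Y' \<in> cls Y}"
    then obtain X' Y' where "Z = (\<lambda>k. X' k + Y' k)" "(X', X) \<in> R" "(Y', Y) \<in> R"
      using equiv_R unfolding equiv_def sym_def by blast
    then show "(Z, \<lambda>k. X k + Y k) \<in> R" using R_add by blast
  qed
  then show ?thesis by (simp add: completion_def)
qed

lemma hscale_cls:
  assumes "X \<in> C" shows "hscale H c (cls X) = cls (\<lambda>k. s c (X k))"
proof -
  have "R `` {\<lambda>k. s c (X' k) |X'. X' \<in> cls X} = cls (\<lambda>k. s c (X k))"
  proof (rule R_image_eq)
    show "(\<lambda>k. s c (X k)) \<in> {\<lambda>k. s c (X' k) |X'. X' \<in> cls X}"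
      using cls_self[OF assms] by blast
    fix Z assume "Z \<in> {\<lambda>k. s c (X' k) |X'. X' \<in> cls X}"
    then obtain X' where "Z = (\<lambda>k. s c (X' k))" "(X', X) \<in> R"
      using equiv_R unfolding equiv_def sym_def by blast
    then show "(Z, \<lambda>k. s c (X k)) \<in> R" using R_scale by blast
  qed
  then show ?thesis by (simp add: completion_def)
qed

lemma nm_convergent:
  assumes X: "X \<in> C" shows "convergent (\<lambda>k. nm (X k))"
proof -
  have "Cauchy (\<lambda>k. nm (X k))"
  proof (rule metric_CauchyI)
    fix \<epsilon> :: real assume "\<epsilon> > 0"
    from C_cauchy[OF X this]
    obtain M where M: "\<forall>m\<ge>M. \<forall>k\<ge>M. nm (X m - X k) < \<epsilon>" by (rule exE)
    have "dist (nm (X m)) (nm (X k)) < \<epsilon>" if "m \<ge> M" "k \<ge> M" for m k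
      using nm_diff_abs[OF C_V[OF X] C_V[OF X], of m k] M[rule_format, OF that] by (simp add: dist_real_def)
    then show "\<exists>M. \<forall>m\<ge>M. \<forall>k\<ge>M. dist (nm (X m)) (nm (X k)) < \<epsilon>" by blast
  qed
  then show ?thesis by (simp add: Cauchy_convergent_iff)
qed

text \<open>Uses that the norms along a Cauchy sequence converge and are therefore bounded.\<close>

lemma ip_limit_respects:
  assumes XX: "(X, X') \<in> R" and YY: "(Y, Y') \<in> R" and l: "(\<lambda>k. ip (X k) (Y k)) \<longlonglongrightarrow> z"
  shows "(\<lambda>k. ip (X' k) (Y' k)) \<longlonglongrightarrow> z"
proof -
  have c: "X \<in> C" "X' \<in> C" "Y \<in> C" "Y' \<in> C" using XX YY by (auto simp: R_iff)
  obtain a where a: "(\<lambda>k. nm (X' k)) \<longlonglongrightarrow> a" using nm_convergent[OF c(2)] by (auto simp: convergent_def)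
  obtain b where b: "(\<lambda>k. nm (Y k)) \<longlonglongrightarrow> b" using nm_convergent[OF c(3)] by (auto simp: convergent_def)
  have X0: "(\<lambda>k. nm (X k - X' k)) \<longlonglongrightarrow> 0" and Y0: "(\<lambda>k. nm (Y k - Y' k)) \<longlonglongrightarrow> 0"
    using XX YY by (auto simp: R_iff)
  have g: "(\<lambda>k. nm (X k - X' k) * nm (Y k) + nm (X' k) * nm (Y k - Y' k)) \<longlonglongrightarrow> 0"
    using tendsto_add[OF tendsto_mult[OF X0 b] tendsto_mult[OF a Y0]] by simp
  have "(\<lambda>k. cmod (ip (X k) (Y k) - ip (X' k) (Y' k))) \<longlonglongrightarrow> 0"
  proof (rule tendsto_0_le[OF g])
    fix k
    have "ip (X k) (Y k) - ip (X' k) (Y' k) = ip (X k - X' k) (Y k) + ip (X' k) (Y k - Y' k)"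
      using c by (simp add: C_V ip_diff_left ip_diff_right)
    also have "cmod \<dots> \<le> cmod (ip (X k - X' k) (Y k)) + cmod (ip (X' k) (Y k - Y' k))"
      by (rule norm_triangle_ineq)
    also have "\<dots> \<le> nm (X k - X' k) * nm (Y k) + nm (X' k) * nm (Y k - Y' k)"
      using c by (intro add_mono cauchy_schwarz) (simp_all add: C_V)
    finally show "cmod (ip (X k) (Y k) - ip (X' k) (Y' k)) \<le>
        nm (X k - X' k) * nm (Y k) + nm (X' k) * nm (Y k - Y' k)" .
  qed simp
  then have "(\<lambda>k. ip (X k) (Y k) - ip (X' k) (Y' k)) \<longlonglongrightarrow> 0" by (rule tendsto_norm_zero_cancel)
  from tendsto_diff[OF l this] show ?thesis by simp
qed

lemma hinner_cls:
  assumes "X \<in> C" "Y \<in> C" "(\<lambda>k. ip (X k) (Y k)) \<longlonglongrightarrow> z"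
  shows "hinner H (cls X) (cls Y) = z"
proof -
  have "(THE z. \<forall>X'\<in>cls X. \<forall>Y'\<in>cls Y. (\<lambda>k. ip (X' k) (Y' k)) \<longlonglongrightarrow> z) = z"
  proof (rule the_equality)
    show "\<forall>X'\<in>cls X. \<forall>Y'\<in>cls Y. (\<lambda>k. ip (X' k) (Y' k)) \<longlonglongrightarrow> z"
      using ip_limit_respects[OF _ _ assms(3)] by blast
    fix z' assume "\<forall>X'\<in>cls X. \<forall>Y'\<in>cls Y. (\<lambda>k. ip (X' k) (Y' k)) \<longlonglongrightarrow> z'"
    then have "(\<lambda>k. ip (X k) (Y k)) \<longlonglongrightarrow> z'" using cls_self assms(1,2) by blast
    then show "z' = z" using assms(3) LIMSEQ_unique by blast
  qed
  then show ?thesis by (simp add: completion_def)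
qed

lemma hinner_emb: "x \<in> V \<Longrightarrow> y \<in> V \<Longrightarrow> hinner H (emb x) (emb y) = ip x y"
  unfolding emb_eq by (rule hinner_cls) (simp_all add: C_const)

lemma emb_span:
  assumes "b ` I \<subseteq> V" "y \<in> span (b ` I)"
  shows "y \<in> V \<and> emb y \<in> hspan H ((\<lambda>i. emb (b i)) ` I)"
  using assms(2)
proof (induction rule: span_induct_alt)
  case base
  have "hzero H = emb 0" by (simp add: completion_def)
  then show ?case using hspan.zero[of H] by simp
next
  case (step c x y)
  have x: "x \<in> V" using step(1) assms(1) by blast
  have "hadd H (hscale H c (emb x)) (emb y) \<in> hspan H ((\<lambda>i. emb (b i)) ` I)"
    using step by (intro hspan.step) auto
  moreover have "hadd H (hscale H c (emb x)) (emb y) = emb (s c x + y)"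
    using x step by (simp add: emb_eq hscale_cls hadd_cls C_const)
  ultimately show ?case using x step by simp
qed

text \<open>Distances are only needed to vectors of the uncompleted space, where a constant sequence
  represents the second argument.\<close>

lemma hdist_emb:
  assumes X: "X \<in> C" and y: "y \<in> V" and lim: "(\<lambda>k. nm (X k - y)) \<longlonglongrightarrow> L"
  shows "hdist H (cls X) (emb y) = L"
proof -
  let ?Z = "\<lambda>k. X k + s (- 1) y"
  have Z: "?Z \<in> C" by (rule C_add[OF X C_const]) (simp add: y)
  have z: "hadd H (cls X) (hscale H (- 1) (emb y)) = cls ?Z"
    unfolding emb_eq hscale_cls[OF C_const[OF y]]
    by (rule hadd_cls[OF X C_const]) (simp add: y)
  have "?Z k = X k - y" for k by simp
  moreover have "ip (X k - y) (X k - y) = of_real ((nm (X k - y))\<^sup>2)" for k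
    by (rule ip_self) (simp add: C_V[OF X] y)
  moreover have "(\<lambda>k. of_real ((nm (X k - y))\<^sup>2)) \<longlonglongrightarrow> complex_of_real (L\<^sup>2)"
    using lim by (intro tendsto_of_real tendsto_power)
  ultimately have "(\<lambda>k. ip (?Z k) (?Z k)) \<longlonglongrightarrow> complex_of_real (L\<^sup>2)" by simp
  then have "hinner H (cls ?Z) (cls ?Z) = complex_of_real (L\<^sup>2)" by (rule hinner_cls[OF Z Z])
  moreover have "L \<ge> 0"
    by (rule LIMSEQ_le_const[OF lim]) (use C_V[OF X] y nm_nonneg in auto)
  ultimately show ?thesis unfolding hdist_def Let_def z by simp
qed

text \<open>Linear combinations that approximate the terms of a Cauchy sequence also approximate its
  class, so it suffices to span the uncompleted space up to null vectors.\<close>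

lemma orthogonal_basis_completion:
  assumes b: "\<And>i. i \<in> I \<Longrightarrow> b i \<in> V" "\<And>i. i \<in> I \<Longrightarrow> ip (b i) (b i) \<noteq> 0"
    and orth: "\<And>i j. i \<in> I \<Longrightarrow> j \<in> I \<Longrightarrow> i \<noteq> j \<Longrightarrow> ip (b i) (b j) = 0"
    and dense: "\<And>x. x \<in> V \<Longrightarrow> \<exists>y\<in>span (b ` I). nm (x - y) = 0"
  shows "orthogonal_basis H I (\<lambda>i. emb (b i))"
  unfolding orthogonal_basis_def
proof (intro conjI ballI impI allI)
  fix i assume i: "i \<in> I"
  show "emb (b i) \<in> hcarrier H"
    unfolding emb_eq by (simp add: completion_def) (rule quotientI[OF C_const[OF b(1)[OF i]]])
  show "emb (b i) \<noteq> hzero H"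
  proof
    assume "emb (b i) = hzero H"
    then have "hinner H (emb (b i)) (emb (b i)) = hinner H (emb 0) (emb 0)"
      by (simp add: completion_def)
    then have "ip (b i) (b i) = ip 0 0" using b(1)[OF i] by (simp add: hinner_emb)
    then show False using b(2)[OF i] ip_self[of 0] by simp
  qed
  show "hinner H (emb (b i)) (emb (b j)) = 0" if "j \<in> I" "i \<noteq> j" for j
    using orth[OF i that] b(1) i that(1) by (simp add: hinner_emb)
next
  fix \<xi> and \<epsilon> :: real assume "\<xi> \<in> hcarrier H" and e: "\<epsilon> > 0"
  then obtain X where X: "X \<in> C" "\<xi> = cls X" by (auto simp: completion_def elim!: quotientE)
  obtain M where M: "\<forall>m\<ge>M. \<forall>k\<ge>M. nm (X m - X k) < \<epsilon> / 2"
    using C_cauchy[OF X(1) half_gt_zero[OF e]] by (rule exE)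
  obtain y where y: "y \<in> span (b ` I)" "nm (X M - y) = 0" using dense[OF C_V[OF X(1)]] by blast
  have yV: "y \<in> V" and hy: "emb y \<in> hspan H ((\<lambda>i. emb (b i)) ` I)"
    using emb_span[OF _ y(1)] b(1) by auto
  have "(\<lambda>k. X k + s (- 1) y) \<in> C" by (rule C_add[OF X(1) C_const]) (simp add: yV)
  from nm_convergent[OF this] obtain L where L: "(\<lambda>k. nm (X k - y)) \<longlonglongrightarrow> L"
    by (auto simp: convergent_def)
  have "nm (X k - y) \<le> \<epsilon> / 2" if "k \<ge> M" for k
    using nm_triangle_diff[of "X k" "X M" y] M[rule_format, of k M] that y(2) C_V[OF X(1)] yV by simp
  then have "L \<le> \<epsilon> / 2" using LIMSEQ_le_const2[OF L] by blast
  then have "hdist H \<xi> (emb y) < \<epsilon>" using hdist_emb[OF X(1) yV L] X(2) e by simp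
  then show "\<exists>y\<in>hspan H ((\<lambda>i. emb (b i)) ` I). hdist H \<xi> y < \<epsilon>" using hy by blast
qed

end

section \<open>Chaos decomposition\<close>

lemma chi_q_add: "chi_q q n (x + y) = chi_q q n x + chi_q q n y"
  by (simp add: chi_q_def sum.distrib distrib_right)
lemma chi_q_scale: "chi_q q n (gscale c x) = c * chi_q q n x"
  by (simp add: chi_q_def gscale_def sum_distrib_left mult.assoc)
lemma chi_q_0: "chi_q q n 0 = 0"
  by (simp add: chi_q_def)

lemma q_inner_superset:
  assumes "finite S" "{n. f n \<noteq> 0} \<subseteq> S"
  shows "q_inner q f g = (\<Sum>n\<in>S. fact n * chi_q q n (gmul {0..n} (f n) (gadj {0..n} (g n))))"
  unfolding q_inner_def
proof (rule sum.mono_neutral_left[OF assms], intro ballI)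
  fix n assume "n \<in> S - {n. f n \<noteq> 0}"
  then have "f n = 0" by simp
  then show "fact n * chi_q q n (gmul {0..n} (f n) (gadj {0..n} (g n))) = 0"
    by (simp only: ground.mul_0_left[OF ground.intro[OF finite_atLeastAtMost]] chi_q_0 mult_zero_right)
qed

lemma subspace_TP: "tvs.subspace TP"
proof (rule tvs.subspaceI)
  note sub = rel_pair.subspace_rel_center[OF is_rel_pair]
  show "0 \<in> TP" using gvs.subspace_0[OF sub] by (simp add: TP_def)
  show "f + g \<in> TP" if "f \<in> TP" "g \<in> TP" for f g
  proof -
    have "{n. (f + g) n \<noteq> 0} \<subseteq> {n. f n \<noteq> 0} \<union> {n. g n \<noteq> 0}" by auto
    then have "finite {n. (f + g) n \<noteq> 0}"
      by (rule finite_subset) (use that in \<open>simp add: TP_def\<close>)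
    then show ?thesis using that gvs.subspace_add[OF sub] by (simp add: TP_def)
  qed
  show "tscale c f \<in> TP" if "f \<in> TP" for c f
  proof -
    have "{n. tscale c f n \<noteq> 0} \<subseteq> {n. f n \<noteq> 0}" by (auto simp: tscale_def)
    then have "finite {n. tscale c f n \<noteq> 0}"
      by (rule finite_subset) (use that in \<open>simp add: TP_def\<close>)
    then show ?thesis using that gvs.subspace_scale[OF sub] by (simp add: TP_def tscale_def)
  qed
qed

lemma TP_finite: "f \<in> TP \<Longrightarrow> finite {n. f n \<noteq> 0}"
  by (simp add: TP_def)

lemma semi_inner_q:
  assumes N: "N \<ge> 1" shows "semi_inner tscale TP (q_inner (1 / real N))"
proof
  show "tvs.subspace TP" by (rule subspace_TP)
  let ?q = "1 / real N"
  fix f g h :: tp and c :: complex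
  note g = ground.intro[OF finite_atLeastAtMost]
  note [simp] = ground.mul_add_left[OF g] ground.mul_scale_left[OF g] chi_q_add chi_q_scale
  {
    assume fg: "f \<in> TP" "g \<in> TP"
    let ?S = "{n. f n \<noteq> 0} \<union> {n. g n \<noteq> 0}"
    have S: "finite ?S" using fg TP_finite by simp
    have "q_inner ?q (f + g) h =
        (\<Sum>n\<in>?S. fact n * chi_q ?q n (gmul {0..n} ((f + g) n) (gadj {0..n} (h n))))"
      by (rule q_inner_superset[OF S]) auto
    also have "\<dots> = (\<Sum>n\<in>?S. fact n * chi_q ?q n (gmul {0..n} (f n) (gadj {0..n} (h n)))) +
        (\<Sum>n\<in>?S. fact n * chi_q ?q n (gmul {0..n} (g n) (gadj {0..n} (h n))))"
      by (simp add: sum.distrib distrib_left)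
    also have "\<dots> = q_inner ?q f h + q_inner ?q g h"
      using q_inner_superset[OF S, of f] q_inner_superset[OF S, of g] by simp
    finally show "q_inner ?q (f + g) h = q_inner ?q f h + q_inner ?q g h" .
  }
  {
    assume f: "f \<in> TP"
    have "q_inner ?q (tscale c f) h =
        (\<Sum>n | f n \<noteq> 0. fact n * chi_q ?q n (gmul {0..n} (tscale c f n) (gadj {0..n} (h n))))"
      by (rule q_inner_superset[OF TP_finite[OF f]]) (auto simp: tscale_def)
    also have "\<dots> = c * q_inner ?q f h"
      by (simp add: q_inner_def tscale_def sum_distrib_left mult.left_commute)
    finally show "q_inner ?q (tscale c f) h = c * q_inner ?q f h" .
  }
  {
    assume fg: "f \<in> TP" "g \<in> TP"
    let ?S = "{n. f n \<noteq> 0} \<union> {n. g n \<noteq> 0}"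
    have S: "finite ?S" using fg TP_finite by simp
    have "chi_q ?q n (gmul {0..n} (g n) (gadj {0..n} (f n))) =
        cnj (chi_q ?q n (gmul {0..n} (f n) (gadj {0..n} (g n))))" for n
      by (simp add: rel_pair.chi_q_gram[OF is_rel_pair N] mult.commute)
    then show "q_inner ?q g f = cnj (q_inner ?q f g)"
      using q_inner_superset[OF S, of f] q_inner_superset[OF S, of g] by (simp add: cnj_sum)
  }
  {
    assume f: "f \<in> TP"
    show "0 \<le> Re (q_inner ?q f f)"
      unfolding q_inner_def Re_sum
    proof (rule sum_nonneg)
      fix n
      have "fact n = complex_of_real (fact n)" by simp
      then show "0 \<le> Re (fact n * chi_q ?q n (gmul {0..n} (f n) (gadj {0..n} (f n))))"
        unfolding rel_pair.chi_q_norm[OF is_rel_pair N]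
        by (simp only: of_real_mult[symmetric] Re_complex_of_real) (simp add: sum_nonneg)
    qed
  }
qed

lemma in_degree_add: "in_degree n (x + y) = in_degree n x + in_degree n y"
  by (auto simp: in_degree_def fun_eq_iff)
lemma in_degree_scale: "in_degree n (gscale c x) = tscale c (in_degree n x)"
  by (auto simp: in_degree_def tscale_def fun_eq_iff)
lemma in_degree_0: "in_degree n 0 = 0"
  by (auto simp: in_degree_def fun_eq_iff)

lemma chaos_TP:
  assumes "p \<in> box_pairs" shows "chaos_elt p \<in> TP"
proof -
  obtain n \<mu> \<nu> where p: "p = (n, \<mu>, \<nu>)" "\<mu> \<in> Par n" "\<nu> \<in> Par (n + 1)" "adds_box \<mu> \<nu>"
    using assms by (auto simp: box_pairs_def)
  interpret rel_pair n by (rule is_rel_pair)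
  obtain c where "rel_char_elt n \<mu> \<nu> = gscale c (block \<mu> \<nu>)" using rel_char_elt_eq[OF p(2-4)] by blast
  then have "rel_char_elt n \<mu> \<nu> \<in> rel_center n"
    using gvs.subspace_scale[OF subspace_rel_center block_rel_center[OF p(2,3)]] by simp
  moreover have "0 \<in> rel_center m" for m
    by (rule gvs.subspace_0[OF rel_pair.subspace_rel_center[OF is_rel_pair]])
  moreover have "finite {m. in_degree n x m \<noteq> 0}" for x
    by (rule finite_subset[of _ "{n}"]) (auto simp: in_degree_def)
  ultimately show ?thesis by (simp add: p(1) TP_def) (simp add: in_degree_def)
qed

lemma chaos_span: "tvs.span (chaos_elt ` box_pairs) = TP"
proof
  show "tvs.span (chaos_elt ` box_pairs) \<subseteq> TP"
    by (rule tvs.span_minimal[OF _ subspace_TP]) (use chaos_TP in blast)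
  let ?S = "tvs.span (chaos_elt ` box_pairs)"
  have deg: "in_degree n x \<in> ?S" if x: "x \<in> rel_center n" for n x
  proof -
    interpret rel_pair n by (rule is_rel_pair)
    have "gvs.subspace {x. in_degree n x \<in> ?S}"
      by (rule gvs.subspaceI)
         (auto simp: in_degree_0 in_degree_add in_degree_scale tvs.span_zero
           intro: tvs.span_add tvs.span_scale)
    moreover have "block_of ` shapes \<subseteq> {x. in_degree n x \<in> ?S}"
    proof
      fix y assume "y \<in> block_of ` shapes"
      then obtain p where p: "p \<in> shapes" "y = block_of p" by blast
      from p(1) obtain \<mu> \<nu> where q: "p = (n, \<mu>, \<nu>)" "\<mu> \<in> Par n" "\<nu> \<in> Par (n + 1)" "adds_box \<mu> \<nu>"
          "block_of p = block \<mu> \<nu>"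
        by (rule shapesE)
      obtain c where c: "c \<noteq> 0" "rel_char_elt n \<mu> \<nu> = gscale c (block \<mu> \<nu>)"
        using rel_char_elt_eq[OF q(2-4)] by blast
      then have "y = gscale (1 / c) (rel_char_elt n \<mu> \<nu>)" using p(2) q(5) by simp
      then have "in_degree n y = tscale (1 / c) (chaos_elt p)" by (simp add: in_degree_scale q(1))
      moreover have "chaos_elt p \<in> ?S"
        using p(1) by (intro tvs.span_base) (auto simp: shapes_def)
      ultimately show "y \<in> {x. in_degree n x \<in> ?S}" by (simp add: tvs.span_scale)
    qed
    ultimately show ?thesis using x gvs.span_minimal unfolding rel_center_span by blast
  qed
  show "TP \<subseteq> ?S"
  proof
    fix f assume f: "f \<in> TP"
    have "f = (\<Sum>n | f n \<noteq> 0. in_degree n (f n))"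
    proof
      fix m
      have app: "(\<Sum>n\<in>S. in_degree n (f n)) m = (\<Sum>n\<in>S. in_degree n (f n) m)" for S
        by (induction S rule: infinite_finite_induct) simp_all
      have "(\<Sum>n | f n \<noteq> 0. in_degree n (f n) m) = (\<Sum>n | f n \<noteq> 0. if n = m then f n else 0)"
        by (rule sum.cong) (auto simp: in_degree_def)
      also have "\<dots> = f m" using TP_finite[OF f] by (simp add: sum.delta)
      finally show "f m = (\<Sum>n | f n \<noteq> 0. in_degree n (f n)) m" by (simp only: app)
    qed
    also have "\<dots> \<in> ?S" using f by (intro tvs.span_sum deg) (simp add: TP_def)
    finally show "f \<in> ?S" .
  qed
qed

lemma q_inner_chaos:
  "q_inner q (chaos_elt (n, \<mu>, \<nu>)) g =
    fact n * chi_q q n (gmul {0..n} (rel_char_elt n \<mu> \<nu>) (gadj {0..n} (g n)))"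
proof -
  have "q_inner q (chaos_elt (n, \<mu>, \<nu>)) g = (\<Sum>m\<in>{n}. fact m *
      chi_q q m (gmul {0..m} (chaos_elt (n, \<mu>, \<nu>) m) (gadj {0..m} (g m))))"
    by (rule q_inner_superset) (auto simp: in_degree_def)
  then show ?thesis by (simp add: in_degree_def)
qed

lemma chaos_orthogonal:
  assumes i: "i \<in> box_pairs" and j: "j \<in> box_pairs" and "i \<noteq> j"
  shows "q_inner q (chaos_elt i) (chaos_elt j) = 0"
proof -
  obtain n \<mu> \<nu> where p: "i = (n, \<mu>, \<nu>)" "\<mu> \<in> Par n" "\<nu> \<in> Par (n + 1)" "adds_box \<mu> \<nu>"
    using i by (auto simp: box_pairs_def)
  obtain m \<mu>' \<nu>' where p': "j = (m, \<mu>', \<nu>')" "\<mu>' \<in> Par m" "\<nu>' \<in> Par (m + 1)" "adds_box \<mu>' \<nu>'"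
    using j by (auto simp: box_pairs_def)
  interpret rel_pair n by (rule is_rel_pair)
  have "gmul {0..n} (rel_char_elt n \<mu> \<nu>) (gadj {0..n} (chaos_elt j n)) = 0"
  proof (cases "m = n")
    case True
    note p'' = p'(2-4)[unfolded True]
    obtain c where c: "rel_char_elt n \<mu> \<nu> = gscale c (block \<mu> \<nu>)" using rel_char_elt_eq[OF p(2-4)] by blast
    obtain c' where c': "rel_char_elt n \<mu>' \<nu>' = gscale c' (block \<mu>' \<nu>')" using rel_char_elt_eq[OF p''] by blast
    have "block \<mu> \<nu> \<odot> block \<mu>' \<nu>' = 0"
      using block_mul_block[OF p(2,3) p''(1,2)] \<open>i \<noteq> j\<close> p(1) p'(1) True by auto
    then show ?thesis
      using True p'(1) by (simp only: p'(1) chaos_elt.simps in_degree_def True c c' simp_thms if_True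
          adj_scale block_adj[OF p''(1,2)] mul_scale_left mul_scale_right gvs.scale_zero_right)
  next
    case False
    then have "chaos_elt j n = 0" by (simp add: p'(1) in_degree_def)
    then show ?thesis by (simp only: adj_0 mul_0_right)
  qed
  then show ?thesis by (simp only: p(1) q_inner_chaos chi_q_0 mult_zero_right)
qed

lemma chaos_norm_eq_0:
  assumes "(n, \<mu>, \<nu>) \<in> box_pairs" "N \<ge> 1"
  shows "q_inner (1 / real N) (chaos_elt (n, \<mu>, \<nu>)) (chaos_elt (n, \<mu>, \<nu>)) = 0 \<longleftrightarrow> N < length \<nu>"
proof -
  have "chaos_elt (n, \<mu>, \<nu>) n = rel_char_elt n \<mu> \<nu>" by (simp add: in_degree_def)
  moreover have "\<mu> \<in> Par n" "\<nu> \<in> Par (n + 1)" "adds_box \<mu> \<nu>"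
    using assms(1) by (auto simp: box_pairs_def)
  ultimately show ?thesis
    using rel_pair.rel_char_elt_norm[OF is_rel_pair, of \<mu> n \<nu> N] assms(2)
    by (simp only: q_inner_chaos mult_eq_0_iff fact_nonzero simp_thms)
qed

lemma box_pairs_le_iff: "(n, \<mu>, \<nu>) \<in> box_pairs_le N \<longleftrightarrow> (n, \<mu>, \<nu>) \<in> box_pairs \<and> length \<nu> \<le> N"
  by (auto simp: box_pairs_le_def box_pairs_def Par_le_def)

lemma chaos_basis:
  assumes N: "N \<ge> 1"
  shows "orthogonal_basis (Fock (1 / real N)) (box_pairs_le N)
    (\<lambda>i. Fock_embed (1 / real N) (chaos_elt i))"
proof -
  interpret semi_inner tscale TP "q_inner (1 / real N)" by (rule semi_inner_q[OF N])
  have le: "i \<in> box_pairs" if "i \<in> box_pairs_le N" for i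
    using that by (cases i) (simp add: box_pairs_le_iff)
  show ?thesis unfolding Fock_def Fock_embed_def
  proof (rule orthogonal_basis_completion)
    fix i assume i: "i \<in> box_pairs_le N"
    show "chaos_elt i \<in> TP" by (rule chaos_TP[OF le[OF i]])
    show "q_inner (1 / real N) (chaos_elt i) (chaos_elt i) \<noteq> 0"
      using i chaos_norm_eq_0[OF _ N] by (cases i) (simp add: box_pairs_le_iff del: chaos_elt.simps)
    show "q_inner (1 / real N) (chaos_elt i) (chaos_elt j) = 0" if "j \<in> box_pairs_le N" "i \<noteq> j" for j
      by (rule chaos_orthogonal[OF le[OF i] le[OF that(1)] that(2)])
  next
    fix x assume "x \<in> TP"
    then have "x \<in> tvs.span (chaos_elt ` box_pairs)" by (simp only: chaos_span)
    then have "x \<in> TP \<and> (\<exists>y\<in>tvs.span (chaos_elt ` box_pairs_le N). y \<in> TP \<and> nm (x - y) = 0)"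
    proof (induction rule: tvs.span_induct_alt)
      case base
      then show ?case using tvs.span_zero V_0 nm_0 by (metis diff_zero)
    next
      case (step c u v)
      obtain i where i: "i \<in> box_pairs" "u = chaos_elt i" using step(1) by blast
      have u: "u \<in> TP" using chaos_TP[OF i(1)] i(2) by simp
      obtain v' where v': "v' \<in> tvs.span (chaos_elt ` box_pairs_le N)" "v' \<in> TP" "nm (v - v') = 0"
        using step by blast
      have "\<exists>u'\<in>tvs.span (chaos_elt ` box_pairs_le N). u' \<in> TP \<and> nm (u - u') = 0"
      proof (cases "i \<in> box_pairs_le N")
        case True
        then have "u \<in> tvs.span (chaos_elt ` box_pairs_le N)" using i(2) by (simp add: tvs.span_base)
        then show ?thesis using u nm_0 by (metis diff_self)
      next
        case False
        then have "q_inner (1 / real N) u u = 0"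
          using chaos_norm_eq_0[OF _ N] i by (cases i) (simp add: box_pairs_le_iff del: chaos_elt.simps)
        then have "nm (u - 0) = 0" by (simp add: semi_norm_def)
        then show ?thesis using tvs.span_zero V_0 by blast
      qed
      then obtain u' where u': "u' \<in> tvs.span (chaos_elt ` box_pairs_le N)" "u' \<in> TP" "nm (u - u') = 0"
        by blast
      have eq: "tscale c u + v - (tscale c u' + v') = tscale c (u - u') + (v - v')"
        by (simp add: tvs.scale_right_diff_distrib)
      have v: "v \<in> TP" using step by blast
      have "nm (tscale c u + v - (tscale c u' + v')) \<le> nm (tscale c (u - u')) + nm (v - v')"
        unfolding eq by (intro nm_triangle V_scale V_diff u u'(2) v v'(2))
      also have "\<dots> = 0" using nm_scale[of "u - u'" c] u u' v' by simp
      finally have "nm (tscale c u + v - (tscale c u' + v')) = 0"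
        using nm_nonneg[OF V_diff[OF V_add[OF V_scale[OF u] v] V_add[OF V_scale[OF u'(2)] v'(2)]], of c c]
        by (rule antisym)
      moreover have "tscale c u' + v' \<in> tvs.span (chaos_elt ` box_pairs_le N)"
        using u' v' by (intro tvs.span_add tvs.span_scale)
      ultimately show ?case
        using V_add[OF V_scale[OF u] v] V_add[OF V_scale[OF u'(2)] v'(2)] by blast
    qed
    then show "\<exists>y\<in>tvs.span (chaos_elt ` box_pairs_le N). nm (x - y) = 0" by blast
  qed
qed

theorem mainTheorem5:
  shows "(\<forall>q\<in>Zset. \<forall>i\<in>box_pairs. \<forall>j\<in>box_pairs. i \<noteq> j \<longrightarrow>
            q_inner q (chaos_elt i) (chaos_elt j) = 0) \<and>
         tvs.span (chaos_elt ` box_pairs) = TP \<and>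
         (\<forall>N::nat. N \<ge> 1 \<longrightarrow>
            orthogonal_basis (Fock (1 / real N)) (box_pairs_le N)
              (\<lambda>i. Fock_embed (1 / real N) (chaos_elt i)))"
  using chaos_orthogonal chaos_span chaos_basis by blast

end
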